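(* Let $\alpha>-1$ and let $\varphi$ be a nonnegative bounded measurable function on $\mathbb{D}$. The following four conditions are equivalent: (1) $\mathbb{T}_\varphi$ is invertible on $L_a^2(\omega_\alpha)$; (2) $T_\varphi$ is invertible on $L_h^2(\omega_\alpha)$; (3) $\widehat{\varphi}$ is invertible in $L^\infty(\omega_\alpha)$; (4) $\widetilde{\varphi}$ is invertible in $L^\infty(\omega_\alpha)$.
   Context: $\mathbb{D}$ is the open unit disk in $\mathbb{C}$, $dA$ is Lebesgue area measure on $\mathbb{D}$ normalized so that $\mathbb{D}$ has measure $1$. For $\alpha>-1$, $\omega_\alpha(z)=(1+\alpha)(1-|z|^2)^\alpha$. $L^\infty(\omega_\alpha)$ is the algebra of essentially bounded measurable functions on $\mathbb{D}$. $L_a^2(\omega_\alpha)$ (resp. $L_h^2(\omega_\alpha)$) is the Hilbert space of analytic (resp. complex-valued harmonic) functions on $\mathbb{D}$ with $\|f\|^2_{L^2(\omega_\alpha)}=\int_{\mathbb{D}}|f|^2\omega_\alpha\,dA<\infty$. Their reproducing kernels are $K_z^\alpha(\lambda)=(1-\overline{z}\lambda)^{-(2+\alpha)}$ and $R_z^\alpha(\lambda)=K_z^\alpha(\lambda)+\overline{K_z^\alpha(\lambda)}-1$ respectively. For bounded $\varphi$, $\mathbb{T}_\varphi$ (resp. $T_\varphi$) is the Toeplitz operator on $L_a^2(\omega_\alpha)$ (resp. $L_h^2(\omega_\alpha)$) sending $f$ to the orthogonal projection of $\varphi f$ from $L^2(\omega_\alpha)$ onto $L_a^2(\omega_\alpha)$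 (resp. $L_h^2(\omega_\alpha)$). The Berezin transforms are $$\widehat{\varphi}(z)=\frac{1}{\|K^\alpha_z\|^2_{L^2(\omega_\alpha)}}\int_{\mathbb{D}}\varphi|K^\alpha_z|^2\omega_\alpha\,dA,\qquad \widetilde{\varphi}(z)=\frac{1}{\|R^\alpha_z\|^2_{L^2(\omega_\alpha)}}\int_{\mathbb{D}}\varphi|R^\alpha_z|^2\omega_\alpha\,dA.$$ *)

theory Defs
  imports "HOL-Analysis.Analysis"
begin

abbreviation unit_disk :: "complex set" where
  "unit_disk \<equiv> ball 0 1"

definition disk_area :: "complex measure" where
  "disk_area = density (lebesgue_on unit_disk) (\<lambda>_. ennreal (1 / pi))"

lemma emeasure_disk_area: "emeasure disk_area unit_disk = 1"
proof -
  have "emeasure lborel unit_disk = ennreal pi"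
    using emeasure_ball[of 1 "0::complex"] by (simp add: unit_ball_vol_2)
  then have "emeasure (lebesgue_on unit_disk) unit_disk = ennreal pi"
    by (simp add: emeasure_restrict_space)
  then have "emeasure disk_area unit_disk = ennreal (1 / pi) * ennreal pi"
    unfolding disk_area_def
    by (subst emeasure_density_const) (auto simp: sets_restrict_space)
  also have "\<dots> = 1"
    by (simp flip: ennreal_mult)
  finally show ?thesis .
qed

definition disk_weight :: "real \<Rightarrow> complex \<Rightarrow> real" where
  "disk_weight \<alpha> z = (1 + \<alpha>) * (1 - (cmod z)\<^sup>2) powr \<alpha>"

definition weighted_area :: "real \<Rightarrow> complex measure" where
  "weighted_area \<alpha> = density disk_area (\<lambda>z. ennreal (disk_weight \<alpha> z))"


definition L2_fun :: "complex measure \<Rightarrow> (complex \<Rightarrow> complex) set" where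
  "L2_fun M = {f \<in> borel_measurable M. integrable M (\<lambda>z. (cmod (f z))\<^sup>2)}"

definition L2_inner :: "complex measure \<Rightarrow> (complex \<Rightarrow> complex) \<Rightarrow> (complex \<Rightarrow> complex) \<Rightarrow> complex" where
  "L2_inner M f g = (LINT z|M. f z * cnj (g z))"

definition L2_norm :: "complex measure \<Rightarrow> (complex \<Rightarrow> complex) \<Rightarrow> real" where
  "L2_norm M f = sqrt (LINT z|M. (cmod (f z))\<^sup>2)"

definition Linfty_fun :: "complex measure \<Rightarrow> (complex \<Rightarrow> complex) set" where
  "Linfty_fun M = {f \<in> borel_measurable M. \<exists>C::real. AE z in M. cmod (f z) \<le> C}"

definition invertible_Linfty :: "complex measure \<Rightarrow> (complex \<Rightarrow> complex) \<Rightarrow> bool" where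
  "invertible_Linfty M f \<longleftrightarrow>
     f \<in> Linfty_fun M \<and> (\<exists>g \<in> Linfty_fun M. AE z in M. f z * g z = 1)"


text \<open>Complex-valued harmonic functions: twice continuously (real) differentiable
  with vanishing Laplacian.\<close>

definition partial_x :: "(complex \<Rightarrow> complex) \<Rightarrow> complex \<Rightarrow> complex" where
  "partial_x f z = vector_derivative (\<lambda>t. f (z + of_real t)) (at 0)"

definition partial_y :: "(complex \<Rightarrow> complex) \<Rightarrow> complex \<Rightarrow> complex" where
  "partial_y f z = vector_derivative (\<lambda>t. f (z + \<i> * of_real t)) (at 0)"

definition C1_on :: "complex set \<Rightarrow> (complex \<Rightarrow> complex) \<Rightarrow> bool" where
  "C1_on S f \<longleftrightarrow>
     continuous_on S f \<and>
     (\<forall>z\<in>S. (\<lambda>t::real. f (z + of_real t)) differentiable (at 0) \<and>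
            (\<lambda>t::real. f (z + \<i> * of_real t)) differentiable (at 0)) \<and>
     continuous_on S (partial_x f) \<and> continuous_on S (partial_y f)"

definition C2_on :: "complex set \<Rightarrow> (complex \<Rightarrow> complex) \<Rightarrow> bool" where
  "C2_on S f \<longleftrightarrow> C1_on S f \<and> C1_on S (partial_x f) \<and> C1_on S (partial_y f)"

definition laplacian :: "(complex \<Rightarrow> complex) \<Rightarrow> complex \<Rightarrow> complex" where
  "laplacian f z = partial_x (partial_x f) z + partial_y (partial_y f) z"

definition harmonic_on :: "complex set \<Rightarrow> (complex \<Rightarrow> complex) \<Rightarrow> bool" where
  "harmonic_on S f \<longleftrightarrow> C2_on S f \<and> (\<forall>z\<in>S. laplacian f z = 0)"


text \<open>A function on the disk is represented by its extension by zero to the complex plane,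
  so that equality of functions on the disk is equality in HOL.\<close>

definition bergman_space :: "real \<Rightarrow> (complex \<Rightarrow> complex) set" where
  "bergman_space \<alpha> =
     {f. f holomorphic_on unit_disk \<and> (\<forall>z. z \<notin> unit_disk \<longrightarrow> f z = 0) \<and>
         f \<in> L2_fun (weighted_area \<alpha>)}"

definition harmonic_bergman_space :: "real \<Rightarrow> (complex \<Rightarrow> complex) set" where
  "harmonic_bergman_space \<alpha> =
     {f. harmonic_on unit_disk f \<and> (\<forall>z. z \<notin> unit_disk \<longrightarrow> f z = 0) \<and>
         f \<in> L2_fun (weighted_area \<alpha>)}"


definition orth_proj ::
  "complex measure \<Rightarrow> (complex \<Rightarrow> complex) set \<Rightarrow> (complex \<Rightarrow> complex) \<Rightarrow> complex \<Rightarrow> complex" where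
  "orth_proj M H f = (THE g. g \<in> H \<and> (\<forall>h\<in>H. L2_inner M (\<lambda>z. f z - g z) h = 0))"

definition toeplitz ::
  "real \<Rightarrow> (complex \<Rightarrow> complex) \<Rightarrow> (complex \<Rightarrow> complex) \<Rightarrow> complex \<Rightarrow> complex" where
  "toeplitz \<alpha> \<phi> f = orth_proj (weighted_area \<alpha>) (bergman_space \<alpha>) (\<lambda>z. \<phi> z * f z)"

definition harmonic_toeplitz ::
  "real \<Rightarrow> (complex \<Rightarrow> complex) \<Rightarrow> (complex \<Rightarrow> complex) \<Rightarrow> complex \<Rightarrow> complex" where
  "harmonic_toeplitz \<alpha> \<phi> f =
     orth_proj (weighted_area \<alpha>) (harmonic_bergman_space \<alpha>) (\<lambda>z. \<phi> z * f z)"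

definition bounded_operator_on ::
  "complex measure \<Rightarrow> (complex \<Rightarrow> complex) set \<Rightarrow>
     ((complex \<Rightarrow> complex) \<Rightarrow> complex \<Rightarrow> complex) \<Rightarrow> bool" where
  "bounded_operator_on M H T \<longleftrightarrow>
     (\<forall>f\<in>H. T f \<in> H) \<and>
     (\<forall>f\<in>H. \<forall>g\<in>H. T (\<lambda>z. f z + g z) = (\<lambda>z. T f z + T g z)) \<and>
     (\<forall>c. \<forall>f\<in>H. T (\<lambda>z. c * f z) = (\<lambda>z. c * T f z)) \<and>
     (\<exists>C. \<forall>f\<in>H. L2_norm M (T f) \<le> C * L2_norm M f)"

definition invertible_operator_on ::
  "complex measure \<Rightarrow> (complex \<Rightarrow> complex) set \<Rightarrow>
     ((complex \<Rightarrow> complex) \<Rightarrow> complex \<Rightarrow> complex) \<Rightarrow> bool" where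
  "invertible_operator_on M H T \<longleftrightarrow>
     bounded_operator_on M H T \<and>
     (\<exists>S. bounded_operator_on M H S \<and> (\<forall>f\<in>H. S (T f) = f \<and> T (S f) = f))"


text \<open>For \<open>z\<close> and \<open>w\<close> in the disk, \<open>1 - cnj z * w\<close> lies in the right half-plane, where
  the principal branch used by \<open>powr\<close> is holomorphic.\<close>

definition bergman_kernel :: "real \<Rightarrow> complex \<Rightarrow> complex \<Rightarrow> complex" where
  "bergman_kernel \<alpha> z w = (1 - cnj z * w) powr (- complex_of_real (2 + \<alpha>))"

definition harmonic_bergman_kernel :: "real \<Rightarrow> complex \<Rightarrow> complex \<Rightarrow> complex" where
  "harmonic_bergman_kernel \<alpha> z w = bergman_kernel \<alpha> z w + cnj (bergman_kernel \<alpha> z w) - 1"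

definition berezin :: "real \<Rightarrow> (complex \<Rightarrow> complex) \<Rightarrow> complex \<Rightarrow> complex" where
  "berezin \<alpha> \<phi> z =
     (LINT w|weighted_area \<alpha>. \<phi> w * of_real ((cmod (bergman_kernel \<alpha> z w))\<^sup>2)) /
     of_real ((L2_norm (weighted_area \<alpha>) (bergman_kernel \<alpha> z))\<^sup>2)"

definition harmonic_berezin :: "real \<Rightarrow> (complex \<Rightarrow> complex) \<Rightarrow> complex \<Rightarrow> complex" where
  "harmonic_berezin \<alpha> \<phi> z =
     (LINT w|weighted_area \<alpha>. \<phi> w * of_real ((cmod (harmonic_bergman_kernel \<alpha> z w))\<^sup>2)) /
     of_real ((L2_norm (weighted_area \<alpha>) (harmonic_bergman_kernel \<alpha> z))\<^sup>2)"

end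

theory Submission
  imports Defs "HOL-Complex_Analysis.Complex_Analysis"
begin

text \<open>Since \<open>\<phi>\<close> is nonnegative, either Toeplitz operator is invertible iff its quadratic form
  \<open>\<integral> \<phi> |f|\<^sup>2\<close> dominates a multiple of \<open>\<parallel>f\<parallel>\<^sup>2\<close> on the space in question. Testing this on the kernels
  bounds the Berezin transforms from below, and \<open>|R\<^sub>z| \<le> C |K\<^sub>z|\<close> together with
  \<open>\<parallel>K\<^sub>z\<parallel> \<le> \<parallel>R\<^sub>z\<parallel>\<close> shows that the harmonic transform is at most a multiple of the analytic one.
  It remains to pass from a lower bound of the analytic Berezin transform to the quadratic form on
  harmonic functions. By Moebius invariance that transform at \<open>z\<close> is the mean of \<open>\<phi>\<close> composed with
  the disk automorphism exchanging \<open>0\<close> and \<open>z\<close>, so \<open>\<phi>\<close> has mass bounded below on all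
  pseudohyperbolic disks of some fixed radius. If the mass of \<open>|f|\<^sup>2\<close> does not grow too much from such
  a disk to a larger one, a normal family argument bounds \<open>\<integral> \<phi> |f|\<^sup>2\<close> over the disk from below,
  because the zero set of a nonzero harmonic function is a null set. Averaging over all disks,
  those with large growth contribute at most half of the total mass (Luecking's argument).\<close>

section \<open>Change of variables under holomorphic maps\<close>

text \<open>A lower bound of the Berezin transform tests the quadratic form on normalised kernels
  only, and the symbol may vanish on sets of positive measure, so no pointwise comparison of
  \<open>\<phi> * |f|^2\<close> with \<open>|f|^2\<close> is available. The growth condition is what
  makes the problem compact: a bound for the mass on the larger disk gives a convergent subsequence
  on the smaller one, and unit mass on the smaller one keeps the limit from vanishing. Composition
  with a disk automorphism preserves the form \<open>G + cnj H\<close>, so a single constant found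
  at the origin serves all centres; being obtained by contradiction, it is not explicit.

  Harmonic functions are handled through this splitting, normalised by \<open>H 0 = 0\<close>. Over
  rotation invariant weights the two parts are orthogonal, which transfers square integrability,
  completeness and normality from holomorphic functions. Proving the final estimate on harmonic
  functions also closes the circle of implications: the analytic space lies in the harmonic one, so
  a form bound on the latter restricts to the former.\<close>

definition complex_of_vec :: "real^2 \<Rightarrow> complex" where
  "complex_of_vec v = Complex (v $ 1) (v $ 2)"

definition vec_of_complex :: "complex \<Rightarrow> real^2" where
  "vec_of_complex z = vector [Re z, Im z]"

lemma complex_vec_inverse [simp]:
  "complex_of_vec (vec_of_complex z) = z" "vec_of_complex (complex_of_vec v) = v"
  by (auto simp: complex_of_vec_def vec_of_complex_def vec_eq_iff forall_2)

lemma vec_of_complex_eq_iff: "v = vec_of_complex z \<longleftrightarrow> complex_of_vec v = z"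
  by (metis complex_vec_inverse)

lemma bounded_linear_complex_of_vec: "bounded_linear complex_of_vec"
  unfolding linear_conv_bounded_linear[symmetric]
  by (rule linearI) (auto simp: complex_of_vec_def complex_eq_iff)

lemma bounded_linear_vec_of_complex: "bounded_linear vec_of_complex"
  unfolding linear_conv_bounded_linear[symmetric]
  by (rule linearI) (auto simp: vec_of_complex_def vec_eq_iff forall_2)

lemma vec_of_complex_measurable [measurable]: "vec_of_complex \<in> borel_measurable borel"
  by (intro borel_measurable_continuous_onI linear_continuous_on bounded_linear_vec_of_complex)

lemma complex_of_vec_measurable [measurable]: "complex_of_vec \<in> borel_measurable borel"
  by (intro borel_measurable_continuous_onI linear_continuous_on bounded_linear_complex_of_vec)

text \<open>Lebesgue measure is determined by its values on boxes, and \<open>vec_of_complex\<close>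
  matches boxes with boxes of the same side lengths. The identification is wanted because the change
  of variables theorem applied below is formulated on \<open>real^2\<close> with a
  determinant.\<close>

lemma lborel_distr_vec_of_complex: "lborel = distr lborel borel vec_of_complex"
proof (rule lborel_eqI)
  fix l u :: "real^2"
  assume le: "\<And>b. b \<in> Basis \<Longrightarrow> l \<bullet> b \<le> u \<bullet> b"
  have vB: "(Basis :: (real^2) set) = {axis 1 1, axis 2 1}"
    by (auto simp: Basis_vec_def UNIV_2)
  have ax: "axis 1 (1::real) \<noteq> (axis 2 1 :: real^2)"
    by (simp add: axis_eq_axis)
  have "vec_of_complex -` box l u = box (complex_of_vec l) (complex_of_vec u)"
    by (auto simp: box_def vB inner_axis complex_of_vec_def vec_of_complex_def Basis_complex_def)
  then have "emeasure (distr lborel borel vec_of_complex) (box l u) =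
      emeasure lborel (box (complex_of_vec l) (complex_of_vec u))"
    by (subst emeasure_distr) auto
  also have "\<dots> = (\<Prod>b\<in>Basis. (complex_of_vec u - complex_of_vec l) \<bullet> b)"
    using le[of "axis 1 1"] le[of "axis 2 1"] by (intro emeasure_lborel_box)
      (auto simp: vB inner_axis complex_of_vec_def Basis_complex_def)
  also have "\<dots> = (\<Prod>b\<in>Basis. (u - l) \<bullet> b)"
    using ax by (simp add: vB inner_axis complex_of_vec_def Basis_complex_def)
  finally show "emeasure (distr lborel borel vec_of_complex) (box l u) = (\<Prod>b\<in>Basis. (u - l) \<bullet> b)" .
qed simp

lemma nn_integral_complex_of_vec:
  assumes [measurable]: "F \<in> borel_measurable borel"
  shows "(\<integral>\<^sup>+v. F (complex_of_vec v) \<partial>lborel) = (\<integral>\<^sup>+z. F z \<partial>lborel)"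
  by (subst lborel_distr_vec_of_complex, subst nn_integral_distr) auto

text \<open>The real Jacobian determinant of a holomorphic map is the squared modulus of its
  derivative. Boundedness of the image gives it finite measure, so that the theorem on the measure
  of a differentiable injective image applies.\<close>

lemma emeasure_holomorphic_image:
  assumes U: "open U" and f: "f holomorphic_on U" and inj: "inj_on f U"
    and bd: "bounded (f ` U)" and B: "B \<in> sets borel" "B \<subseteq> U"
    and fB: "f ` B \<in> sets borel"
  shows "emeasure lborel (f ` B) = (\<integral>\<^sup>+z. indicator B z * ennreal ((cmod (deriv f z))\<^sup>2) \<partial>lborel)"
proof -
  let ?g = "\<lambda>v. vec_of_complex (f (complex_of_vec v))"
  let ?g' = "\<lambda>v h. vec_of_complex (deriv f (complex_of_vec v) * complex_of_vec h)"
  let ?S = "complex_of_vec -` B"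
  have Sb: "?S \<in> sets borel"
    using measurable_sets_borel[OF complex_of_vec_measurable B(1)] by simp
  have der: "(?g has_derivative ?g' v) (at v within ?S)" if "v \<in> ?S" for v
  proof -
    have "complex_of_vec v \<in> U" using that B by auto
    then have "(f has_field_derivative deriv f (complex_of_vec v)) (at (complex_of_vec v))"
      by (rule holomorphic_derivI[OF f U])
    then have "(f has_derivative (*) (deriv f (complex_of_vec v))) (at (complex_of_vec v))"
      by (simp add: has_field_derivative_def)
    then have "((\<lambda>v. f (complex_of_vec v)) has_derivative (\<lambda>h. deriv f (complex_of_vec v) * complex_of_vec h)) (at v)"
      using bounded_linear_imp_has_derivative[OF bounded_linear_complex_of_vec]
      by (rule has_derivative_compose[rotated])
    then have "(?g has_derivative ?g' v) (at v)"
      by (rule bounded_linear.has_derivative[OF bounded_linear_vec_of_complex])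
    then show ?thesis by (rule has_derivative_at_withinI)
  qed
  have injS: "inj_on ?g ?S"
  proof (rule inj_onI)
    fix v w assume "v \<in> ?S" "w \<in> ?S" "?g v = ?g w"
    then have "complex_of_vec v = complex_of_vec w"
      using inj B by (auto simp: vec_of_complex_eq_iff inj_on_def)
    then show "v = w" by (metis complex_vec_inverse(2))
  qed
  have img: "?g ` ?S = complex_of_vec -` (f ` B)"
  proof safe
    fix v z assume "complex_of_vec v = f z" "z \<in> B"
    then have "v = ?g (vec_of_complex z)" "vec_of_complex z \<in> ?S"
      by (simp_all add: vec_of_complex_eq_iff)
    then show "v \<in> ?g ` ?S" by (rule image_eqI)
  qed simp
  \<comment> \<open>Multiplication by a + ib has the real matrix with rows (a, -b) and (b, a), of
    determinant a^2 + b^2.\<close>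
  have det: "\<bar>det (matrix (?g' v))\<bar> = (cmod (deriv f (complex_of_vec v)))\<^sup>2" for v
    by (simp add: det_2 matrix_def complex_of_vec_def vec_of_complex_def axis_def cmod_def power2_eq_square)
  have imb: "?g ` ?S \<in> sets borel"
    unfolding img using measurable_sets_borel[OF complex_of_vec_measurable fB] by simp
  have "emeasure lborel (?g ` ?S) = emeasure (distr lborel borel vec_of_complex) (?g ` ?S)"
    by (simp only: lborel_distr_vec_of_complex[symmetric])
  also have "\<dots> = emeasure lborel (f ` B)"
  proof -
    have "vec_of_complex -` (?g ` ?S) = f ` B" unfolding img by auto
    then show ?thesis using imb by (subst emeasure_distr) auto
  qed
  finally have em: "emeasure lborel (f ` B) = emeasure lborel (?g ` ?S)" ..
  have fin: "emeasure lborel (f ` B) < \<infinity>"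
    using bd B by (intro emeasure_bounded_finite) (auto intro: bounded_subset)
  have lm: "?g ` ?S \<in> lmeasurable"
    using imb fin em by (intro fmeasurableI) auto
  have "((\<lambda>v. \<bar>det (matrix (?g' v))\<bar>) has_integral measure lebesgue (?g ` ?S)) ?S"
    using has_measure_differentiable_image[OF _ der injS, of "measure lebesgue (?g ` ?S)"] lm Sb by auto
  then have "((\<lambda>v. (cmod (deriv f (complex_of_vec v)))\<^sup>2) has_integral measure lebesgue (?g ` ?S)) ?S"
    by (simp only: det)
  then have "(\<integral>\<^sup>+v. ennreal (indicator ?S v * (cmod (deriv f (complex_of_vec v)))\<^sup>2) \<partial>lborel) = measure lebesgue (?g ` ?S)"
    by (intro nn_integral_has_integral_lebesgue) auto
  also have "ennreal (measure lebesgue (?g ` ?S)) = emeasure lborel (f ` B)"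
  proof -
    have "emeasure lebesgue (?g ` ?S) = emeasure lborel (f ` B)"
      using imb unfolding em by simp
    moreover have "emeasure lebesgue (?g ` ?S) = ennreal (measure lebesgue (?g ` ?S))"
      using lm by (intro emeasure_eq_ennreal_measure) (auto simp: fmeasurable_def)
    ultimately show ?thesis by (simp only:)
  qed
  finally have *: "emeasure lborel (f ` B) =
      (\<integral>\<^sup>+v. ennreal (indicator ?S v * (cmod (deriv f (complex_of_vec v)))\<^sup>2) \<partial>lborel)" ..
  \<comment> \<open>Nothing is known about \<open>deriv f\<close> off \<open>U\<close>; cutting it
    off by the indicator of \<open>U\<close> gives a Borel function and changes nothing on
    \<open>B\<close>.\<close>
  have [measurable]: "(\<lambda>z. indicator B z * ennreal ((cmod (deriv f z))\<^sup>2)) \<in> borel_measurable borel"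
  proof -
    have "continuous_on U (deriv f)"
      by (intro holomorphic_on_imp_continuous_on holomorphic_deriv f U)
    then have "(\<lambda>z. indicator U z *\<^sub>R deriv f z) \<in> borel_measurable borel"
      using U by (intro borel_measurable_continuous_on_indicator) auto
    then have m: "(\<lambda>z. indicator B z * ennreal ((cmod (indicator U z *\<^sub>R deriv f z))\<^sup>2)) \<in> borel_measurable borel"
      using B by measurable
    show ?thesis
      by (rule measurable_cong[THEN iffD2, OF _ m]) (use B in \<open>auto simp: indicator_def\<close>)
  qed
  show ?thesis
    unfolding * by (subst nn_integral_complex_of_vec[symmetric], measurable)
      (auto intro!: nn_integral_cong simp: indicator_def)
qed

text \<open>The set version says that two measures agree on every Borel set: Lebesgue measure on the
  image, and the push-forward of the Jacobian density. Hence the integrals of every nonnegative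
  Borel function agree.\<close>

lemma nn_integral_holomorphic_image:
  assumes U: "open U" and f: "f holomorphic_on U" and inj: "inj_on f U"
    and bd: "bounded (f ` U)" and [measurable]: "F \<in> borel_measurable borel"
  shows "(\<integral>\<^sup>+w. indicator (f ` U) w * F w \<partial>lborel) =
    (\<integral>\<^sup>+z. indicator U z * (F (f z) * ennreal ((cmod (deriv f z))\<^sup>2)) \<partial>lborel)"
proof -
  \<comment> \<open>Extension by 0 makes \<open>h\<close> Borel on the whole plane; the density
    \<open>k\<close> vanishes off \<open>U\<close>, so the extension carries no mass.\<close>
  define h where "h z = (if z \<in> U then f z else 0)" for z
  define k where "k z = ennreal (indicator U z * (cmod (deriv f z))\<^sup>2)" for z
  have [measurable]: "U \<in> sets borel" using U by auto
  have of: "open (f ` U)" by (rule open_mapping_thm3[OF f U inj])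
  then have [measurable]: "f ` U \<in> sets borel" by auto
  have "(\<lambda>z. indicator U z *\<^sub>R f z) \<in> borel_measurable borel"
    using U holomorphic_on_imp_continuous_on[OF f] by (intro borel_measurable_continuous_on_indicator) auto
  moreover have "(\<lambda>z. indicator U z *\<^sub>R f z) = h" by (auto simp: h_def indicator_def)
  ultimately have hm [measurable]: "h \<in> borel_measurable borel" by simp
  have "continuous_on U (deriv f)"
    by (intro holomorphic_on_imp_continuous_on holomorphic_deriv f U)
  then have "(\<lambda>z. indicator U z *\<^sub>R deriv f z) \<in> borel_measurable borel"
    using U by (intro borel_measurable_continuous_on_indicator) auto
  then have "(\<lambda>z. ennreal ((cmod (indicator U z *\<^sub>R deriv f z))\<^sup>2)) \<in> borel_measurable borel"
    by measurable
  moreover have "(\<lambda>z. ennreal ((cmod (indicator U z *\<^sub>R deriv f z))\<^sup>2)) = k"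
    by (auto simp: k_def indicator_def)
  ultimately have km [measurable]: "k \<in> borel_measurable borel" by (simp only:)
  have eq: "density lborel (indicator (f ` U)) = distr (density lborel k) borel h"
  proof (rule measure_eqI)
    fix A assume "A \<in> sets (density lborel (indicator (f ` U)))"
    then have A [measurable]: "A \<in> sets borel" by simp
    let ?B = "U \<inter> h -` A"
    have B: "?B \<in> sets borel" using measurable_sets_borel[OF hm A] by auto
    have fB: "f ` ?B = A \<inter> f ` U" by (auto simp: h_def)
    have "emeasure lborel (f ` ?B) = (\<integral>\<^sup>+z. indicator ?B z * ennreal ((cmod (deriv f z))\<^sup>2) \<partial>lborel)"
      by (rule emeasure_holomorphic_image[OF U f inj bd B]) (auto simp: fB)
    also have "\<dots> = emeasure (distr (density lborel k) borel h) A"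
      using measurable_sets_borel[OF hm A]
      by (subst emeasure_distr) (auto simp: emeasure_density k_def indicator_def intro!: nn_integral_cong)
    finally show "emeasure (density lborel (indicator (f ` U))) A = emeasure (distr (density lborel k) borel h) A"
      by (simp add: fB emeasure_restricted Int_commute)
  qed simp
  have "(\<integral>\<^sup>+w. indicator (f ` U) w * F w \<partial>lborel) = (\<integral>\<^sup>+w. F w \<partial>density lborel (indicator (f ` U)))"
    by (subst nn_integral_density) auto
  also have "\<dots> = (\<integral>\<^sup>+z. k z * F (h z) \<partial>lborel)"
    unfolding eq by (subst nn_integral_distr) (auto simp: nn_integral_density)
  also have "\<dots> = (\<integral>\<^sup>+z. indicator U z * (F (f z) * ennreal ((cmod (deriv f z))\<^sup>2)) \<partial>lborel)"
    by (intro nn_integral_cong) (auto simp: k_def h_def indicator_def mult.commute)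
  finally show ?thesis .
qed

section \<open>Harmonic functions as sums of holomorphic and antiholomorphic functions\<close>

lemma C1_on_partial_x:
  assumes "C1_on S u" "Complex x y \<in> S"
  shows "((\<lambda>s. u (Complex s y)) has_vector_derivative partial_x u (Complex x y)) (at x)"
proof -
  have "(\<lambda>t::real. u (Complex x y + of_real t)) differentiable (at 0)"
    using assms unfolding C1_on_def by blast
  then have u0: "((\<lambda>t::real. u (Complex x y + of_real t)) has_vector_derivative partial_x u (Complex x y)) (at (x - x))"
    by (simp add: partial_x_def vector_derivative_works)
  have l: "((\<lambda>s. s - x) has_vector_derivative 1) (at x)"
    by (auto intro!: derivative_eq_intros)
  from vector_diff_chain_at[where f = "\<lambda>s. s - x" and f' = 1 and x = x, OF l u0]
  have "((\<lambda>s. u (Complex x y + of_real (s - x))) has_vector_derivative partial_x u (Complex x y)) (at x)"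
    by (simp add: o_def)
  moreover have "Complex x y + of_real (s - x) = Complex s y" for s
    by (simp add: complex_eq_iff)
  ultimately show ?thesis by simp
qed

lemma C1_on_partial_y:
  assumes "C1_on S u" "Complex x y \<in> S"
  shows "((\<lambda>s. u (Complex x s)) has_vector_derivative partial_y u (Complex x y)) (at y)"
proof -
  have "(\<lambda>t::real. u (Complex x y + \<i> * of_real t)) differentiable (at 0)"
    using assms unfolding C1_on_def by blast
  then have u0: "((\<lambda>t::real. u (Complex x y + \<i> * of_real t)) has_vector_derivative partial_y u (Complex x y)) (at (y - y))"
    by (simp add: partial_y_def vector_derivative_works)
  have l: "((\<lambda>s. s - y) has_vector_derivative 1) (at y)"
    by (auto intro!: derivative_eq_intros)
  from vector_diff_chain_at[where f = "\<lambda>s. s - y" and f' = 1 and x = y, OF l u0]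
  have "((\<lambda>s. u (Complex x y + \<i> * of_real (s - y))) has_vector_derivative partial_y u (Complex x y)) (at y)"
    by (simp add: o_def)
  moreover have "Complex x y + \<i> * of_real (s - y) = Complex x s" for s
    by (simp add: complex_eq_iff)
  ultimately show ?thesis by simp
qed

lemma continuous_on_Complex [continuous_intros]:
  "continuous_on A f \<Longrightarrow> continuous_on A g \<Longrightarrow> continuous_on A (\<lambda>x. Complex (f x) (g x))"
  unfolding Complex_eq by (intro continuous_intros)

lemma open_imp_square:
  assumes "open S" "z \<in> S"
  obtains d where "d > 0" "\<And>x y. \<bar>x - Re z\<bar> \<le> d \<Longrightarrow> \<bar>y - Im z\<bar> \<le> d \<Longrightarrow> Complex x y \<in> S"
proof -
  obtain r where r: "r > 0" "ball z r \<subseteq> S" using assms by (meson open_contains_ball)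
  have "Complex x y \<in> S" if "\<bar>x - Re z\<bar> \<le> r / 3" "\<bar>y - Im z\<bar> \<le> r / 3" for x y
  proof -
    have "cmod (Complex x y - z) \<le> \<bar>x - Re z\<bar> + \<bar>y - Im z\<bar>"
      using cmod_le[of "Complex x y - z"] by simp
    also have "\<dots> < r" using that r by simp
    finally show ?thesis using r by (auto simp: dist_norm norm_minus_commute)
  qed
  then show ?thesis using that[of "r / 3"] r by simp
qed

text \<open>The two directional derivatives combine to a total derivative because the vertical one
  is continuous. The argument takes place on a square around the point, where both coordinates vary
  independently.\<close>

lemma C1_on_has_derivative:
  assumes u: "C1_on S u" and S: "open S" and z: "z \<in> S"
  shows "(u has_derivative (\<lambda>h. Re h *\<^sub>R partial_x u z + Im h *\<^sub>R partial_y u z)) (at z)"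
proof -
  obtain d where d: "d > 0" "\<And>x y. \<bar>x - Re z\<bar> \<le> d \<Longrightarrow> \<bar>y - Im z\<bar> \<le> d \<Longrightarrow> Complex x y \<in> S"
    using open_imp_square[OF S z] by blast
  let ?X = "{Re z - d<..<Re z + d}" and ?Y = "{Im z - d<..<Im z + d}"
  have XY: "Complex x y \<in> S" if "x \<in> ?X" "y \<in> ?Y" for x y
    using that by (intro d(2)) auto
  have cont: "continuous_on (?X \<times> ?Y) (\<lambda>(x, y). blinfun_scaleR_left (partial_y u (Complex x y)))"
  proof -
    have "continuous_on S (partial_y u)" using u by (simp add: C1_on_def)
    then have "continuous_on (?X \<times> ?Y) (\<lambda>p. partial_y u (Complex (fst p) (snd p)))"
      by (rule continuous_on_compose2) (use XY in \<open>auto intro!: continuous_intros\<close>)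
    then show ?thesis
      unfolding case_prod_beta by (intro continuous_intros)
  qed
  have "((\<lambda>(x, y). u (Complex x y)) has_derivative
      (\<lambda>(tx, ty). tx *\<^sub>R partial_x u z + blinfun_scaleR_left (partial_y u (Complex (Re z) (Im z))) ty))
      (at (Re z, Im z) within ?X \<times> ?Y)"
  proof (rule has_derivative_partialsI[where f = "\<lambda>x y. u (Complex x y)" and x = "Re z" and y = "Im z"
        and X = ?X and Y = ?Y and fx = "\<lambda>tx. tx *\<^sub>R partial_x u z"
        and fy = "\<lambda>x y. blinfun_scaleR_left (partial_y u (Complex x y))"])
    show "((\<lambda>x. u (Complex x (Im z))) has_derivative (\<lambda>tx. tx *\<^sub>R partial_x u z)) (at (Re z) within ?X)"
      by (rule has_derivative_at_withinI)
        (use C1_on_partial_x[OF u, of "Re z" "Im z"] z in \<open>simp add: has_vector_derivative_def\<close>)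
    show "((\<lambda>y. u (Complex x y)) has_derivative blinfun_scaleR_left (partial_y u (Complex x y))) (at y within ?Y)"
      if "x \<in> ?X" "y \<in> ?Y" for x y
      by (rule has_derivative_at_withinI)
        (use C1_on_partial_y[OF u XY[OF that]] in \<open>simp add: has_vector_derivative_def\<close>)
    show "continuous (at (Re z, Im z) within ?X \<times> ?Y) (\<lambda>(x, y). blinfun_scaleR_left (partial_y u (Complex x y)))"
      using cont d(1) by (simp add: continuous_on_eq_continuous_within)
  qed (use d(1) in auto)
  then have 1: "((\<lambda>(x, y). u (Complex x y)) has_derivative
      (\<lambda>(tx, ty). tx *\<^sub>R partial_x u z + ty *\<^sub>R partial_y u z)) (at (Re z, Im z))"
    using d(1) by (subst (asm) at_within_open) (auto intro!: open_Times)
  have 2: "((\<lambda>w. (Re w, Im w)) has_derivative (\<lambda>h. (Re h, Im h))) (at z)"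
    by (auto intro!: derivative_eq_intros)
  from has_derivative_compose[OF 2 1] show ?thesis by simp
qed

text \<open>Writing \<open>u\<close> as the integral of its horizontal derivative, the mixed derivative can be taken
  under the integral sign.\<close>

lemma mixed_partials_commute:
  assumes u: "C2_on S u" and S: "open S" and z: "z \<in> S"
  shows "partial_x (partial_y u) z = partial_y (partial_x u) z"
proof -
  have u1: "C1_on S u" and ux: "C1_on S (partial_x u)" and uy: "C1_on S (partial_y u)"
    using u by (auto simp: C2_on_def)
  obtain d where d: "d > 0" "\<And>x y. \<bar>x - Re z\<bar> \<le> d \<Longrightarrow> \<bar>y - Im z\<bar> \<le> d \<Longrightarrow> Complex x y \<in> S"
    using open_imp_square[OF S z] by blast
  let ?a = "Re z - d" and ?b = "Re z + d"
  let ?Y = "{Im z - d<..<Im z + d}"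
  have in_S: "Complex x y \<in> S" if "x \<in> {?a..?b}" "y \<in> ?Y" for x y
    using that by (intro d(2)) auto
  have cont: "continuous_on ({?a..?b} \<times> ?Y) (\<lambda>p. v (Complex (fst p) (snd p)))"
    if "continuous_on S v" for v :: "complex \<Rightarrow> complex"
    using that by (rule continuous_on_compose2) (use in_S in \<open>auto intro!: continuous_intros\<close>)
  have contx: "continuous_on {?a..x} (\<lambda>t. v (Complex t y))"
    if "continuous_on S v" "x \<le> ?b" "y \<in> ?Y" for v :: "complex \<Rightarrow> complex" and x y
    using that(1) by (rule continuous_on_compose2) (use that in_S in \<open>auto intro!: continuous_intros\<close>)
  have Y: "Im z \<in> ?Y" using d by simp
  have repr: "u (Complex x y) = u (Complex ?a y) + integral {?a..x} (\<lambda>t. partial_x u (Complex t y))"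
    if "x \<in> {?a..?b}" "y \<in> ?Y" for x y
  proof -
    have "((\<lambda>t. partial_x u (Complex t y)) has_integral u (Complex x y) - u (Complex ?a y)) {?a..x}"
      using that in_S
      by (intro fundamental_theorem_of_calculus has_vector_derivative_at_within[OF C1_on_partial_x[OF u1]]) auto
    then show ?thesis by (simp add: integral_unique)
  qed
  have uyeq: "partial_y u (Complex x (Im z)) =
      partial_y u (Complex ?a (Im z)) + integral {?a..x} (\<lambda>t. partial_y (partial_x u) (Complex t (Im z)))"
    if x: "x \<in> {?a..?b}" for x
  proof -
    let ?f = "\<lambda>y. u (Complex ?a y) + integral (cbox ?a x) (\<lambda>t. partial_x u (Complex t y))"
    have "((\<lambda>y. integral (cbox ?a x) (\<lambda>t. partial_x u (Complex t y))) has_vector_derivative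
        integral (cbox ?a x) (\<lambda>t. partial_y (partial_x u) (Complex t (Im z)))) (at (Im z) within ?Y)"
    proof (rule leibniz_rule_vector_derivative[where U = "?Y"])
      show "((\<lambda>y. partial_x u (Complex t y)) has_vector_derivative partial_y (partial_x u) (Complex t y)) (at y within ?Y)"
        if "y \<in> ?Y" "t \<in> cbox ?a x" for y t
        using that x by (intro has_vector_derivative_at_within[OF C1_on_partial_y[OF ux]] in_S) auto
      show "(\<lambda>t. partial_x u (Complex t y)) integrable_on cbox ?a x" if "y \<in> ?Y" for y
        using that x u1 by (intro integrable_continuous) (auto intro!: contx simp: C1_on_def)
      have "continuous_on S (partial_y (partial_x u))" using ux by (simp add: C1_on_def)
      then show "continuous_on (?Y \<times> cbox ?a x) (\<lambda>(y, t). partial_y (partial_x u) (Complex t y))"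
        unfolding case_prod_beta
        by (rule continuous_on_compose2) (use x in \<open>auto intro!: continuous_intros in_S\<close>)
    qed (use Y in auto)
    then have "(?f has_vector_derivative partial_y u (Complex ?a (Im z)) +
        integral (cbox ?a x) (\<lambda>t. partial_y (partial_x u) (Complex t (Im z)))) (at (Im z) within ?Y)"
      by (intro has_vector_derivative_add has_vector_derivative_at_within[OF C1_on_partial_y[OF u1]] in_S)
        (use d in auto)
    then have "(?f has_vector_derivative partial_y u (Complex ?a (Im z)) +
        integral (cbox ?a x) (\<lambda>t. partial_y (partial_x u) (Complex t (Im z)))) (at (Im z))"
      using Y by (subst (asm) at_within_open) auto
    then have der: "((\<lambda>y. u (Complex x y)) has_vector_derivative partial_y u (Complex ?a (Im z)) +
        integral (cbox ?a x) (\<lambda>t. partial_y (partial_x u) (Complex t (Im z)))) (at (Im z))"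
    proof (rule has_vector_derivative_transform_within_open[where S = "?Y"])
      show "?f y = u (Complex x y)" if "y \<in> ?Y" for y
        by (subst repr[OF x that]) simp
    qed (use Y in auto)
    show ?thesis
      using vector_derivative_unique_at[OF C1_on_partial_y[OF u1 in_S[OF x Y]] der] by simp
  qed
  \<comment> \<open>The representation of \<open>partial_y u\<close> is now differentiated in the
    horizontal variable, which returns the integrand at the end point.\<close>
  have "((\<lambda>x. integral {?a..x} (\<lambda>t. partial_y (partial_x u) (Complex t (Im z)))) has_vector_derivative
      partial_y (partial_x u) (Complex (Re z) (Im z))) (at (Re z) within {?a..?b})"
    using d Y ux by (intro integral_has_vector_derivative contx) (auto simp: C1_on_def)
  then have "((\<lambda>x. partial_y u (Complex ?a (Im z)) + integral {?a..x} (\<lambda>t. partial_y (partial_x u) (Complex t (Im z))))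
      has_vector_derivative partial_y (partial_x u) z) (at (Re z) within {?a..?b})"
    by (auto intro!: derivative_eq_intros)
  moreover have "at (Re z) within {?a..?b} = at (Re z)"
    using d by (intro at_within_interior) auto
  ultimately have "((\<lambda>x. partial_y u (Complex ?a (Im z)) + integral {?a..x} (\<lambda>t. partial_y (partial_x u) (Complex t (Im z))))
      has_vector_derivative partial_y (partial_x u) z) (at (Re z))"
    by simp
  then have "((\<lambda>x. partial_y u (Complex x (Im z))) has_vector_derivative partial_y (partial_x u) z) (at (Re z))"
  proof (rule has_vector_derivative_transform_within_open[where S = "{?a<..<?b}"])
    show "partial_y u (Complex ?a (Im z)) + integral {?a..x} (\<lambda>t. partial_y (partial_x u) (Complex t (Im z))) =
        partial_y u (Complex x (Im z))" if "x \<in> {?a<..<?b}" for x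
      using that by (subst uyeq[of x]) auto
  qed (use d in auto)
  from vector_derivative_unique_at[OF this C1_on_partial_x[OF uy]] z show ?thesis by simp
qed

text \<open>The Wirtinger derivative \<open>p\<close> of \<open>f\<close> in z satisfies the
  Cauchy-Riemann equations, because these amount to the Laplace equation together with the equality
  of the mixed partials. \<open>G\<close> is a primitive of \<open>p\<close>, and
  \<open>f - G\<close> has vanishing derivative in z, so its conjugate is holomorphic. The constant
  is moved into \<open>G\<close> so that \<open>H\<close> vanishes at the base point; later this
  kills the cross term.\<close>

lemma harmonic_on_imp_holomorphic_decomposition:
  assumes f: "harmonic_on S f" and S: "open S" "convex S" "a \<in> S"
  obtains G H where "G holomorphic_on S" "H holomorphic_on S" "H a = 0"
    "\<And>z. z \<in> S \<Longrightarrow> f z = G z + cnj (H z)"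
proof -
  have C2: "C2_on S f" and lap: "\<And>z. z \<in> S \<Longrightarrow> laplacian f z = 0"
    using f by (auto simp: harmonic_on_def)
  have f1: "C1_on S f" and fx: "C1_on S (partial_x f)" and fy: "C1_on S (partial_y f)"
    using C2 by (auto simp: C2_on_def)
  define p where "p z = (partial_x f z - \<i> * partial_y f z) * (1 / 2)" for z
  have p: "(p has_field_derivative (partial_x (partial_x f) z - \<i> * partial_x (partial_y f) z) * (1 / 2)) (at z)"
    if z: "z \<in> S" for z
  proof -
    let ?a = "partial_x (partial_x f) z" and ?b = "partial_x (partial_y f) z" and ?c = "partial_y (partial_y f) z"
    have m: "partial_y (partial_x f) z = ?b" using mixed_partials_commute[OF C2 S(1) z] by simp
    have c: "?c = - ?a" using lap[OF z] by (simp add: laplacian_def add_eq_0_iff)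
    have "(p has_derivative (\<lambda>h. ((Re h *\<^sub>R ?a + Im h *\<^sub>R ?b) - \<i> * (Re h *\<^sub>R ?b + Im h *\<^sub>R ?c)) * (1 / 2))) (at z)"
      unfolding p_def using C1_on_has_derivative[OF fx S(1) z] C1_on_has_derivative[OF fy S(1) z]
      by (intro has_derivative_mult_left has_derivative_mult_right has_derivative_diff) (simp_all add: m)
    also have "(\<lambda>h. ((Re h *\<^sub>R ?a + Im h *\<^sub>R ?b) - \<i> * (Re h *\<^sub>R ?b + Im h *\<^sub>R ?c)) * (1 / 2)) = (*) ((?a - \<i> * ?b) * (1 / 2))"
      by (rule ext) (simp add: c complex_eq_iff field_simps)
    finally show ?thesis by (simp only: has_field_derivative_def)
  qed
  have "p holomorphic_on S"
    using p S(1) by (auto simp: holomorphic_on_open)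
  from holomorphic_convex_primitive'[OF S(2,1) this]
  obtain G where "\<And>z. z \<in> S \<Longrightarrow> (G has_field_derivative p z) (at z within S)" by blast
  then have G: "\<And>z. z \<in> S \<Longrightarrow> (G has_field_derivative p z) (at z)"
    using S(1) by (metis at_within_open)
  define k where "k z = cnj (f z - G z)" for z
  have k: "(k has_field_derivative cnj ((partial_x f z + \<i> * partial_y f z) / 2)) (at z)" if z: "z \<in> S" for z
  proof -
    have "(G has_derivative (\<lambda>h. p z * h)) (at z)"
      using G[OF z] by (simp add: has_field_derivative_def)
    then have "(k has_derivative (\<lambda>h. cnj ((Re h *\<^sub>R partial_x f z + Im h *\<^sub>R partial_y f z) - p z * h))) (at z)"
      unfolding k_def using C1_on_has_derivative[OF f1 S(1) z]
      by (intro bounded_linear.has_derivative[OF bounded_linear_cnj] has_derivative_diff)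
    also have "(\<lambda>h. cnj ((Re h *\<^sub>R partial_x f z + Im h *\<^sub>R partial_y f z) - p z * h)) =
        (*) (cnj ((partial_x f z + \<i> * partial_y f z) / 2))"
      by (rule ext) (simp add: p_def complex_eq_iff field_simps)
    finally show ?thesis by (simp only: has_field_derivative_def)
  qed
  have hol: "G holomorphic_on S" "k holomorphic_on S"
    using G k S(1) by (auto simp: holomorphic_on_open)
  have "(\<lambda>z. G z + cnj (k a)) holomorphic_on S" "(\<lambda>z. k z - k a) holomorphic_on S"
    by (intro holomorphic_intros hol)+
  then show ?thesis
    by (rule that) (auto simp: k_def)
qed

text \<open>The derivative in direction \<open>d\<close> is \<open>d * G'\<close> plus the conjugate
  of \<open>d * H'\<close>. Both partial derivatives thus have the same shape as \<open>f\<close>,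
  and the lemma can be applied to its own conclusions to reach second order.\<close>

lemma C1_on_holomorphic_add_cnj:
  assumes S: "open S" and G: "G holomorphic_on S" and H: "H holomorphic_on S"
    and f: "\<And>z. z \<in> S \<Longrightarrow> f z = G z + cnj (H z)"
  shows "C1_on S f"
    "z \<in> S \<Longrightarrow> partial_x f z = deriv G z + cnj (deriv H z)"
    "z \<in> S \<Longrightarrow> partial_y f z = \<i> * deriv G z + cnj (\<i> * deriv H z)"
proof -
  have dir: "((\<lambda>t::real. f (z + d * of_real t)) has_vector_derivative d * deriv G z + cnj (d * deriv H z)) (at 0)"
    if z: "z \<in> S" for d z
  proof -
    have l: "((\<lambda>t::real. z + d * of_real t) has_vector_derivative d) (at 0)"
      by (auto intro!: derivative_eq_intros simp: has_vector_derivative_def scaleR_conv_of_real)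
    have "((\<lambda>t::real. G (z + d * of_real t)) has_vector_derivative d * deriv G z) (at 0)"
      "((\<lambda>t::real. H (z + d * of_real t)) has_vector_derivative d * deriv H z) (at 0)"
      using field_vector_diff_chain_at[OF l, of G "deriv G z"] field_vector_diff_chain_at[OF l, of H "deriv H z"]
        holomorphic_derivI[OF G S z] holomorphic_derivI[OF H S z] by (auto simp: o_def)
    then have "((\<lambda>t::real. G (z + d * of_real t) + cnj (H (z + d * of_real t))) has_vector_derivative
        d * deriv G z + cnj (d * deriv H z)) (at 0)"
      by (intro has_vector_derivative_add has_vector_derivative_cnj)
    then show ?thesis
    proof (rule has_vector_derivative_transform_within_open[where S = "(\<lambda>t::real. z + d * of_real t) -` S"])
      show "open ((\<lambda>t::real. z + d * of_real t) -` S)"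
        using S by (intro open_vimage) (auto intro!: continuous_intros)
    qed (use z f in auto)
  qed
  show x: "partial_x f z = deriv G z + cnj (deriv H z)" if "z \<in> S" for z
    using dir[OF that, of 1] by (simp add: partial_x_def vector_derivative_at)
  show y: "partial_y f z = \<i> * deriv G z + cnj (\<i> * deriv H z)" if "z \<in> S" for z
    using dir[OF that, of \<i>] by (simp only: partial_y_def vector_derivative_at)
  have cont: "continuous_on S G" "continuous_on S H" "continuous_on S (deriv G)" "continuous_on S (deriv H)"
    using S G H by (auto intro!: holomorphic_on_imp_continuous_on holomorphic_deriv)
  show "C1_on S f"
    unfolding C1_on_def
  proof (intro conjI ballI)
    have "continuous_on S (\<lambda>z. G z + cnj (H z))"
      using cont by (auto intro!: continuous_intros)
    then show "continuous_on S f"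
      by (rule continuous_on_eq) (simp add: f)
    show "continuous_on S (partial_x f)"
      by (rule continuous_on_cong[THEN iffD2, OF refl x]) (use cont in \<open>auto intro!: continuous_intros\<close>)
    show "continuous_on S (partial_y f)"
      by (rule continuous_on_cong[THEN iffD2, OF refl y]) (use cont in \<open>auto intro!: continuous_intros\<close>)
    fix z assume "z \<in> S"
    from dir[OF this, of 1] dir[OF this, of \<i>]
    show "(\<lambda>t::real. f (z + of_real t)) differentiable (at 0)"
      "(\<lambda>t::real. f (z + \<i> * of_real t)) differentiable (at 0)"
      by (auto simp: differentiableI_vector)
  qed
qed

text \<open>The second derivatives in the two directions carry the factors 1 and i^2 = -1, so they
  cancel in the Laplacian.\<close>

lemma harmonic_on_holomorphic_add_cnj:
  assumes S: "open S" and G: "G holomorphic_on S" and H: "H holomorphic_on S"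
    and f: "\<And>z. z \<in> S \<Longrightarrow> f z = G z + cnj (H z)"
  shows "harmonic_on S f"
proof -
  note D = holomorphic_deriv[OF G S] holomorphic_deriv[OF H S]
  note 1 = C1_on_holomorphic_add_cnj[OF S G H f]
  note x = C1_on_holomorphic_add_cnj[OF S D, of "partial_x f", OF 1(2)]
  have iD: "(\<lambda>z. \<i> * deriv G z) holomorphic_on S" "(\<lambda>z. \<i> * deriv H z) holomorphic_on S"
    by (intro holomorphic_intros D)+
  note y = C1_on_holomorphic_add_cnj[OF S iD, of "partial_y f", OF 1(3)]
  have "deriv (\<lambda>z. \<i> * deriv G z) z = \<i> * deriv (deriv G) z" "deriv (\<lambda>z. \<i> * deriv H z) z = \<i> * deriv (deriv H) z"
    if "z \<in> S" for z
    using holomorphic_on_imp_differentiable_at[OF D(1) S that] holomorphic_on_imp_differentiable_at[OF D(2) S that]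
    by (auto intro!: deriv_cmult)
  then show ?thesis
    unfolding harmonic_on_def C2_on_def laplacian_def using 1 x y by simp
qed

section \<open>Projections and Toeplitz operators on complete subspaces of L2\<close>

lemma cnj_measurable [measurable]: "cnj \<in> borel_measurable borel"
  by (intro borel_measurable_continuous_onI continuous_intros)

lemma L2_funI [intro]:
  "f \<in> borel_measurable M \<Longrightarrow> integrable M (\<lambda>z. (cmod (f z))\<^sup>2) \<Longrightarrow> f \<in> L2_fun M"
  by (simp add: L2_fun_def)

lemma L2_funD:
  assumes "f \<in> L2_fun M"
  shows "f \<in> borel_measurable M" "integrable M (\<lambda>z. (cmod (f z))\<^sup>2)"
  using assms by (auto simp: L2_fun_def)

lemma norm_add_square_le: "(norm (a + b))\<^sup>2 \<le> 2 * (norm a)\<^sup>2 + 2 * (norm b)\<^sup>2"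
  for a b :: "'a::real_normed_vector"
proof -
  have "(norm (a + b))\<^sup>2 \<le> (norm a + norm b)\<^sup>2"
    by (simp add: norm_triangle_ineq power_mono)
  also have "\<dots> \<le> 2 * (norm a)\<^sup>2 + 2 * (norm b)\<^sup>2"
    using sum_squares_bound[of "norm a" "norm b"] by (simp add: power2_sum)
  finally show ?thesis .
qed

lemma L2_fun_add:
  assumes "f \<in> L2_fun M" "g \<in> L2_fun M"
  shows "(\<lambda>z. f z + g z) \<in> L2_fun M"
proof
  note [measurable] = L2_funD(1)[OF assms(1)] L2_funD(1)[OF assms(2)]
  show "(\<lambda>z. f z + g z) \<in> borel_measurable M" by measurable
  show "integrable M (\<lambda>z. (cmod (f z + g z))\<^sup>2)"
    by (rule Bochner_Integration.integrable_bound[where f = "\<lambda>z. 2 * (cmod (f z))\<^sup>2 + 2 * (cmod (g z))\<^sup>2"])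
       (use assms in \<open>auto simp: L2_fun_def norm_add_square_le\<close>)
qed

lemma L2_fun_bounded_mult:
  assumes "f \<in> L2_fun M" and [measurable]: "\<psi> \<in> borel_measurable M"
    and b: "\<And>z. z \<in> space M \<Longrightarrow> cmod (\<psi> z) \<le> B"
  shows "(\<lambda>z. \<psi> z * f z) \<in> L2_fun M"
proof
  note [measurable] = L2_funD(1)[OF assms(1)]
  show "(\<lambda>z. \<psi> z * f z) \<in> borel_measurable M" by measurable
  have "(cmod (\<psi> z * f z))\<^sup>2 \<le> B\<^sup>2 * (cmod (f z))\<^sup>2" if "z \<in> space M" for z
    using b[OF that] by (auto simp: norm_mult power_mult_distrib intro!: mult_right_mono power_mono)
  then have AE: "AE z in M. norm ((cmod (\<psi> z * f z))\<^sup>2) \<le> norm (B\<^sup>2 * (cmod (f z))\<^sup>2)"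
    by (intro AE_I2) (simp add: abs_mult)
  have "(\<lambda>z. (cmod (\<psi> z * f z))\<^sup>2) \<in> borel_measurable M" by measurable
  then show "integrable M (\<lambda>z. (cmod (\<psi> z * f z))\<^sup>2)"
    by (rule Bochner_Integration.integrable_bound[OF integrable_mult_right[OF L2_funD(2)[OF assms(1)]] _ AE])
qed

lemma L2_fun_scale: "f \<in> L2_fun M \<Longrightarrow> (\<lambda>z. c * f z) \<in> L2_fun M"
  by (rule L2_fun_bounded_mult[where B = "cmod c"]) auto

lemma L2_fun_diff:
  assumes "f \<in> L2_fun M" "g \<in> L2_fun M"
  shows "(\<lambda>z. f z - g z) \<in> L2_fun M"
  using L2_fun_add[OF assms(1) L2_fun_scale[OF assms(2), of "-1"]] by simp

lemma L2_inner_integrable: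
  assumes "f \<in> L2_fun M" "g \<in> L2_fun M"
  shows "integrable M (\<lambda>z. f z * cnj (g z))"
proof (rule Bochner_Integration.integrable_bound[where f = "\<lambda>z. (cmod (f z))\<^sup>2 + (cmod (g z))\<^sup>2"])
  note [measurable] = L2_funD(1)[OF assms(1)] L2_funD(1)[OF assms(2)]
  show "(\<lambda>z. f z * cnj (g z)) \<in> borel_measurable M" by measurable
  have "cmod (f z) * cmod (g z) \<le> (cmod (f z))\<^sup>2 + (cmod (g z))\<^sup>2" for z
    using sum_squares_bound[of "cmod (f z)" "cmod (g z)"] mult_nonneg_nonneg[of "cmod (f z)" "cmod (g z)"]
      norm_ge_zero[of "f z"] norm_ge_zero[of "g z"] by linarith
  then show "AE z in M. norm (f z * cnj (g z)) \<le> norm ((cmod (f z))\<^sup>2 + (cmod (g z))\<^sup>2)"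
    by (simp add: norm_mult)
qed (use assms in \<open>auto simp: L2_fun_def\<close>)

lemma L2_inner_add_left:
  "f \<in> L2_fun M \<Longrightarrow> g \<in> L2_fun M \<Longrightarrow> h \<in> L2_fun M \<Longrightarrow>
    L2_inner M (\<lambda>z. f z + g z) h = L2_inner M f h + L2_inner M g h"
  by (simp add: L2_inner_def ring_distribs L2_inner_integrable)

lemma L2_inner_diff_left:
  "f \<in> L2_fun M \<Longrightarrow> g \<in> L2_fun M \<Longrightarrow> h \<in> L2_fun M \<Longrightarrow>
    L2_inner M (\<lambda>z. f z - g z) h = L2_inner M f h - L2_inner M g h"
  by (simp add: L2_inner_def ring_distribs L2_inner_integrable)

lemma L2_inner_scale_left: "L2_inner M (\<lambda>z. c * f z) h = c * L2_inner M f h"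
  by (simp add: L2_inner_def mult.assoc)

lemma L2_inner_scale_right: "L2_inner M f (\<lambda>z. c * h z) = cnj c * L2_inner M f h"
  by (simp add: L2_inner_def mult.left_commute)

lemma L2_inner_commute: "L2_inner M g f = cnj (L2_inner M f g)"
  by (simp add: L2_inner_def mult.commute flip: Bochner_Integration.integral_cnj)

lemma L2_inner_diff_right:
  "f \<in> L2_fun M \<Longrightarrow> g \<in> L2_fun M \<Longrightarrow> h \<in> L2_fun M \<Longrightarrow>
    L2_inner M f (\<lambda>z. g z - h z) = L2_inner M f g - L2_inner M f h"
  by (simp add: L2_inner_def ring_distribs L2_inner_integrable)

lemma L2_norm_nonneg [simp]: "L2_norm M f \<ge> 0"
  by (simp add: L2_norm_def)

lemma L2_norm_square: "(L2_norm M f)\<^sup>2 = (LINT z|M. (cmod (f z))\<^sup>2)"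
  by (simp add: L2_norm_def)

lemma L2_inner_self: "L2_inner M f f = of_real ((L2_norm M f)\<^sup>2)"
  unfolding L2_norm_square L2_inner_def by (simp flip: complex_norm_square of_real_power)

lemma L2_norm_scale: "L2_norm M (\<lambda>z. c * f z) = cmod c * L2_norm M f"
  by (simp add: L2_norm_def norm_mult power_mult_distrib real_sqrt_mult)

lemma L2_norm_diff_square:
  assumes "f \<in> L2_fun M" "g \<in> L2_fun M"
  shows "(L2_norm M (\<lambda>z. f z - g z))\<^sup>2 =
    (L2_norm M f)\<^sup>2 - 2 * Re (L2_inner M f g) + (L2_norm M g)\<^sup>2"
proof -
  have "complex_of_real ((L2_norm M (\<lambda>z. f z - g z))\<^sup>2) =
      L2_inner M f f - L2_inner M g f - (L2_inner M f g - L2_inner M g g)"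
    unfolding L2_inner_self[symmetric]
    by (simp add: assms L2_fun_diff L2_inner_diff_left L2_inner_diff_right)
  then show ?thesis
    by (simp add: complex_eq_iff L2_inner_self L2_inner_commute[of M g f])
qed

lemma L2_parallelogram:
  assumes "f \<in> L2_fun M" "g \<in> L2_fun M"
  shows "(L2_norm M (\<lambda>z. f z - g z))\<^sup>2 + (L2_norm M (\<lambda>z. f z + g z))\<^sup>2 =
    2 * (L2_norm M f)\<^sup>2 + 2 * (L2_norm M g)\<^sup>2"
  using L2_norm_diff_square[OF assms] L2_norm_diff_square[OF assms(1) L2_fun_scale[OF assms(2), of "-1"]]
    L2_inner_scale_right[of M f "-1" g] L2_norm_scale[of M "-1" g]
  by simp

text \<open>The multiple of \<open>h\<close> removed is the projection of \<open>f\<close> onto the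
  line through \<open>h\<close>, the best approximation from that line. The gain in squared norm
  gives the Cauchy-Schwarz inequality, and later the near-orthogonality of a minimising
  sequence.\<close>

lemma L2_project_out:
  assumes "f \<in> L2_fun M" "h \<in> L2_fun M" "L2_norm M h \<noteq> 0"
  shows "(L2_norm M (\<lambda>z. f z - L2_inner M f h / of_real ((L2_norm M h)\<^sup>2) * h z))\<^sup>2 =
    (L2_norm M f)\<^sup>2 - (cmod (L2_inner M f h))\<^sup>2 / (L2_norm M h)\<^sup>2"
proof -
  let ?t = "L2_inner M f h / of_real ((L2_norm M h)\<^sup>2)"
  have e: "cnj (L2_inner M f h) * L2_inner M f h = of_real ((cmod (L2_inner M f h))\<^sup>2)"
    by (metis complex_norm_square mult.commute)
  have "cnj ?t * L2_inner M f h = cnj (L2_inner M f h) * L2_inner M f h / of_real ((L2_norm M h)\<^sup>2)"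
    by simp
  also have "\<dots> = of_real ((cmod (L2_inner M f h))\<^sup>2 / (L2_norm M h)\<^sup>2)"
    by (simp only: e of_real_divide)
  finally have "Re (L2_inner M f (\<lambda>z. ?t * h z)) = (cmod (L2_inner M f h))\<^sup>2 / (L2_norm M h)\<^sup>2"
    by (simp only: L2_inner_scale_right Re_complex_of_real)
  moreover have "(L2_norm M (\<lambda>z. ?t * h z))\<^sup>2 = (cmod (L2_inner M f h))\<^sup>2 / (L2_norm M h)\<^sup>2"
    using assms(3) unfolding L2_norm_scale
    by (simp only: norm_divide power_mult_distrib power_divide norm_of_real abs_power2)
       (simp add: power2_eq_square)
  ultimately show ?thesis
    using L2_norm_diff_square[OF assms(1) L2_fun_scale[OF assms(2), of ?t]] by simp
qed

lemma L2_Cauchy_Schwarz: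
  assumes "f \<in> L2_fun M" "h \<in> L2_fun M"
  shows "cmod (L2_inner M f h) \<le> L2_norm M f * L2_norm M h"
proof (cases "L2_norm M h = 0")
  case True
  \<comment> \<open>The elements are functions, not classes modulo null sets, so norm zero means
    vanishing almost everywhere only.\<close>
  then have "AE z in M. (cmod (h z))\<^sup>2 = 0"
    using assms(2) by (subst integral_nonneg_eq_0_iff_AE[symmetric]) (auto simp: L2_norm_def L2_fun_def)
  then have "L2_inner M f h = (LINT z|M. 0)"
    unfolding L2_inner_def using L2_funD(1)[OF assms(1)] L2_funD(1)[OF assms(2)]
    by (intro integral_cong_AE) auto
  then show ?thesis by simp
next
  case False
  then have pos: "(L2_norm M h)\<^sup>2 > 0" by simp
  have "(cmod (L2_inner M f h))\<^sup>2 / (L2_norm M h)\<^sup>2 \<le> (L2_norm M f)\<^sup>2"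
    using L2_project_out[OF assms False] by (metis diff_ge_0_iff_ge zero_le_power2)
  then have "(cmod (L2_inner M f h))\<^sup>2 \<le> (L2_norm M f * L2_norm M h)\<^sup>2"
    using pos by (simp add: divide_simps power_mult_distrib)
  then show ?thesis
    by (rule power2_le_imp_le) simp
qed

lemma L2_norm_triangle_diff:
  assumes "f \<in> L2_fun M" "g \<in> L2_fun M"
  shows "L2_norm M (\<lambda>z. f z - g z) \<le> L2_norm M f + L2_norm M g"
proof (rule power2_le_imp_le)
  have "- Re (L2_inner M f g) \<le> L2_norm M f * L2_norm M g"
    using L2_Cauchy_Schwarz[OF assms] abs_Re_le_cmod[of "L2_inner M f g"] by linarith
  then show "(L2_norm M (\<lambda>z. f z - g z))\<^sup>2 \<le> (L2_norm M f + L2_norm M g)\<^sup>2"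
    using L2_norm_diff_square[OF assms] by (simp add: power2_sum)
qed simp

lemma mult_right_cancel_nonneg:
  fixes a b x :: real
  assumes "a * x \<le> b * x" "0 \<le> x" "x = 0 \<Longrightarrow> a \<le> b"
  shows "a \<le> b"
  using assms by (cases "x = 0") (auto simp: mult_le_cancel_right)

text \<open>A Hilbert space made of actual functions. \<open>definite\<close> stands in for the
  passage to classes; for the Bergman spaces it comes from continuity. Besides these spaces, the
  range of a Toeplitz operator that is bounded below will be an instance.\<close>

locale l2_subspace =
  fixes M :: "complex measure" and H :: "(complex \<Rightarrow> complex) set"
  assumes sub: "f \<in> H \<Longrightarrow> f \<in> L2_fun M"
    and zero: "(\<lambda>_. 0) \<in> H"
    and add: "f \<in> H \<Longrightarrow> g \<in> H \<Longrightarrow> (\<lambda>z. f z + g z) \<in> H"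
    and scale: "f \<in> H \<Longrightarrow> (\<lambda>z. c * f z) \<in> H"
    and definite: "f \<in> H \<Longrightarrow> L2_norm M f = 0 \<Longrightarrow> f = (\<lambda>_. 0)"
    and complete: "(\<And>n::nat. F n \<in> H) \<Longrightarrow>
      (\<And>e. e > 0 \<Longrightarrow> \<exists>N. \<forall>m\<ge>N. \<forall>n\<ge>N. L2_norm M (\<lambda>z. F m z - F n z) < e) \<Longrightarrow>
      \<exists>f\<in>H. (\<lambda>n. L2_norm M (\<lambda>z. F n z - f z)) \<longlonglongrightarrow> 0"
begin

lemma diff: "f \<in> H \<Longrightarrow> g \<in> H \<Longrightarrow> (\<lambda>z. f z - g z) \<in> H"
  using add[OF _ scale[of g "-1"], of f] by simp

lemma minimizing_sequence:
  assumes u: "u \<in> L2_fun M"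
  obtains G d where "\<And>n. G n \<in> H"
    "\<And>n. (L2_norm M (\<lambda>z. u z - G n z))\<^sup>2 < d + inverse (real (Suc n))"
    "\<And>g. g \<in> H \<Longrightarrow> d \<le> (L2_norm M (\<lambda>z. u z - g z))\<^sup>2"
proof -
  define Q where "Q = (\<lambda>g. (L2_norm M (\<lambda>z. u z - g z))\<^sup>2) ` H"
  have bdd: "bdd_below Q" by (auto simp: Q_def intro!: bdd_belowI[of _ 0])
  have "\<exists>g\<in>H. (L2_norm M (\<lambda>z. u z - g z))\<^sup>2 < Inf Q + inverse (real (Suc n))" for n
    using cInf_lessD[of Q "Inf Q + inverse (real (Suc n))"] zero by (auto simp: Q_def)
  then obtain G where "\<And>n. G n \<in> H" "\<And>n. (L2_norm M (\<lambda>z. u z - G n z))\<^sup>2 < Inf Q + inverse (real (Suc n))"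
    by metis
  moreover have "Inf Q \<le> (L2_norm M (\<lambda>z. u z - g z))\<^sup>2" if "g \<in> H" for g
    using that bdd by (auto simp: Q_def intro!: cInf_lower)
  ultimately show ?thesis using that by blast
qed

text \<open>Near-minimisers of the distance to \<open>H\<close> form a Cauchy sequence by the
  parallelogram law. Orthogonality of the limit is not read off from its own minimality: every
  residual along the sequence is already nearly orthogonal to \<open>h\<close>, with a bound that
  tends to 0, and the inner product is continuous.\<close>

lemma projection_exists:
  assumes u: "u \<in> L2_fun M"
  shows "\<exists>g\<in>H. \<forall>h\<in>H. L2_inner M (\<lambda>z. u z - g z) h = 0"
proof -
  obtain G d where G: "\<And>n. G n \<in> H"
    and Gd: "\<And>n. (L2_norm M (\<lambda>z. u z - G n z))\<^sup>2 < d + inverse (real (Suc n))"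
    and d: "\<And>g. g \<in> H \<Longrightarrow> d \<le> (L2_norm M (\<lambda>z. u z - g z))\<^sup>2"
    using minimizing_sequence[OF u] by blast
  have GL: "G n \<in> L2_fun M" for n by (rule sub[OF G])
  have close: "(L2_norm M (\<lambda>z. G m z - G n z))\<^sup>2 \<le> 2 * inverse (real (Suc m)) + 2 * inverse (real (Suc n))" for m n
  proof -
    let ?a = "\<lambda>z. u z - G n z" and ?b = "\<lambda>z. u z - G m z"
    \<comment> \<open>The midpoint of two near-minimisers is a competitor too, so it lies no closer
      to \<open>u\<close> than \<open>d\<close> allows.\<close>
    have "d \<le> (L2_norm M (\<lambda>z. u z - 1/2 * (G n z + G m z)))\<^sup>2"
      by (intro d scale add G)
    also have "(\<lambda>z. u z - 1/2 * (G n z + G m z)) = (\<lambda>z. 1/2 * (?a z + ?b z))"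
      by (auto simp: field_simps)
    finally have "4 * d \<le> (L2_norm M (\<lambda>z. ?a z + ?b z))\<^sup>2"
      unfolding L2_norm_scale by (simp add: norm_divide power_divide)
    moreover have "(\<lambda>z. ?a z - ?b z) = (\<lambda>z. G m z - G n z)" by auto
    ultimately show ?thesis
      using L2_parallelogram[OF L2_fun_diff[OF u GL[of n]] L2_fun_diff[OF u GL[of m]]] Gd[of m] Gd[of n]
      by simp
  qed
  have "\<exists>N. \<forall>m\<ge>N. \<forall>n\<ge>N. L2_norm M (\<lambda>z. G m z - G n z) < e" if e: "e > 0" for e
  proof -
    obtain N where N: "inverse (real (Suc N)) < e\<^sup>2 / 4"
      using reals_Archimedean[of "e\<^sup>2 / 4"] e by auto
    have "L2_norm M (\<lambda>z. G m z - G n z) < e" if "m \<ge> N" "n \<ge> N" for m n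
    proof (rule power2_less_imp_less)
      have "inverse (real (Suc m)) \<le> inverse (real (Suc N))" "inverse (real (Suc n)) \<le> inverse (real (Suc N))"
        using that by (auto intro!: le_imp_inverse_le)
      then show "(L2_norm M (\<lambda>z. G m z - G n z))\<^sup>2 < e\<^sup>2"
        using close[of m n] N by linarith
    qed (use e in auto)
    then show ?thesis by blast
  qed
  from complete[OF G this] obtain g where g: "g \<in> H"
    and lim: "(\<lambda>n. L2_norm M (\<lambda>z. G n z - g z)) \<longlonglongrightarrow> 0" by blast
  have "L2_inner M (\<lambda>z. u z - g z) h = 0" if h: "h \<in> H" for h
  proof -
    have hL: "h \<in> L2_fun M" and gL: "g \<in> L2_fun M" using h g sub by auto
    have a: "cmod (L2_inner M (\<lambda>z. u z - G n z) h) \<le> sqrt (inverse (real (Suc n))) * L2_norm M h" for n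
    proof (cases "L2_norm M h = 0")
      case True
      then show ?thesis using L2_Cauchy_Schwarz[OF L2_fun_diff[OF u GL[of n]] hL] by simp
    next
      case False
      let ?t = "L2_inner M (\<lambda>z. u z - G n z) h / of_real ((L2_norm M h)\<^sup>2)"
      \<comment> \<open>Correcting \<open>G n\<close> by the best multiple of \<open>h\<close>
        cannot beat the infimum, so the gain is at most the remaining gap 1/(n+1).\<close>
      have "d \<le> (L2_norm M (\<lambda>z. u z - (G n z + ?t * h z)))\<^sup>2"
        by (intro d scale add G h)
      also have "\<dots> = (L2_norm M (\<lambda>z. u z - G n z))\<^sup>2 - (cmod (L2_inner M (\<lambda>z. u z - G n z) h))\<^sup>2 / (L2_norm M h)\<^sup>2"
        using L2_project_out[OF L2_fun_diff[OF u GL[of n]] hL False] by (simp add: diff_diff_eq)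
      finally have "(cmod (L2_inner M (\<lambda>z. u z - G n z) h))\<^sup>2 / (L2_norm M h)\<^sup>2 \<le> inverse (real (Suc n))"
        using Gd[of n] by linarith
      then have "(cmod (L2_inner M (\<lambda>z. u z - G n z) h))\<^sup>2 \<le> inverse (real (Suc n)) * (L2_norm M h)\<^sup>2"
        using False by (simp add: divide_simps)
      also have "\<dots> = (sqrt (inverse (real (Suc n))) * L2_norm M h)\<^sup>2"
        unfolding power_mult_distrib by (simp del: of_nat_Suc)
      finally show ?thesis
        by (rule power2_le_imp_le) simp
    qed
    have b: "cmod (L2_inner M (\<lambda>z. u z - g z) h) \<le>
        sqrt (inverse (real (Suc n))) * L2_norm M h + L2_norm M (\<lambda>z. G n z - g z) * L2_norm M h" for n
    proof -
      have "L2_inner M (\<lambda>z. (u z - G n z) + (G n z - g z)) h =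
          L2_inner M (\<lambda>z. u z - G n z) h + L2_inner M (\<lambda>z. G n z - g z) h"
        by (intro L2_inner_add_left L2_fun_diff u GL gL hL)
      then have "L2_inner M (\<lambda>z. u z - g z) h =
          L2_inner M (\<lambda>z. u z - G n z) h + L2_inner M (\<lambda>z. G n z - g z) h"
        by simp
      then show ?thesis
        using norm_triangle_mono[OF a[of n] L2_Cauchy_Schwarz[OF L2_fun_diff[OF GL[of n] gL] hL]] by simp
    qed
    have "(\<lambda>n. sqrt (inverse (real (Suc n))) * L2_norm M h + L2_norm M (\<lambda>z. G n z - g z) * L2_norm M h)
        \<longlonglongrightarrow> sqrt 0 * L2_norm M h + 0 * L2_norm M h"
      by (intro tendsto_intros lim LIMSEQ_inverse_real_of_nat)
    then have "cmod (L2_inner M (\<lambda>z. u z - g z) h) \<le> 0"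
      using b by (intro LIMSEQ_le_const) auto
    then show ?thesis by simp
  qed
  with g show ?thesis by blast
qed

lemma projection_unique:
  assumes u: "u \<in> L2_fun M" and g: "g \<in> H" "\<forall>h\<in>H. L2_inner M (\<lambda>z. u z - g z) h = 0"
    and g': "g' \<in> H" "\<forall>h\<in>H. L2_inner M (\<lambda>z. u z - g' z) h = 0"
  shows "g' = g"
proof -
  let ?k = "\<lambda>z. g' z - g z"
  have k: "?k \<in> H" by (intro diff g g')
  have "L2_inner M ?k ?k = L2_inner M (\<lambda>z. (u z - g z) - (u z - g' z)) ?k" by simp
  also have "\<dots> = 0"
    using g g' k L2_inner_diff_left[OF L2_fun_diff[OF u sub[OF g(1)]] L2_fun_diff[OF u sub[OF g'(1)]] sub[OF k]]
    by simp
  finally have "L2_norm M ?k = 0" by (simp add: L2_inner_self)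
  from definite[OF k this] show ?thesis by (metis eq_iff_diff_eq_0 ext)
qed

lemma orth_proj:
  assumes "u \<in> L2_fun M"
  shows "orth_proj M H u \<in> H" "h \<in> H \<Longrightarrow> L2_inner M (\<lambda>z. u z - orth_proj M H u z) h = 0"
proof -
  have "\<exists>!g. g \<in> H \<and> (\<forall>h\<in>H. L2_inner M (\<lambda>z. u z - g z) h = 0)"
  proof -
    obtain g where g: "g \<in> H" "\<forall>h\<in>H. L2_inner M (\<lambda>z. u z - g z) h = 0"
      using projection_exists[OF assms] by auto
    show ?thesis
    proof (rule ex1I[of _ g])
      show "g \<in> H \<and> (\<forall>h\<in>H. L2_inner M (\<lambda>z. u z - g z) h = 0)" using g by simp
      show "g' = g" if "g' \<in> H \<and> (\<forall>h\<in>H. L2_inner M (\<lambda>z. u z - g' z) h = 0)" for g'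
        using that by (intro projection_unique[OF assms g]) auto
    qed
  qed
  from theI'[OF this] show "orth_proj M H u \<in> H" "h \<in> H \<Longrightarrow> L2_inner M (\<lambda>z. u z - orth_proj M H u z) h = 0"
    by (auto simp: orth_proj_def)
qed

lemma orth_proj_eqI:
  assumes "u \<in> L2_fun M" "g \<in> H" "\<And>h. h \<in> H \<Longrightarrow> L2_inner M (\<lambda>z. u z - g z) h = 0"
  shows "orth_proj M H u = g"
  by (rule projection_unique[OF assms(1,2)]) (use orth_proj[OF assms(1)] assms(3) in auto)

lemma orth_proj_inner:
  assumes "u \<in> L2_fun M" "h \<in> H"
  shows "L2_inner M (orth_proj M H u) h = L2_inner M u h"
  using orth_proj[OF assms(1)] L2_inner_diff_left[OF assms(1) sub sub[OF assms(2)], of "orth_proj M H u"]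
    assms(2) by simp

lemma orth_proj_add:
  assumes u: "u \<in> L2_fun M" and v: "v \<in> L2_fun M"
  shows "orth_proj M H (\<lambda>z. u z + v z) = (\<lambda>z. orth_proj M H u z + orth_proj M H v z)"
proof (rule orth_proj_eqI)
  fix h assume h: "h \<in> H"
  have "L2_inner M (\<lambda>z. (u z - orth_proj M H u z) + (v z - orth_proj M H v z)) h = 0"
    using h L2_inner_add_left[OF L2_fun_diff[OF u sub[OF orth_proj(1)[OF u]]]
      L2_fun_diff[OF v sub[OF orth_proj(1)[OF v]]] sub[OF h]] by (simp add: orth_proj u v)
  then show "L2_inner M (\<lambda>z. u z + v z - (orth_proj M H u z + orth_proj M H v z)) h = 0"
    by (simp add: algebra_simps)
qed (intro L2_fun_add u v add orth_proj)+

lemma orth_proj_scale: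
  assumes u: "u \<in> L2_fun M"
  shows "orth_proj M H (\<lambda>z. c * u z) = (\<lambda>z. c * orth_proj M H u z)"
proof (rule orth_proj_eqI)
  fix h assume h: "h \<in> H"
  show "L2_inner M (\<lambda>z. c * u z - c * orth_proj M H u z) h = 0"
    using orth_proj(2)[OF u h] L2_inner_scale_left[of M c "\<lambda>z. u z - orth_proj M H u z" h]
    by (simp add: algebra_simps)
qed (intro L2_fun_scale u scale orth_proj)+

lemma orth_proj_norm_le:
  assumes u: "u \<in> L2_fun M"
  shows "L2_norm M (orth_proj M H u) \<le> L2_norm M u"
proof -
  let ?p = "orth_proj M H u"
  have p: "?p \<in> H" by (rule orth_proj[OF u])
  have e: "L2_inner M u ?p = of_real ((L2_norm M ?p)\<^sup>2)"
    using orth_proj_inner[OF u p] by (simp only: L2_inner_self)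
  have "(L2_norm M ?p)\<^sup>2 = cmod (L2_inner M u ?p)"
    unfolding e norm_of_real by simp
  also have "\<dots> \<le> L2_norm M u * L2_norm M ?p"
    by (rule L2_Cauchy_Schwarz[OF u sub[OF p]])
  finally have "L2_norm M ?p * L2_norm M ?p \<le> L2_norm M u * L2_norm M ?p"
    by (simp add: power2_eq_square)
  then show ?thesis
    by (rule mult_right_cancel_nonneg) auto
qed

end

section \<open>Toeplitz operators with nonnegative bounded symbol\<close>

locale l2_toeplitz = l2_subspace +
  fixes \<phi> :: "complex \<Rightarrow> real" and B :: real
  assumes phi_measurable [measurable]: "\<phi> \<in> borel_measurable M"
    and phi_nonneg: "z \<in> space M \<Longrightarrow> 0 \<le> \<phi> z"
    and phi_le: "z \<in> space M \<Longrightarrow> \<phi> z \<le> B"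
    and B_pos: "B > 0"
begin

definition T :: "(complex \<Rightarrow> complex) \<Rightarrow> complex \<Rightarrow> complex" where
  "T f = orth_proj M H (\<lambda>z. complex_of_real (\<phi> z) * f z)"

lemma phi_mult_L2: "f \<in> L2_fun M \<Longrightarrow> (\<lambda>z. complex_of_real (\<phi> z) * f z) \<in> L2_fun M"
  by (rule L2_fun_bounded_mult[where B = B]) (auto simp: phi_nonneg phi_le)

lemma phi_integrable:
  assumes "f \<in> L2_fun M" shows "integrable M (\<lambda>z. \<phi> z * (cmod (f z))\<^sup>2)"
proof (rule Bochner_Integration.integrable_bound[where f = "\<lambda>z. B * (cmod (f z))\<^sup>2"])
  show "AE z in M. norm (\<phi> z * (cmod (f z))\<^sup>2) \<le> norm (B * (cmod (f z))\<^sup>2)"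
    using phi_nonneg phi_le B_pos by (auto simp: abs_mult intro!: mult_right_mono)
qed (use assms in \<open>auto simp: L2_fun_def\<close>)

lemma T_in: "f \<in> H \<Longrightarrow> T f \<in> H"
  unfolding T_def by (intro orth_proj phi_mult_L2 sub)

lemma T_add: "f \<in> H \<Longrightarrow> g \<in> H \<Longrightarrow> T (\<lambda>z. f z + g z) = (\<lambda>z. T f z + T g z)"
  unfolding T_def by (simp add: distrib_left orth_proj_add[OF phi_mult_L2[OF sub] phi_mult_L2[OF sub]])

lemma T_scale: "f \<in> H \<Longrightarrow> T (\<lambda>z. c * f z) = (\<lambda>z. c * T f z)"
  unfolding T_def
  by (simp add: mult.left_commute[of _ c] orth_proj_scale[OF phi_mult_L2[OF sub]])

lemma T_diff: "f \<in> H \<Longrightarrow> g \<in> H \<Longrightarrow> T (\<lambda>z. f z - g z) = (\<lambda>z. T f z - T g z)"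
  using T_add[OF _ scale[of g "-1"], of f] T_scale[of g "-1"] by simp

text \<open>Since \<open>\<phi>^2 \<le> B * \<phi>\<close>, the norm of \<open>T f\<close> is
  controlled by the quadratic form itself, not just by the norm of \<open>f\<close>. This turns a
  lower bound for \<open>T f\<close> into one for the form.\<close>

lemma T_square_le:
  assumes "f \<in> H" shows "(L2_norm M (T f))\<^sup>2 \<le> B * (LINT z|M. \<phi> z * (cmod (f z))\<^sup>2)"
proof -
  have fL: "f \<in> L2_fun M" by (rule sub[OF assms])
  have "(L2_norm M (T f))\<^sup>2 \<le> (L2_norm M (\<lambda>z. complex_of_real (\<phi> z) * f z))\<^sup>2"
    unfolding T_def by (intro power_mono orth_proj_norm_le phi_mult_L2 fL) simp
  also have "\<dots> \<le> (LINT z|M. B * (\<phi> z * (cmod (f z))\<^sup>2))"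
    unfolding L2_norm_square
  proof (rule integral_mono)
    fix z assume "z \<in> space M"
    then have "\<phi> z * \<phi> z \<le> B * \<phi> z" by (intro mult_right_mono phi_le phi_nonneg)
    then have "\<phi> z * \<phi> z * (cmod (f z))\<^sup>2 \<le> B * \<phi> z * (cmod (f z))\<^sup>2"
      by (rule mult_right_mono) simp
    then show "(cmod (complex_of_real (\<phi> z) * f z))\<^sup>2 \<le> B * (\<phi> z * (cmod (f z))\<^sup>2)"
      by (simp add: norm_mult power_mult_distrib power2_eq_square[of "\<phi> z"])
  qed (use phi_mult_L2[OF fL] phi_integrable[OF fL] in \<open>auto simp: L2_fun_def\<close>)
  finally show ?thesis by simp
qed

lemma T_norm_le:
  assumes "f \<in> H" shows "L2_norm M (T f) \<le> B * L2_norm M f"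
proof (rule power2_le_imp_le)
  have "(LINT z|M. \<phi> z * (cmod (f z))\<^sup>2) \<le> (LINT z|M. B * (cmod (f z))\<^sup>2)"
    using sub[OF assms] phi_le
    by (intro integral_mono phi_integrable) (auto simp: L2_fun_def intro!: mult_right_mono)
  then have "B * (LINT z|M. \<phi> z * (cmod (f z))\<^sup>2) \<le> B * (B * (L2_norm M f)\<^sup>2)"
    using B_pos by (simp add: L2_norm_square)
  then show "(L2_norm M (T f))\<^sup>2 \<le> (B * L2_norm M f)\<^sup>2"
    using T_square_le[OF assms] by (simp add: power_mult_distrib) (simp add: power2_eq_square[of B])
qed (use B_pos in simp)

lemma T_inner: "f \<in> H \<Longrightarrow> L2_inner M (T f) f = of_real (LINT z|M. \<phi> z * (cmod (f z))\<^sup>2)"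
  unfolding T_def by (subst orth_proj_inner[OF phi_mult_L2[OF sub]])
    (auto simp: L2_inner_def mult.assoc simp flip: complex_norm_square of_real_mult of_real_power)

lemma invertible_imp_bounded_below:
  assumes "invertible_operator_on M H T"
  shows "\<exists>c>0. \<forall>f\<in>H. c * (LINT z|M. (cmod (f z))\<^sup>2) \<le> (LINT z|M. \<phi> z * (cmod (f z))\<^sup>2)"
proof -
  obtain S where "bounded_operator_on M H S" and S: "\<And>f. f \<in> H \<Longrightarrow> S (T f) = f"
    using assms unfolding invertible_operator_on_def by blast
  then obtain C where C: "\<And>f. f \<in> H \<Longrightarrow> L2_norm M (S f) \<le> C * L2_norm M f"
    unfolding bounded_operator_on_def by blast
  \<comment> \<open>The summand 1 keeps \<open>K\<close> positive when \<open>C\<close> is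
    0.\<close>
  define K where "K = C\<^sup>2 * B + 1"
  have K: "K > 0" using B_pos by (simp add: K_def add_nonneg_pos)
  have "(1 / K) * (LINT z|M. (cmod (f z))\<^sup>2) \<le> (LINT z|M. \<phi> z * (cmod (f z))\<^sup>2)" if f: "f \<in> H" for f
  proof -
    let ?I = "LINT z|M. \<phi> z * (cmod (f z))\<^sup>2"
    have I: "?I \<ge> 0" using phi_nonneg by (intro integral_nonneg_AE) auto
    have "L2_norm M f \<le> C * L2_norm M (T f)" using C[OF T_in[OF f]] S[OF f] by simp
    then have "(L2_norm M f)\<^sup>2 \<le> (C * L2_norm M (T f))\<^sup>2" by (intro power_mono) auto
    also have "\<dots> \<le> C\<^sup>2 * (B * ?I)"
      unfolding power_mult_distrib by (intro mult_left_mono T_square_le f) auto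
    also have "\<dots> \<le> K * ?I" using I by (simp add: K_def algebra_simps)
    finally show ?thesis using K by (simp add: L2_norm_square field_simps)
  qed
  then show ?thesis using K by (intro exI[of _ "1 / K"]) auto
qed

text \<open>A Lax-Milgram argument: the form bound and Cauchy-Schwarz give
  \<open>c * |f| \<le> |T f|\<close>, hence injectivity, a complete range and a bounded inverse on
  it. Completeness of the range provides the projection onto it, and a nonzero vector orthogonal to
  the range would violate the form bound.\<close>

lemma bounded_below_imp_invertible:
  assumes "c > 0" and bb: "\<And>f. f \<in> H \<Longrightarrow> c * (LINT z|M. (cmod (f z))\<^sup>2) \<le> (LINT z|M. \<phi> z * (cmod (f z))\<^sup>2)"
  shows "invertible_operator_on M H T"
proof -
  have below: "c * L2_norm M f \<le> L2_norm M (T f)" if f: "f \<in> H" for f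
  proof -
    have "c * (L2_norm M f)\<^sup>2 \<le> Re (L2_inner M (T f) f)"
      using bb[OF f] T_inner[OF f] by (simp add: L2_norm_square)
    also have "\<dots> \<le> L2_norm M (T f) * L2_norm M f"
      by (rule order_trans[OF complex_Re_le_cmod L2_Cauchy_Schwarz[OF sub[OF T_in[OF f]] sub[OF f]]])
    finally have "c * L2_norm M f * L2_norm M f \<le> L2_norm M (T f) * L2_norm M f"
      by (simp add: power2_eq_square mult.assoc)
    then show ?thesis
      by (rule mult_right_cancel_nonneg) auto
  qed
  have inj: "f = g" if "f \<in> H" "g \<in> H" "T f = T g" for f g
  proof -
    have "L2_norm M (T (\<lambda>z. f z - g z)) = 0"
      using that by (simp add: T_diff L2_norm_def)
    then have "L2_norm M (\<lambda>z. f z - g z) = 0"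
      using below[OF diff[OF that(1,2)]] \<open>c > 0\<close>
        L2_norm_nonneg[of M "\<lambda>z. f z - g z"] by (simp add: mult_le_0_iff)
    from definite[OF diff[OF that(1,2)] this] show ?thesis by (metis eq_iff_diff_eq_0 ext)
  qed
  \<comment> \<open>For completeness, a Cauchy sequence of images has Cauchy preimages by
    \<open>below\<close>, and \<open>T\<close> maps their limit to the limit of the images.\<close>
  interpret R: l2_subspace M "T ` H"
  proof
    fix f assume "f \<in> T ` H" then show "f \<in> L2_fun M" using sub T_in by auto
  next
    have "T (\<lambda>_. 0) = (\<lambda>_. 0)" using T_scale[OF zero, of 0] by simp
    then show "(\<lambda>_. 0) \<in> T ` H" using zero by (metis image_eqI)
  next
    fix f g assume "f \<in> T ` H" "g \<in> T ` H"
    then show "(\<lambda>z. f z + g z) \<in> T ` H" by (auto simp flip: T_add intro!: imageI add)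
  next
    fix f c assume "f \<in> T ` H"
    then show "(\<lambda>z. c * f z) \<in> T ` H" by (auto simp flip: T_scale intro!: imageI scale)
  next
    fix f assume "f \<in> T ` H" "L2_norm M f = 0"
    then show "f = (\<lambda>_. 0)" using T_in by (auto intro: definite)
  next
    fix F :: "nat \<Rightarrow> complex \<Rightarrow> complex"
    assume F: "\<And>n. F n \<in> T ` H"
      and Cau: "\<And>e. e > 0 \<Longrightarrow> \<exists>N. \<forall>m\<ge>N. \<forall>n\<ge>N. L2_norm M (\<lambda>z. F m z - F n z) < e"
    have "\<forall>n. \<exists>f. f \<in> H \<and> F n = T f" using F by blast
    from choice[OF this] obtain f where f: "\<And>n. f n \<in> H" "\<And>n. F n = T (f n)" by blast
    have "\<exists>g\<in>H. (\<lambda>n. L2_norm M (\<lambda>z. f n z - g z)) \<longlonglongrightarrow> 0"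
    proof (rule complete)
      fix e :: real assume "e > 0"
      then obtain N where N: "\<And>m n. m \<ge> N \<Longrightarrow> n \<ge> N \<Longrightarrow> L2_norm M (\<lambda>z. F m z - F n z) < c * e"
        using Cau[of "c * e"] \<open>c > 0\<close> by auto
      have "L2_norm M (\<lambda>z. f m z - f n z) < e" if "m \<ge> N" "n \<ge> N" for m n
      proof -
        have "c * L2_norm M (\<lambda>z. f m z - f n z) \<le> L2_norm M (\<lambda>z. F m z - F n z)"
          using below[OF diff[OF f(1)[of m] f(1)[of n]]] by (simp add: T_diff f)
        also have "\<dots> < c * e" by (rule N[OF that])
        finally show ?thesis using \<open>c > 0\<close> by simp
      qed
      then show "\<exists>N. \<forall>m\<ge>N. \<forall>n\<ge>N. L2_norm M (\<lambda>z. f m z - f n z) < e" by blast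
    qed (rule f)
    then obtain g where g: "g \<in> H" and lim: "(\<lambda>n. L2_norm M (\<lambda>z. f n z - g z)) \<longlonglongrightarrow> 0" by blast
    have "(\<lambda>n. L2_norm M (\<lambda>z. F n z - T g z)) \<longlonglongrightarrow> 0"
    proof (rule tendsto_sandwich[OF _ _ tendsto_const tendsto_mult_right_zero[OF lim, of B]])
      show "\<forall>\<^sub>F n in sequentially. L2_norm M (\<lambda>z. F n z - T g z) \<le> B * L2_norm M (\<lambda>z. f n z - g z)"
        using T_norm_le[OF diff[OF f(1) g]] by (simp add: T_diff f g)
    qed auto
    then show "\<exists>f\<in>T ` H. (\<lambda>n. L2_norm M (\<lambda>z. F n z - f z)) \<longlonglongrightarrow> 0" using g by blast
  qed
  have surj: "h \<in> T ` H" if h: "h \<in> H" for h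
  proof -
    \<comment> \<open>The residual of \<open>h\<close> is orthogonal to the range, in particular to
      its own image; its quadratic form is therefore 0.\<close>
    let ?p = "orth_proj M (T ` H) h" and ?g = "\<lambda>z. h z - orth_proj M (T ` H) h z"
    have p: "?p \<in> T ` H" by (rule R.orth_proj[OF sub[OF h]])
    then have g: "?g \<in> H" using T_in h by (intro diff) auto
    have "L2_inner M ?g (T ?g) = 0" using g by (intro R.orth_proj sub h) auto
    then have "L2_inner M (T ?g) ?g = 0" by (simp add: L2_inner_commute[of M "T ?g" ?g])
    then have "c * (L2_norm M ?g)\<^sup>2 \<le> 0"
      using bb[OF g] T_inner[OF g] by (simp add: L2_norm_square)
    then have "L2_norm M ?g = 0" using \<open>c > 0\<close> by (simp add: mult_le_0_iff)
    from definite[OF g this] have "h = ?p" by (metis eq_iff_diff_eq_0 ext)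
    with p show ?thesis by simp
  qed
  define S where "S = inv_into H T"
  have S: "S h \<in> H" "T (S h) = h" if "h \<in> H" for h
    using surj[OF that] by (auto simp: S_def inv_into_into f_inv_into_f)
  have ST: "S (T f) = f" if "f \<in> H" for f
    using inj[OF S(1)[OF T_in[OF that]] that] S(2)[OF T_in[OF that]] by blast
  have "bounded_operator_on M H T"
    unfolding bounded_operator_on_def using T_in T_add T_scale T_norm_le by blast
  moreover have "bounded_operator_on M H S"
    unfolding bounded_operator_on_def
  proof (intro conjI ballI allI)
    fix f g assume fg: "f \<in> H" "g \<in> H"
    show "S (\<lambda>z. f z + g z) = (\<lambda>z. S f z + S g z)"
      by (rule inj[OF S(1)[OF add[OF fg]] add[OF S(1)[OF fg(1)] S(1)[OF fg(2)]]])
        (simp add: T_add S add fg)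
  next
    fix f c assume f: "f \<in> H"
    show "S (\<lambda>z. c * f z) = (\<lambda>z. c * S f z)"
      by (rule inj[OF S(1)[OF scale[OF f]] scale[OF S(1)[OF f]]])
        (simp add: T_scale S scale f)
  next
    have "L2_norm M (S f) \<le> (1 / c) * L2_norm M f" if "f \<in> H" for f
      using below[OF S(1)[OF that]] \<open>c > 0\<close> by (simp add: S[OF that] field_simps)
    then show "\<exists>C. \<forall>f\<in>H. L2_norm M (S f) \<le> C * L2_norm M f" by blast
  qed (rule S)
  ultimately show ?thesis
    unfolding invertible_operator_on_def using S ST by blast
qed

lemma invertible_iff_bounded_below:
  "invertible_operator_on M H T \<longleftrightarrow>
    (\<exists>c>0. \<forall>f\<in>H. c * (LINT z|M. (cmod (f z))\<^sup>2) \<le> (LINT z|M. \<phi> z * (cmod (f z))\<^sup>2))"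
  using invertible_imp_bounded_below bounded_below_imp_invertible by blast

end

section \<open>Orthogonality of holomorphic and antiholomorphic functions\<close>

lemma ball_in_borel [measurable]: "ball c r \<in> sets borel"
  by simp

lemma holomorphic_indicator_borel:
  assumes "f holomorphic_on S" "open S"
  shows "(\<lambda>z. indicator S z *\<^sub>R f z) \<in> borel_measurable borel"
  using assms holomorphic_on_imp_continuous_on[OF assms(1)]
  by (intro borel_measurable_continuous_on_indicator) auto

section \<open>Rotations and means over circles\<close>

lemma nn_integral_ball_rotate:
  assumes [measurable]: "F \<in> borel_measurable borel" and c: "cmod c = 1"
  shows "(\<integral>\<^sup>+z. indicator (ball 0 R) z * F z \<partial>lborel) = (\<integral>\<^sup>+z. indicator (ball 0 R) z * F (c * z) \<partial>lborel)"
proof -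
  have c0: "c \<noteq> 0" using c by auto
  have im: "(*) c ` ball 0 R = ball 0 R"
  proof (intro equalityI subsetI)
    fix z :: complex assume "z \<in> ball 0 R"
    then have "z = c * (z / c)" "z / c \<in> ball 0 R" using c c0 by (auto simp: norm_divide)
    then show "z \<in> (*) c ` ball 0 R" by (rule image_eqI)
  qed (use c in \<open>auto simp: norm_mult\<close>)
  have "(\<integral>\<^sup>+z. indicator ((*) c ` ball 0 R) z * F z \<partial>lborel) =
      (\<integral>\<^sup>+z. indicator (ball 0 R) z * (F (c * z) * ennreal ((cmod (deriv ((*) c) z))\<^sup>2)) \<partial>lborel)"
  proof (rule nn_integral_holomorphic_image)
    show "bounded ((*) c ` ball 0 R)" unfolding im by simp
    show "(*) c holomorphic_on ball 0 R" by (intro holomorphic_intros)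
  qed (use c0 in \<open>auto simp: inj_on_def\<close>)
  moreover have "deriv ((*) c) z = c" for z
    by (rule DERIV_imp_deriv) (auto intro!: derivative_eq_intros)
  ultimately show ?thesis unfolding im by (simp add: c)
qed

text \<open>Cauchy's formula at the centre, applied to \<open>P (z * u)\<close> as a function of
  \<open>u\<close> on the unit circle. Dividing by 2 pi i leaves the mean over a parameter interval
  of length 1.\<close>

lemma circle_mean_value:
  assumes P: "P holomorphic_on ball 0 R" and z: "z \<in> ball 0 R"
  shows "((\<lambda>t. P (exp (2 * of_real pi * \<i> * of_real t) * z)) has_integral P 0) {0..1}"
proof -
  \<comment> \<open>With a radius above 1 the function of \<open>u\<close> is holomorphic around the
    closed unit disk. For \<open>z = 0\<close> any such radius works.\<close>
  obtain r where r: "r > 1" "cmod z * r < R"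
  proof -
    have "\<exists>r>1. cmod z * r < R"
    proof (cases "z = 0")
      case True then show ?thesis using z by (intro exI[of _ 2]) auto
    next
      case False
      then have "1 < R / cmod z" using z by simp
      then obtain r where "1 < r" "r < R / cmod z" using dense by blast
      then show ?thesis using False by (intro exI[of _ r]) (simp add: field_simps)
    qed
    then show ?thesis using that by blast
  qed
  have "(\<lambda>u. z * u) ` ball 0 r \<subseteq> ball 0 R"
  proof safe
    fix u :: complex assume "u \<in> ball 0 r"
    then have "cmod (z * u) \<le> cmod z * r" by (auto simp: norm_mult intro!: mult_left_mono)
    then show "z * u \<in> ball 0 R" using r by simp
  qed
  then have hol: "(\<lambda>u. P (z * u)) holomorphic_on ball 0 r"
    using holomorphic_on_compose_gen[OF _ P, of "\<lambda>u. z * u" "ball 0 r"]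
    by (auto simp: o_def intro!: holomorphic_intros)
  have sub: "cball 0 1 \<subseteq> ball (0::complex) r" "ball 0 1 \<subseteq> ball (0::complex) r"
    using r by auto
  have "((\<lambda>u. P (z * u) / (u - 0)) has_contour_integral (2 * of_real pi * \<i> * P (z * 0))) (circlepath 0 1)"
    using holomorphic_on_subset[OF hol sub(1)] holomorphic_on_subset[OF hol sub(2)]
    by (intro Cauchy_integral_circlepath) (auto intro!: holomorphic_on_imp_continuous_on)
  then have "((\<lambda>t. (P (z * circlepath 0 1 t) / circlepath 0 1 t) * vector_derivative (circlepath 0 1) (at t within {0..1}))
      has_integral (2 * of_real pi * \<i> * P 0)) {0..1}"
    by (simp add: has_contour_integral_def)
  then have "((\<lambda>t. 2 * of_real pi * \<i> * P (exp (2 * of_real pi * \<i> * of_real t) * z)) has_integral (2 * of_real pi * \<i> * P 0)) {0..1}"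
  proof (rule has_integral_eq[rotated])
    fix t :: real assume "t \<in> {0..1}"
    then have vd: "vector_derivative (circlepath 0 1) (at t within {0..1}) =
        2 * of_real pi * \<i> * exp (2 * of_real pi * \<i> * of_real t)"
      by (subst vector_derivative_circlepath01) auto
    have cp: "circlepath 0 1 t = exp (2 * of_real pi * \<i> * of_real t)"
      by (simp add: circlepath)
    show "P (z * circlepath 0 1 t) / circlepath 0 1 t * vector_derivative (circlepath 0 1) (at t within {0..1}) =
        2 * of_real pi * \<i> * P (exp (2 * of_real pi * \<i> * of_real t) * z)"
      unfolding vd cp by (simp add: mult.commute)
  qed
  then have "((\<lambda>t. inverse (2 * of_real pi * \<i>) * (2 * of_real pi * \<i> * P (exp (2 * of_real pi * \<i> * of_real t) * z)))
      has_integral inverse (2 * of_real pi * \<i>) * (2 * of_real pi * \<i> * P 0)) {0..1}"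
    by (rule has_integral_mult_right)
  then show ?thesis by (simp add: field_simps)
qed

lemma norm_add_cnj_square: "(cmod (a + cnj b))\<^sup>2 = (cmod a)\<^sup>2 + (cmod b)\<^sup>2 + 2 * Re (a * b)"
  unfolding cmod_power2 by (simp add: power2_eq_square algebra_simps)

text \<open>The cross term \<open>2 * Re (G * H)\<close> has a holomorphic function under the real
  part, so its mean is the value at 0, and \<open>H 0 = 0\<close> makes that vanish.\<close>

lemma nn_integral_circle_eq:
  assumes G: "G holomorphic_on ball 0 R" and H: "H holomorphic_on ball 0 R" and H0: "H 0 = 0"
    and z: "z \<in> ball 0 R"
  defines "e \<equiv> \<lambda>t. exp (2 * of_real pi * \<i> * complex_of_real t) * z"
  shows "(\<integral>\<^sup>+t. indicator {0..1} t * ennreal ((cmod (G (e t) + cnj (H (e t))))\<^sup>2) \<partial>lborel) =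
    (\<integral>\<^sup>+t. indicator {0..1} t * ennreal ((cmod (G (e t)))\<^sup>2 + (cmod (H (e t)))\<^sup>2) \<partial>lborel)"
proof -
  have e: "e t \<in> ball 0 R" for t using z by (simp add: e_def norm_mult)
  have econt: "continuous_on {0..1} e" unfolding e_def by (intro continuous_intros)
  have cont: "continuous_on {0..1} (\<lambda>t. G (e t))" "continuous_on {0..1} (\<lambda>t. H (e t))"
    using continuous_on_compose2[OF holomorphic_on_imp_continuous_on[OF G] econt]
      continuous_on_compose2[OF holomorphic_on_imp_continuous_on[OF H] econt] e
    by (simp_all add: image_subset_iff)
  let ?q = "\<lambda>t. (cmod (G (e t)))\<^sup>2 + (cmod (H (e t)))\<^sup>2"
  have "?q integrable_on {0..1}"
    by (intro integrable_continuous_interval continuous_intros cont)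
  then obtain I where I: "(?q has_integral I) {0..1}"
    by (auto simp: integrable_on_def)
  have "((\<lambda>t. G (e t) * H (e t)) has_integral G 0 * H 0) {0..1}"
    unfolding e_def using circle_mean_value[OF holomorphic_on_mult[OF G H] z] .
  then have "((\<lambda>t. Re (G (e t) * H (e t))) has_integral Re (G 0 * H 0)) {0..1}"
    by (rule has_integral_Re)
  then have "((\<lambda>t. 2 * Re (G (e t) * H (e t))) has_integral 2 * Re (G 0 * H 0)) {0..1}"
    by (rule has_integral_mult_right)
  from has_integral_add[OF I this] have J: "((\<lambda>t. (cmod (G (e t) + cnj (H (e t))))\<^sup>2) has_integral I) {0..1}"
    unfolding norm_add_cnj_square by (simp add: H0)
  have "(\<integral>\<^sup>+t. indicator {0..1} t * ennreal (h t) \<partial>lborel) = ennreal I"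
    if "(h has_integral I) {0..1}" "\<And>t. 0 \<le> h t" for h :: "real \<Rightarrow> real"
    using nn_integral_has_integral_lebesgue[OF that(2,1)]
    by (simp add: ennreal_mult' ennreal_indicator)
  from this[OF I] this[OF J] show ?thesis by simp
qed

abbreviation ball_integral :: "real \<Rightarrow> (complex \<Rightarrow> ennreal) \<Rightarrow> ennreal" where
  "ball_integral r F \<equiv> \<integral>\<^sup>+z. indicator (ball 0 r) z * F z \<partial>lborel"

text \<open>Ball and weight are rotation invariant, so the integral equals each of its rotated
  copies. Averaging over the angle and exchanging the integrals brings the circle mean inside; this
  takes the place of polar coordinates.\<close>

lemma nn_integral_ball_average:
  assumes [measurable]: "F \<in> borel_measurable borel" "W \<in> borel_measurable borel"
    and W: "\<And>c z. cmod c = 1 \<Longrightarrow> W (c * z) = W z"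
  shows "ball_integral R (\<lambda>z. F z * W z) =
    (\<integral>\<^sup>+z. indicator (ball 0 R) z * W z *
      (\<integral>\<^sup>+t. indicator {0..1::real} t * F (exp (2 * of_real pi * \<i> * complex_of_real t) * z) \<partial>lborel) \<partial>lborel)"
proof -
  let ?e = "\<lambda>t. exp (2 * of_real pi * \<i> * complex_of_real t)"
  have [measurable]: "?e \<in> borel_measurable borel"
    by (intro borel_measurable_continuous_onI continuous_intros)
  let ?I = "ball_integral R (\<lambda>z. F z * W z)"
  have rot: "?I = ball_integral R (\<lambda>z. F (?e t * z) * W z)" for t
    by (subst nn_integral_ball_rotate[where c = "?e t"]) (auto simp: W)
  have m: "(\<lambda>z. indicator (ball 0 R) z * (F (?e t * z) * W z)) \<in> borel_measurable borel" for t
    by measurable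
  have "?I = (\<integral>\<^sup>+t. indicator {0..1::real} t * ?I \<partial>lborel)"
    by (subst nn_integral_multc) auto
  also have "\<dots> = (\<integral>\<^sup>+t. (\<integral>\<^sup>+z. indicator {0..1} t * (indicator (ball 0 R) z * (F (?e t * z) * W z)) \<partial>lborel) \<partial>lborel)"
    by (simp add: nn_integral_cmult m flip: rot)
  also have "\<dots> = (\<integral>\<^sup>+z. (\<integral>\<^sup>+t. indicator {0..1} t * (indicator (ball 0 R) z * (F (?e t * z) * W z)) \<partial>lborel) \<partial>lborel)"
    by (rule lborel_pair.Fubini') measurable
  also have "\<dots> = (\<integral>\<^sup>+z. indicator (ball 0 R) z * W z * (\<integral>\<^sup>+t. indicator {0..1} t * F (?e t * z) \<partial>lborel) \<partial>lborel)"
    by (subst nn_integral_cmult[symmetric]) (auto intro!: nn_integral_cong simp: mult_ac)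
  finally show ?thesis .
qed

text \<open>On every circle about the origin the cross term is the mean of \<open>2 * Re (G * H)\<close>, which is
  its value at the centre.\<close>

lemma nn_integral_harmonic_orthogonal:
  assumes G: "G holomorphic_on ball 0 R" and H: "H holomorphic_on ball 0 R" and H0: "H 0 = 0"
    and [measurable]: "W \<in> borel_measurable borel"
    and W: "\<And>c z. cmod c = 1 \<Longrightarrow> W (c * z) = W z"
  shows "ball_integral R (\<lambda>z. ennreal ((cmod (G z + cnj (H z)))\<^sup>2) * W z) =
    ball_integral R (\<lambda>z. ennreal ((cmod (G z))\<^sup>2 + (cmod (H z))\<^sup>2) * W z)"
proof -
  let ?B = "ball 0 R :: complex set"
  let ?G = "\<lambda>z. indicator ?B z *\<^sub>R G z" and ?H = "\<lambda>z. indicator ?B z *\<^sub>R H z"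
  have [measurable]: "?G \<in> borel_measurable borel" "?H \<in> borel_measurable borel"
    using G H by (auto intro!: holomorphic_indicator_borel)
  have "ball_integral R (\<lambda>z. ennreal ((cmod (G z + cnj (H z)))\<^sup>2) * W z) =
      ball_integral R (\<lambda>z. ennreal ((cmod (?G z + cnj (?H z)))\<^sup>2) * W z)"
    by (intro nn_integral_cong) (auto simp: indicator_def)
  also have "\<dots> = ball_integral R (\<lambda>z. ennreal ((cmod (?G z))\<^sup>2 + (cmod (?H z))\<^sup>2) * W z)"
    (is "?L = ?R")
  proof -
    have "(\<integral>\<^sup>+t. indicator {0..1} t * ennreal ((cmod (?G (exp (2 * of_real pi * \<i> * complex_of_real t) * z) +
          cnj (?H (exp (2 * of_real pi * \<i> * complex_of_real t) * z))))\<^sup>2) \<partial>lborel) =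
        (\<integral>\<^sup>+t. indicator {0..1} t * ennreal ((cmod (?G (exp (2 * of_real pi * \<i> * complex_of_real t) * z)))\<^sup>2 +
          (cmod (?H (exp (2 * of_real pi * \<i> * complex_of_real t) * z)))\<^sup>2) \<partial>lborel)"
      if "z \<in> ?B" for z
      using nn_integral_circle_eq[OF G H H0 that] that by (simp add: norm_mult)
    note circle = this
    have L: "?L = (\<integral>\<^sup>+z. indicator ?B z * W z * (\<integral>\<^sup>+t. indicator {0..1} t *
        ennreal ((cmod (?G (exp (2 * of_real pi * \<i> * complex_of_real t) * z) +
          cnj (?H (exp (2 * of_real pi * \<i> * complex_of_real t) * z))))\<^sup>2) \<partial>lborel) \<partial>lborel)"
      by (rule nn_integral_ball_average) (measurable, rule W)
    have R: "?R = (\<integral>\<^sup>+z. indicator ?B z * W z * (\<integral>\<^sup>+t. indicator {0..1} t *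
        ennreal ((cmod (?G (exp (2 * of_real pi * \<i> * complex_of_real t) * z)))\<^sup>2 +
          (cmod (?H (exp (2 * of_real pi * \<i> * complex_of_real t) * z)))\<^sup>2) \<partial>lborel) \<partial>lborel)"
      by (rule nn_integral_ball_average) (measurable, rule W)
    show ?thesis
      unfolding L R
    proof (rule nn_integral_cong, goal_cases)
      case (1 z)
      show ?case
      proof (cases "z \<in> ?B")
        case True
        show ?thesis by (simp only: circle[OF True])
      qed simp
    qed
  qed
  also have "\<dots> = ball_integral R (\<lambda>z. ennreal ((cmod (G z))\<^sup>2 + (cmod (H z))\<^sup>2) * W z)"
    by (intro nn_integral_cong) (auto simp: indicator_def)
  finally show ?thesis .
qed

text \<open>The constant \<open>G 0\<close> and \<open>G - G 0\<close> are orthogonal, and the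
  second square is dropped. To fit the form \<open>G + cnj H\<close> the conjugate of
  \<open>G\<close> is split: its constant takes the holomorphic slot, and \<open>G - G 0\<close>,
  which vanishes at 0, the conjugated one.\<close>

lemma holomorphic_square_mean_ge:
  assumes G: "G holomorphic_on ball 0 R"
    and [measurable]: "W \<in> borel_measurable borel"
    and W: "\<And>c z. cmod c = 1 \<Longrightarrow> W (c * z) = W z"
  shows "ennreal ((cmod (G 0))\<^sup>2) * ball_integral R W \<le>
    ball_integral R (\<lambda>z. ennreal ((cmod (G z))\<^sup>2) * W z)"
proof -
  have m: "(\<lambda>z. indicator (ball 0 R) z * W z) \<in> borel_measurable borel" by measurable
  have "ball_integral R (\<lambda>z. ennreal ((cmod (cnj (G 0) + cnj (G z - G 0)))\<^sup>2) * W z) =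
      ball_integral R (\<lambda>z. ennreal ((cmod (cnj (G 0)))\<^sup>2 + (cmod (G z - G 0))\<^sup>2) * W z)"
    by (rule nn_integral_harmonic_orthogonal) (auto intro!: holomorphic_intros G W)
  then have "ball_integral R (\<lambda>z. ennreal ((cmod (G z))\<^sup>2) * W z) =
      ball_integral R (\<lambda>z. ennreal ((cmod (G 0))\<^sup>2 + (cmod (G z - G 0))\<^sup>2) * W z)"
    by (simp flip: complex_cnj_add)
  also have "\<dots> \<ge> (\<integral>\<^sup>+z. ennreal ((cmod (G 0))\<^sup>2) * (indicator (ball 0 R) z * W z) \<partial>lborel)"
    by (intro nn_integral_mono) (auto simp: indicator_def intro!: mult_right_mono ennreal_leI)
  finally show ?thesis by (simp add: nn_integral_cmult m)
qed

section \<open>Weighted area measure and Bergman spaces\<close>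

text \<open>Weight and area normalisation in one factor, so that integrals over
  \<open>weighted_area\<close> become integrals over \<open>lborel\<close>.\<close>

definition disk_density :: "real \<Rightarrow> complex \<Rightarrow> real" where
  "disk_density \<alpha> z = disk_weight \<alpha> z / pi"

abbreviation disk_integral :: "real \<Rightarrow> (complex \<Rightarrow> ennreal) \<Rightarrow> ennreal" where
  "disk_integral \<alpha> F \<equiv> \<integral>\<^sup>+z. indicator unit_disk z * (F z * ennreal (disk_density \<alpha> z)) \<partial>lborel"

lemma disk_weight_measurable [measurable]: "disk_weight \<alpha> \<in> borel_measurable borel"
  unfolding disk_weight_def[abs_def] by measurable

lemma disk_density_measurable [measurable]: "disk_density \<alpha> \<in> borel_measurable borel"
  unfolding disk_density_def[abs_def] by measurable

lemma one_minus_norm_square_pos: "z \<in> unit_disk \<Longrightarrow> 0 < 1 - (cmod z)\<^sup>2"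
  by (simp add: power_less_one_iff abs_square_less_1)

lemma disk_weight_pos: "\<alpha> > -1 \<Longrightarrow> z \<in> unit_disk \<Longrightarrow> disk_weight \<alpha> z > 0"
  using one_minus_norm_square_pos[of z] by (simp add: disk_weight_def)

lemma disk_density_pos: "\<alpha> > -1 \<Longrightarrow> z \<in> unit_disk \<Longrightarrow> disk_density \<alpha> z > 0"
  by (simp add: disk_density_def disk_weight_pos del: mem_ball)

lemma disk_density_rotate: "cmod c = 1 \<Longrightarrow> disk_density \<alpha> (c * z) = disk_density \<alpha> z"
  by (simp add: disk_density_def disk_weight_def norm_mult)

lemma sets_weighted_area [measurable_cong]: "sets (weighted_area \<alpha>) = sets (lebesgue_on unit_disk)"
  by (simp add: weighted_area_def disk_area_def)

lemma space_weighted_area [simp]: "space (weighted_area \<alpha>) = unit_disk"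
  by (simp add: weighted_area_def disk_area_def)

lemma borel_imp_lebesgue_on:
  assumes "f \<in> borel_measurable borel"
  shows "f \<in> borel_measurable (lebesgue_on S)"
  using assms by (intro measurable_restrict_space1 measurable_completion) simp

text \<open>The bridge from \<open>weighted_area\<close>, which lives on Lebesgue measurable sets,
  to \<open>lborel\<close>, where Fubini and the change of variables are carried out.\<close>

lemma nn_integral_weighted_area:
  assumes f [measurable]: "f \<in> borel_measurable (lebesgue_on unit_disk)"
  shows "(\<integral>\<^sup>+z. f z \<partial>weighted_area \<alpha>) =
    disk_integral \<alpha> f"
proof -
  have w [measurable]: "disk_weight \<alpha> \<in> borel_measurable (lebesgue_on unit_disk)"
    by (rule borel_imp_lebesgue_on) measurable
  have sa: "sets disk_area = sets (lebesgue_on unit_disk)" by (simp add: disk_area_def)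
  have "(\<integral>\<^sup>+z. f z \<partial>weighted_area \<alpha>) = (\<integral>\<^sup>+z. ennreal (disk_weight \<alpha> z) * f z \<partial>disk_area)"
    unfolding weighted_area_def by (rule nn_integral_density) (simp_all add: sa cong: measurable_cong_sets)
  also have "\<dots> = (\<integral>\<^sup>+z. ennreal (1 / pi) * (ennreal (disk_weight \<alpha> z) * f z) \<partial>lebesgue_on unit_disk)"
    unfolding disk_area_def by (rule nn_integral_density) simp_all
  also have "\<dots> = (\<integral>\<^sup>+z. ennreal (1 / pi) * (ennreal (disk_weight \<alpha> z) * f z) * indicator unit_disk z \<partial>lebesgue)"
    by (rule nn_integral_restrict_space) simp
  also have "\<dots> = (\<integral>\<^sup>+z. ennreal (1 / pi) * (ennreal (disk_weight \<alpha> z) * f z) * indicator unit_disk z \<partial>lborel)"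
    by (rule nn_integral_completion)
  also have "\<dots> = disk_integral \<alpha> f"
  proof (rule nn_integral_cong)
    fix z
    have "ennreal (disk_density \<alpha> z) = ennreal (1 / pi) * ennreal (disk_weight \<alpha> z)"
      by (subst ennreal_mult'[symmetric]) (simp_all add: disk_density_def)
    then show "ennreal (1 / pi) * (ennreal (disk_weight \<alpha> z) * f z) * indicator unit_disk z =
        indicator unit_disk z * (f z * ennreal (disk_density \<alpha> z))"
      by (simp add: mult_ac)
  qed
  finally show ?thesis .
qed

lemma AE_weighted_area:
  assumes "\<alpha> > -1"
  shows "(AE z in weighted_area \<alpha>. P z) \<longleftrightarrow> (AE z in lebesgue_on unit_disk. P z)"
proof -
  have w: "disk_weight \<alpha> \<in> borel_measurable (lebesgue_on unit_disk)"
    by (rule borel_imp_lebesgue_on) measurable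
  have "disk_weight \<alpha> z > 0" if "z \<in> space (lebesgue_on unit_disk)" for z
    using that disk_weight_pos[OF assms] by simp
  then have "(AE z in lebesgue_on unit_disk. 0 < ennreal (disk_weight \<alpha> z) \<longrightarrow> P z) \<longleftrightarrow> (AE z in lebesgue_on unit_disk. P z)"
    by (intro AE_cong) auto
  then show ?thesis
    using w unfolding weighted_area_def disk_area_def
    by (subst AE_density, simp, subst AE_density) auto
qed

text \<open>The squared modulus is uniformly distributed on the disk, since the annulus between the
  radii sqrt x and 1 has area pi (1 - x). A measure on the line that is finite on the rays
  \<open>{x<..}\<close> is determined by them.\<close>

lemma nn_integral_disk_radial:
  assumes [measurable]: "h \<in> borel_measurable borel"
  shows "(\<integral>\<^sup>+z. indicator unit_disk z * h ((cmod z)\<^sup>2) \<partial>lborel) = ennreal pi * (\<integral>\<^sup>+t. indicator {0..1} t * h t \<partial>lborel)"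
proof -
  let ?N = "distr (density lborel (indicator unit_disk)) borel (\<lambda>z. (cmod z)\<^sup>2)"
  let ?L = "density lborel (\<lambda>t::real. ennreal pi * indicator {0..1} t)"
  have "?N = ?L"
  proof (rule measure_eqI_lessThan)
    fix x :: real
    have "(\<lambda>z::complex. (cmod z)\<^sup>2) \<in> borel_measurable borel" by measurable
    then have "(\<lambda>z::complex. (cmod z)\<^sup>2) -` {x<..} \<in> sets borel"
      by (rule measurable_sets_borel) simp
    then have "emeasure ?N {x<..} = emeasure lborel (unit_disk \<inter> (\<lambda>z. (cmod z)\<^sup>2) -` {x<..})"
      by (subst emeasure_distr) (auto simp: emeasure_restricted)
    also have "\<dots> = ennreal (pi * (if x < 0 then 1 else if x < 1 then 1 - x else 0))"
    proof -
      consider "x < 0" | "0 \<le> x" "x < 1" | "x \<ge> 1" by linarith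
      then show ?thesis
      proof cases
        case 1
        then have "unit_disk \<inter> (\<lambda>z. (cmod z)\<^sup>2) -` {x<..} = unit_disk"
          by (auto intro: less_le_trans[OF _ zero_le_power2])
        then show ?thesis using 1 emeasure_ball[of 1 "0::complex"] by (simp add: unit_ball_vol_2)
      next
        case 2
        have lt: "x < (cmod z)\<^sup>2 \<longleftrightarrow> \<not> cmod z \<le> sqrt x" for z
          by (metis abs_norm_cancel not_le real_sqrt_abs real_sqrt_less_iff)
        have "unit_disk \<inter> (\<lambda>z. (cmod z)\<^sup>2) -` {x<..} = unit_disk - cball 0 (sqrt x)"
          by (auto simp: lt)
        moreover have "cball 0 (sqrt x) \<subseteq> (unit_disk :: complex set)"
        proof
          fix w :: complex assume "w \<in> cball 0 (sqrt x)"
          then have "cmod w \<le> sqrt x" by simp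
          also have "\<dots> < 1" using 2 by simp
          finally show "w \<in> unit_disk" by simp
        qed
        ultimately have "emeasure lborel (unit_disk \<inter> (\<lambda>z. (cmod z)\<^sup>2) -` {x<..}) =
            emeasure lborel unit_disk - emeasure lborel (cball (0::complex) (sqrt x))"
          using emeasure_bounded_finite[of "cball (0::complex) (sqrt x)"]
          by (simp only:) (rule emeasure_Diff, auto)
        also have "\<dots> = ennreal pi - ennreal (pi * x)"
          using 2 emeasure_ball[of 1 "0::complex"] emeasure_cball[of "sqrt x" "0::complex"]
          by (simp add: unit_ball_vol_2 mult.commute)
        also have "\<dots> = ennreal (pi * (1 - x))"
          using 2 by (subst ennreal_minus) (auto simp: algebra_simps)
        finally show ?thesis using 2 by simp
      next
        case 3
        have "(cmod z)\<^sup>2 < 1" if "z \<in> unit_disk" for z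
          using one_minus_norm_square_pos[OF that] by simp
        then have "unit_disk \<inter> (\<lambda>z. (cmod z)\<^sup>2) -` {x<..} = {}"
          using 3 by fastforce
        then show ?thesis using 3 by simp
      qed
    qed
    finally have N: "emeasure ?N {x<..} = ennreal (pi * (if x < 0 then 1 else if x < 1 then 1 - x else 0))" .
    then show "emeasure ?N {x<..} < \<infinity>" by simp
    have "emeasure ?L {x<..} = (\<integral>\<^sup>+t. ennreal pi * indicator ({0..1} \<inter> {x<..}) t \<partial>lborel)"
      by (subst emeasure_density) (auto intro!: nn_integral_cong simp: indicator_def)
    also have "\<dots> = ennreal pi * emeasure lborel ({0..1} \<inter> {x<..})"
      by (subst nn_integral_cmult) auto
    also have "\<dots> = ennreal (pi * (if x < 0 then 1 else if x < 1 then 1 - x else 0))"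
    proof -
      consider "x < 0" | "0 \<le> x" "x < 1" | "x \<ge> 1" by linarith
      then show ?thesis
      proof cases
        case 1
        then have "{0..1} \<inter> {x<..} = {0..1}" by auto
        with 1 show ?thesis by simp
      next
        case 2
        then have "{0..1} \<inter> {x<..} = {x<..1}" by auto
        with 2 show ?thesis by (simp add: ennreal_mult)
      next
        case 3
        then have "{0..1} \<inter> {x<..} = {}" by auto
        with 3 show ?thesis by simp
      qed
    qed
    finally show "emeasure ?N {x<..} = emeasure ?L {x<..}" using N by simp
  qed auto
  then have "(\<integral>\<^sup>+t. h t \<partial>?N) = (\<integral>\<^sup>+t. h t \<partial>?L)" by simp
  moreover have "(\<integral>\<^sup>+t. h t \<partial>?N) = (\<integral>\<^sup>+z. indicator unit_disk z * h ((cmod z)\<^sup>2) \<partial>lborel)"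
    by (subst nn_integral_distr) (auto simp: nn_integral_density)
  moreover have "(\<integral>\<^sup>+t. h t \<partial>?L) = ennreal pi * (\<integral>\<^sup>+t. indicator {0..1} t * h t \<partial>lborel)"
    by (subst nn_integral_density) (auto simp: nn_integral_cmult mult.assoc)
  ultimately show ?thesis by simp
qed

text \<open>In the variable t = |z|^2 the mass is (1 + \<alpha>) times the integral of (1 -
  t)^\<alpha> over [0,1]. Reflecting t moves the possible singularity for negative \<alpha> to 0,
  where the power integral is explicit.\<close>

lemma nn_integral_disk_density:
  assumes "\<alpha> > -1"
  shows "(\<integral>\<^sup>+z. indicator unit_disk z * ennreal (disk_density \<alpha> z) \<partial>lborel) = 1"
proof -
  let ?h = "\<lambda>t::real. ennreal ((1 + \<alpha>) / pi * (1 - t) powr \<alpha>)"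
  have hi: "((\<lambda>x. (1 + \<alpha>) / pi * x powr \<alpha>) has_integral ((1 + \<alpha>) / pi * (1 powr (\<alpha> + 1) / (\<alpha> + 1)))) {0..1}"
    using assms by (intro has_integral_mult_right has_integral_powr_from_0) auto
  have "(\<integral>\<^sup>+z. indicator unit_disk z * ennreal (disk_density \<alpha> z) \<partial>lborel) =
      (\<integral>\<^sup>+z. indicator unit_disk z * ?h ((cmod z)\<^sup>2) \<partial>lborel)"
    by (intro nn_integral_cong) (simp add: disk_density_def disk_weight_def)
  also have "\<dots> = ennreal pi * (\<integral>\<^sup>+t. indicator {0..1} t * ?h t \<partial>lborel)"
    by (rule nn_integral_disk_radial) measurable
  also have "(\<integral>\<^sup>+t. indicator {0..1} t * ?h t \<partial>lborel) =
      (\<integral>\<^sup>+x. indicator {0..1} (1 + (-1) * x) * ?h (1 + (-1) * x) \<partial>lborel)"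
    by (subst nn_integral_real_affine[where c = "-1" and t = 1]) auto
  also have "\<dots> = (\<integral>\<^sup>+x. ennreal (indicator {0..1} x * ((1 + \<alpha>) / pi * x powr \<alpha>)) \<partial>lborel)"
    by (intro nn_integral_cong) (auto simp: indicator_def)
  also have "\<dots> = ennreal ((1 + \<alpha>) / pi * (1 powr (\<alpha> + 1) / (\<alpha> + 1)))"
    using assms by (intro nn_integral_has_integral_lebesgue[OF _ hi]) auto
  also have "ennreal pi * \<dots> = 1"
    using assms by (subst ennreal_mult'[symmetric]) (auto simp: field_simps)
  finally show ?thesis .
qed

lemma L2_fun_iff_nn_integral:
  "f \<in> L2_fun M \<longleftrightarrow> f \<in> borel_measurable M \<and> (\<integral>\<^sup>+z. ennreal ((cmod (f z))\<^sup>2) \<partial>M) < \<infinity>"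
  by (auto simp: L2_fun_def integrable_iff_bounded)

lemma nn_integral_L2_norm:
  assumes "f \<in> L2_fun M"
  shows "(\<integral>\<^sup>+z. ennreal ((cmod (f z))\<^sup>2) \<partial>M) = ennreal ((L2_norm M f)\<^sup>2)"
  unfolding L2_norm_square by (rule nn_integral_eq_integral) (use assms in \<open>auto simp: L2_fun_def\<close>)

lemma holomorphic_square_le_ball_integral:
  assumes G: "G holomorphic_on ball z s" and s: "s > 0"
  shows "ennreal ((cmod (G z))\<^sup>2 * (pi * s\<^sup>2)) \<le> (\<integral>\<^sup>+w. indicator (ball z s) w * ennreal ((cmod (G w))\<^sup>2) \<partial>lborel)"
proof -
  have im: "(+) z ` ball 0 s = ball z s"
  proof (intro equalityI subsetI)
    fix w assume "w \<in> ball z s"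
    then have "w = z + (w - z)" "w - z \<in> ball 0 s" by (auto simp: dist_norm norm_minus_commute)
    then show "w \<in> (+) z ` ball 0 s" by (rule image_eqI)
  qed (auto simp: dist_norm)
  have G': "(\<lambda>u. G (z + u)) holomorphic_on ball 0 s"
  proof -
    have "(\<lambda>u. z + u) holomorphic_on ball 0 s" by (intro holomorphic_intros)
    from holomorphic_on_compose_gen[OF this G] im show ?thesis by (simp add: o_def)
  qed
  have [measurable]: "(\<lambda>w. indicator (ball z s) w *\<^sub>R G w) \<in> borel_measurable borel"
    using G by (intro holomorphic_indicator_borel) auto
  have "ennreal ((cmod (G (z + 0)))\<^sup>2) * (\<integral>\<^sup>+u. indicator (ball (0::complex) s) u * 1 \<partial>lborel) \<le>
      (\<integral>\<^sup>+u. indicator (ball 0 s) u * (ennreal ((cmod (G (z + u)))\<^sup>2) * 1) \<partial>lborel)"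
    by (rule holomorphic_square_mean_ge[OF G']) auto
  also have "(\<integral>\<^sup>+u. indicator (ball (0::complex) s) u * 1 \<partial>lborel) = ennreal (pi * s\<^sup>2)"
    using s emeasure_ball[of s "0::complex"] by (simp add: unit_ball_vol_2)
  also have "(\<integral>\<^sup>+u. indicator (ball 0 s) u * (ennreal ((cmod (G (z + u)))\<^sup>2) * 1) \<partial>lborel) =
      (\<integral>\<^sup>+u. indicator (ball 0 s) u * (ennreal ((cmod (indicator (ball z s) (z + u) *\<^sub>R G (z + u)))\<^sup>2) *
         ennreal ((cmod (deriv ((+) z) u))\<^sup>2)) \<partial>lborel)"
  proof (rule nn_integral_cong)
    fix u
    have "deriv ((+) z) u = 1" by (rule DERIV_imp_deriv) (auto intro!: derivative_eq_intros)
    then show "indicator (ball 0 s) u * (ennreal ((cmod (G (z + u)))\<^sup>2) * 1) =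
        indicator (ball 0 s) u * (ennreal ((cmod (indicator (ball z s) (z + u) *\<^sub>R G (z + u)))\<^sup>2) *
         ennreal ((cmod (deriv ((+) z) u))\<^sup>2))"
      by (auto simp: indicator_def dist_norm)
  qed
  also have "\<dots> = (\<integral>\<^sup>+w. indicator ((+) z ` ball 0 s) w * ennreal ((cmod (indicator (ball z s) w *\<^sub>R G w))\<^sup>2) \<partial>lborel)"
  proof (rule nn_integral_holomorphic_image[symmetric])
    show "(\<lambda>w. ennreal ((cmod (indicator (ball z s) w *\<^sub>R G w))\<^sup>2)) \<in> borel_measurable borel"
      by measurable
    show "(\<lambda>u. z + u) holomorphic_on ball 0 s" by (intro holomorphic_intros)
  qed (auto simp: im)
  also have "\<dots> = (\<integral>\<^sup>+w. indicator (ball z s) w * ennreal ((cmod (G w))\<^sup>2) \<partial>lborel)"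
    unfolding im by (intro nn_integral_cong) (auto simp: indicator_def)
  finally show ?thesis by (simp add: ennreal_mult)
qed

text \<open>Members of the two spaces vanish off the disk; holomorphic functions given by a formula,
  such as the kernels, enter the spaces through this extension.\<close>

definition zero_ext :: "(complex \<Rightarrow> complex) \<Rightarrow> complex \<Rightarrow> complex" where
  "zero_ext f z = (if z \<in> unit_disk then f z else 0)"

lemma zero_ext_borel [measurable]:
  assumes "continuous_on unit_disk f"
  shows "zero_ext f \<in> borel_measurable borel"
proof -
  have "zero_ext f = (\<lambda>z. indicator unit_disk z *\<^sub>R f z)"
    by (auto simp: zero_ext_def indicator_def)
  then show ?thesis using assms by (auto intro: borel_measurable_continuous_on_indicator)
qed

lemma weighted_area_measurableI:
  "f \<in> borel_measurable borel \<Longrightarrow> f \<in> borel_measurable (weighted_area \<alpha>)"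
  by (subst measurable_cong_sets[OF sets_weighted_area refl]) (rule borel_imp_lebesgue_on)

lemma L2_fun_weighted_area_iff:
  assumes "f \<in> borel_measurable borel"
  shows "f \<in> L2_fun (weighted_area \<alpha>) \<longleftrightarrow>
    disk_integral \<alpha> (\<lambda>z. ennreal ((cmod (f z))\<^sup>2)) < \<infinity>"
proof -
  have "(\<lambda>z. ennreal ((cmod (f z))\<^sup>2)) \<in> borel_measurable (lebesgue_on unit_disk)"
    using assms by (intro borel_imp_lebesgue_on) measurable
  from nn_integral_weighted_area[OF this] show ?thesis
    using weighted_area_measurableI[OF assms] by (simp add: L2_fun_iff_nn_integral)
qed

lemma L2_norm_weighted_area:
  assumes "f \<in> borel_measurable borel" "f \<in> L2_fun (weighted_area \<alpha>)"
  shows "ennreal ((L2_norm (weighted_area \<alpha>) f)\<^sup>2) =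
    disk_integral \<alpha> (\<lambda>z. ennreal ((cmod (f z))\<^sup>2))"
proof -
  have "(\<lambda>z. ennreal ((cmod (f z))\<^sup>2)) \<in> borel_measurable (lebesgue_on unit_disk)"
    using assms(1) by (intro borel_imp_lebesgue_on) measurable
  from nn_integral_weighted_area[OF this] show ?thesis
    by (simp only: nn_integral_L2_norm[OF assms(2), symmetric])
qed

section \<open>The analytic Bergman space as a Hilbert space of functions\<close>

lemma bergman_space_borel:
  "f \<in> bergman_space \<alpha> \<Longrightarrow> f \<in> borel_measurable borel"
proof -
  assume f: "f \<in> bergman_space \<alpha>"
  then have "zero_ext f \<in> borel_measurable borel"
    by (intro zero_ext_borel holomorphic_on_imp_continuous_on) (simp add: bergman_space_def)
  moreover have "zero_ext f = f" using f by (auto simp: zero_ext_def bergman_space_def)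
  ultimately show ?thesis by simp
qed

lemma harmonic_bergman_space_borel:
  "f \<in> harmonic_bergman_space \<alpha> \<Longrightarrow> f \<in> borel_measurable borel"
proof -
  assume f: "f \<in> harmonic_bergman_space \<alpha>"
  then have "zero_ext f \<in> borel_measurable borel"
    by (intro zero_ext_borel) (simp add: harmonic_bergman_space_def harmonic_on_def C2_on_def C1_on_def)
  moreover have "zero_ext f = f" using f by (auto simp: zero_ext_def harmonic_bergman_space_def)
  ultimately show ?thesis by simp
qed

text \<open>The set where a continuous function is nonzero is open, and an open null set is
  empty.\<close>

lemma L2_norm_zero_imp_zero:
  assumes \<alpha>: "\<alpha> > -1" and f: "continuous_on unit_disk f" "f \<in> L2_fun (weighted_area \<alpha>)"
    and 0: "L2_norm (weighted_area \<alpha>) f = 0" and z: "z \<in> unit_disk"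
  shows "f z = 0"
proof (rule ccontr)
  assume "f z \<noteq> 0"
  define U where "U = {w \<in> unit_disk. f w \<noteq> 0}"
  have U: "open U"
    using continuous_open_preimage[OF f(1) open_ball, of "- {0}"] by (auto simp: U_def vimage_def Int_def)
  have "AE w in weighted_area \<alpha>. (cmod (f w))\<^sup>2 = 0"
    using 0 f(2) by (subst integral_nonneg_eq_0_iff_AE[symmetric]) (auto simp: L2_norm_def L2_fun_def)
  then have "AE w in lebesgue_on unit_disk. f w = 0"
    by (simp add: AE_weighted_area[OF \<alpha>])
  then have "AE w in lebesgue. w \<in> unit_disk \<longrightarrow> f w = 0"
    by (subst (asm) AE_restrict_space_iff) auto
  then have "AE w in lebesgue. w \<notin> U" by (auto simp: U_def)
  then have "negligible U"
    using U by (subst (asm) AE_iff_null_sets[symmetric]) (auto simp: negligible_iff_null_sets)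
  then have "U = {}" using open_not_negligible[OF U] by blast
  then show False using \<open>f z \<noteq> 0\<close> z by (auto simp: U_def)
qed

lemma disk_density_lower_bound:
  assumes \<alpha>: "\<alpha> > -1" and r: "0 \<le> r" "r < 1"
  obtains k where "k > 0" "\<And>z. cmod z \<le> r \<Longrightarrow> k \<le> disk_density \<alpha> z"
proof -
  have "\<exists>z\<in>cball 0 r. \<forall>w\<in>cball 0 r. disk_density \<alpha> z \<le> disk_density \<alpha> w"
  proof (rule continuous_attains_inf)
    have "1 - (cmod z)\<^sup>2 \<noteq> 0" if "z \<in> cball 0 r" for z
      using one_minus_norm_square_pos[of z] that r by auto
    then show "continuous_on (cball 0 r) (disk_density \<alpha>)"
      unfolding disk_density_def[abs_def] disk_weight_def[abs_def] by (intro continuous_intros) auto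
  qed (use r in auto)
  then obtain z where z: "z \<in> cball 0 r" "\<And>w. w \<in> cball 0 r \<Longrightarrow> disk_density \<alpha> z \<le> disk_density \<alpha> w" by blast
  then have "disk_density \<alpha> z > 0" using r by (intro disk_density_pos \<alpha>) auto
  with z show ?thesis using that by auto
qed

text \<open>The submean inequality is applied on disks of a fixed radius about the points of modulus
  at most \<open>r\<close>. They stay in a smaller concentric disk, on which the density is bounded
  below.\<close>

lemma holomorphic_square_le_weighted:
  assumes \<alpha>: "\<alpha> > -1" and r: "0 \<le> r" "r < 1"
  obtains C where "C > 0" "\<And>G z. G holomorphic_on unit_disk \<Longrightarrow> cmod z \<le> r \<Longrightarrow>
    ennreal ((cmod (G z))\<^sup>2) \<le> ennreal C *
      disk_integral \<alpha> (\<lambda>w. ennreal ((cmod (G w))\<^sup>2))"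
proof -
  \<comment> \<open>Half of the gap between the radius \<open>r\<close> and the unit circle.\<close>
  define s where "s = (1 - r) / 2"
  have s: "s > 0" "r + s < 1" "0 \<le> r + s" using r by (auto simp: s_def field_simps)
  obtain k where k: "k > 0" "\<And>z. cmod z \<le> r + s \<Longrightarrow> k \<le> disk_density \<alpha> z"
    using disk_density_lower_bound[OF \<alpha> s(3,2)] by blast
  define C where "C = inverse (pi * s\<^sup>2 * k)"
  have C: "C > 0" using s k by (simp add: C_def)
  have "ennreal ((cmod (G z))\<^sup>2) \<le> ennreal C *
      disk_integral \<alpha> (\<lambda>w. ennreal ((cmod (G w))\<^sup>2))"
    if G: "G holomorphic_on unit_disk" and z: "cmod z \<le> r" for G z
  proof -
    have near: "cmod w \<le> r + s" if "w \<in> ball z s" for w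
      using norm_triangle_sub[of w z] that z by (simp add: dist_norm norm_minus_commute)
    then have sub: "ball z s \<subseteq> unit_disk" using s by fastforce
    have "ennreal k * ennreal ((cmod (G z))\<^sup>2 * (pi * s\<^sup>2)) \<le>
        ennreal k * (\<integral>\<^sup>+w. indicator (ball z s) w * ennreal ((cmod (G w))\<^sup>2) \<partial>lborel)"
      using holomorphic_square_le_ball_integral[OF holomorphic_on_subset[OF G sub] s(1)]
      by (intro mult_left_mono) auto
    also have "\<dots> = (\<integral>\<^sup>+w. ennreal k * (indicator (ball z s) w * ennreal ((cmod (G w))\<^sup>2)) \<partial>lborel)"
    proof -
      have "(\<lambda>w. indicator (ball z s) w * ennreal ((cmod (indicator unit_disk w *\<^sub>R G w))\<^sup>2)) \<in> borel_measurable borel"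
        using holomorphic_indicator_borel[OF G open_ball] by measurable
      also have "(\<lambda>w. indicator (ball z s) w * ennreal ((cmod (indicator unit_disk w *\<^sub>R G w))\<^sup>2)) =
          (\<lambda>w. indicator (ball z s) w * ennreal ((cmod (G w))\<^sup>2))"
        using sub by (intro ext) (auto simp: indicator_def)
      finally show ?thesis by (simp add: nn_integral_cmult)
    qed
    also have "\<dots> \<le> disk_integral \<alpha> (\<lambda>w. ennreal ((cmod (G w))\<^sup>2))"
    proof (rule nn_integral_mono)
      fix w
      show "ennreal k * (indicator (ball z s) w * ennreal ((cmod (G w))\<^sup>2)) \<le>
          indicator unit_disk w * (ennreal ((cmod (G w))\<^sup>2) * ennreal (disk_density \<alpha> w))"
      proof (cases "w \<in> ball z s")
        case True
        have "ennreal k * ennreal ((cmod (G w))\<^sup>2) \<le> ennreal ((cmod (G w))\<^sup>2) * ennreal (disk_density \<alpha> w)"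
          using k(2)[OF near[OF True]] by (subst mult.commute) (intro mult_left_mono ennreal_leI, auto)
        then show ?thesis using True sub by (auto simp: indicator_def)
      qed simp
    qed
    finally have *: "ennreal k * ennreal ((cmod (G z))\<^sup>2 * (pi * s\<^sup>2)) \<le>
      disk_integral \<alpha> (\<lambda>w. ennreal ((cmod (G w))\<^sup>2))" .
    have "ennreal ((cmod (G z))\<^sup>2) = ennreal C * (ennreal k * ennreal ((cmod (G z))\<^sup>2 * (pi * s\<^sup>2)))"
      using s k by (simp add: C_def field_simps flip: ennreal_mult')
    also have "\<dots> \<le> ennreal C *
      disk_integral \<alpha> (\<lambda>w. ennreal ((cmod (G w))\<^sup>2))"
      using * by (rule mult_left_mono) simp
    finally show ?thesis .
  qed
  then show ?thesis using that C by blast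
qed

text \<open>Point evaluations are bounded uniformly on smaller disks, which makes a norm Cauchy
  sequence locally uniformly Cauchy.\<close>

lemma bergman_point_bound:
  assumes \<alpha>: "\<alpha> > -1" and r: "0 \<le> r" "r < 1"
  obtains C where "C > 0" "\<And>f z. f \<in> bergman_space \<alpha> \<Longrightarrow> cmod z \<le> r \<Longrightarrow> cmod (f z) \<le> C * L2_norm (weighted_area \<alpha>) f"
proof -
  obtain C where C: "C > 0" "\<And>G z. G holomorphic_on unit_disk \<Longrightarrow> cmod z \<le> r \<Longrightarrow>
    ennreal ((cmod (G z))\<^sup>2) \<le> ennreal C *
      disk_integral \<alpha> (\<lambda>w. ennreal ((cmod (G w))\<^sup>2))"
    using holomorphic_square_le_weighted[OF assms] by blast
  have "cmod (f z) \<le> sqrt C * L2_norm (weighted_area \<alpha>) f" if f: "f \<in> bergman_space \<alpha>" and z: "cmod z \<le> r" for f z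
  proof -
    have "f holomorphic_on unit_disk" "f \<in> L2_fun (weighted_area \<alpha>)" using f by (auto simp: bergman_space_def)
    then have "ennreal ((cmod (f z))\<^sup>2) \<le> ennreal C * ennreal ((L2_norm (weighted_area \<alpha>) f)\<^sup>2)"
      using C(2)[OF _ z] L2_norm_weighted_area[OF bergman_space_borel[OF f]] by simp
    also have "\<dots> = ennreal ((sqrt C * L2_norm (weighted_area \<alpha>) f)\<^sup>2)"
      using C(1) by (simp add: ennreal_mult power_mult_distrib)
    finally have "(cmod (f z))\<^sup>2 \<le> (sqrt C * L2_norm (weighted_area \<alpha>) f)\<^sup>2"
      by (simp add: ennreal_le_iff)
    then show ?thesis by (rule power2_le_imp_le) (use C(1) in simp)
  qed
  then show ?thesis using that[of "sqrt C"] C(1) by simp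
qed

lemma bergman_add: "f \<in> bergman_space \<alpha> \<Longrightarrow> g \<in> bergman_space \<alpha> \<Longrightarrow> (\<lambda>z. f z + g z) \<in> bergman_space \<alpha>"
  by (auto simp: bergman_space_def intro!: holomorphic_intros L2_fun_add)

lemma bergman_scale: "f \<in> bergman_space \<alpha> \<Longrightarrow> (\<lambda>z. c * f z) \<in> bergman_space \<alpha>"
  by (auto simp: bergman_space_def intro!: holomorphic_intros L2_fun_scale)

lemma bergman_diff: "f \<in> bergman_space \<alpha> \<Longrightarrow> g \<in> bergman_space \<alpha> \<Longrightarrow> (\<lambda>z. f z - g z) \<in> bergman_space \<alpha>"
  using bergman_add[OF _ bergman_scale[of g \<alpha> "-1"]] by simp

text \<open>The locally uniform limit is holomorphic; that it is also the limit in norm, and square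
  integrable, follows from Fatou's lemma.\<close>

lemma bergman_complete:
  assumes \<alpha>: "\<alpha> > -1" and F: "\<And>n::nat. F n \<in> bergman_space \<alpha>"
    and Cau: "\<And>e. e > 0 \<Longrightarrow> \<exists>N. \<forall>m\<ge>N. \<forall>n\<ge>N. L2_norm (weighted_area \<alpha>) (\<lambda>z. F m z - F n z) < e"
  shows "\<exists>f\<in>bergman_space \<alpha>. (\<lambda>n. L2_norm (weighted_area \<alpha>) (\<lambda>z. F n z - f z)) \<longlonglongrightarrow> 0"
proof -
  let ?M = "weighted_area \<alpha>"
  have unif: "uniformly_convergent_on (cball 0 r) F" if r: "0 \<le> r" "r < 1" for r
  proof (rule Cauchy_uniformly_convergent, unfold uniformly_Cauchy_on_def, safe)
    fix e :: real assume e: "e > 0"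
    obtain C where C: "C > 0" "\<And>f z. f \<in> bergman_space \<alpha> \<Longrightarrow> cmod z \<le> r \<Longrightarrow> cmod (f z) \<le> C * L2_norm ?M f"
      using bergman_point_bound[OF \<alpha> r] by blast
    obtain N where N: "\<And>m n. m \<ge> N \<Longrightarrow> n \<ge> N \<Longrightarrow> L2_norm ?M (\<lambda>z. F m z - F n z) < e / C"
      using Cau[of "e / C"] C(1) e by auto
    have "dist (F m z) (F n z) < e" if "z \<in> cball 0 r" "m \<ge> N" "n \<ge> N" for z m n
    proof -
      have "dist (F m z) (F n z) \<le> C * L2_norm ?M (\<lambda>z. F m z - F n z)"
        unfolding dist_norm using that by (intro C(2) bergman_diff F) auto
      also have "\<dots> < C * (e / C)"
        using N[OF that(2,3)] C(1) by (intro mult_strict_left_mono)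
      finally show ?thesis using C(1) by simp
    qed
    then show "\<exists>M. \<forall>x\<in>cball 0 r. \<forall>m\<ge>M. \<forall>n\<ge>M. dist (F m x) (F n x) < e" by blast
  qed
  define g where "g z = (if z \<in> unit_disk then lim (\<lambda>n. F n z) else 0)" for z
  have lim: "uniform_limit (cball 0 r) F g sequentially" if r: "0 \<le> r" "r < 1" for r
  proof -
    have "uniform_limit (cball 0 r) F (\<lambda>z. lim (\<lambda>n. F n z)) sequentially"
      using unif[OF r] by (simp add: uniformly_convergent_uniform_limit_iff)
    then show ?thesis
      by (rule uniform_limit_cong'[THEN iffD1, rotated 2]) (use r in \<open>auto simp: g_def\<close>)
  qed
  have ptw: "(\<lambda>n. F n z) \<longlonglongrightarrow> g z" for z
  proof (cases "z \<in> unit_disk")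
    case True
    then show ?thesis using tendsto_uniform_limitI[OF lim[of "cmod z"]] by simp
  next
    case False
    then have "F n z = 0" for n using F[of n] by (auto simp: bergman_space_def)
    then show ?thesis using False by (simp add: g_def)
  qed
  have ghol: "g holomorphic_on unit_disk"
  proof (rule holomorphic_uniform_sequence[OF open_ball])
    show "F n holomorphic_on unit_disk" for n using F[of n] by (simp add: bergman_space_def)
    fix z :: complex assume z: "z \<in> unit_disk"
    let ?d = "(1 - cmod z) / 2"
    have sub: "cball z ?d \<subseteq> cball 0 (cmod z + ?d)"
    proof
      fix w assume "w \<in> cball z ?d"
      then show "w \<in> cball 0 (cmod z + ?d)"
        using norm_triangle_sub[of w z] by (simp add: dist_norm norm_minus_commute field_simps)
    qed
    have r: "0 \<le> cmod z + ?d" "cmod z + ?d < 1" using z by (auto simp: field_simps)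
    have "uniform_limit (cball z ?d) F g sequentially"
      using uniform_limit_on_subset[OF lim[OF r] sub] .
    moreover have "cball z ?d \<subseteq> unit_disk" using sub r by auto
    ultimately show "\<exists>d. 0 < d \<and> cball z d \<subseteq> unit_disk \<and> uniform_limit (cball z d) F g sequentially"
      using z by (intro exI[of _ ?d]) auto
  qed
  have gb [measurable]: "g \<in> borel_measurable borel"
  proof -
    have "zero_ext g = g" by (auto simp: zero_ext_def g_def)
    then show ?thesis using zero_ext_borel[OF holomorphic_on_imp_continuous_on[OF ghol]] by simp
  qed
  have Fb [measurable]: "F n \<in> borel_measurable borel" for n by (rule bergman_space_borel[OF F])
  have Fm [measurable]: "F n \<in> borel_measurable ?M" and gm [measurable]: "g \<in> borel_measurable ?M" for n
    by (auto intro: weighted_area_measurableI Fb gb)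
  have FL: "F n \<in> L2_fun ?M" for n using F[of n] by (simp add: bergman_space_def)
  \<comment> \<open>Pointwise convergence of \<open>F m\<close> to \<open>g\<close> lets a bound on
    \<open>F n - F m\<close> for large \<open>m\<close> pass to \<open>F n - g\<close>.\<close>
  have fatou: "(\<integral>\<^sup>+z. ennreal ((cmod (F n z - g z))\<^sup>2) \<partial>?M) \<le> ennreal (e\<^sup>2)"
    if "\<And>m. m \<ge> N \<Longrightarrow> L2_norm ?M (\<lambda>z. F n z - F m z) \<le> e" for n N e
  proof -
    have "(\<integral>\<^sup>+z. ennreal ((cmod (F n z - g z))\<^sup>2) \<partial>?M) =
        (\<integral>\<^sup>+z. liminf (\<lambda>m. ennreal ((cmod (F n z - F m z))\<^sup>2)) \<partial>?M)"
    proof (rule nn_integral_cong)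
      fix z
      have "(\<lambda>m. ennreal ((cmod (F n z - F m z))\<^sup>2)) \<longlonglongrightarrow> ennreal ((cmod (F n z - g z))\<^sup>2)"
        by (intro tendsto_ennrealI tendsto_intros ptw)
      then show "ennreal ((cmod (F n z - g z))\<^sup>2) = liminf (\<lambda>m. ennreal ((cmod (F n z - F m z))\<^sup>2))"
        by (intro lim_imp_Liminf[symmetric]) auto
    qed
    also have "\<dots> \<le> liminf (\<lambda>m. \<integral>\<^sup>+z. ennreal ((cmod (F n z - F m z))\<^sup>2) \<partial>?M)"
      by (rule nn_integral_liminf) measurable
    also have "\<dots> \<le> ennreal (e\<^sup>2)"
    proof (rule Liminf_le)
      show "\<forall>\<^sub>F m in sequentially. (\<integral>\<^sup>+z. ennreal ((cmod (F n z - F m z))\<^sup>2) \<partial>?M) \<le> ennreal (e\<^sup>2)"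
        using eventually_ge_at_top[of N]
      proof eventually_elim
        case (elim m)
        have "(\<integral>\<^sup>+z. ennreal ((cmod (F n z - F m z))\<^sup>2) \<partial>?M) = ennreal ((L2_norm ?M (\<lambda>z. F n z - F m z))\<^sup>2)"
          by (intro nn_integral_L2_norm L2_fun_diff FL)
        also have "\<dots> \<le> ennreal (e\<^sup>2)"
          by (intro ennreal_leI power_mono that elim) auto
        finally show ?case .
      qed
    qed simp
    finally show ?thesis .
  qed
  have diffL: "(\<lambda>z. F n z - g z) \<in> L2_fun ?M \<and> L2_norm ?M (\<lambda>z. F n z - g z) \<le> e"
    if e: "e > 0" and N: "\<And>m. m \<ge> N \<Longrightarrow> L2_norm ?M (\<lambda>z. F n z - F m z) \<le> e" for n N e
  proof
    have fat: "(\<integral>\<^sup>+z. ennreal ((cmod (F n z - g z))\<^sup>2) \<partial>?M) \<le> ennreal (e\<^sup>2)"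
      by (rule fatou) (rule N)
    show L: "(\<lambda>z. F n z - g z) \<in> L2_fun ?M"
      using le_less_trans[OF fat ennreal_less_top] by (auto simp: L2_fun_iff_nn_integral)
    have "(L2_norm ?M (\<lambda>z. F n z - g z))\<^sup>2 \<le> e\<^sup>2"
      using fat by (simp add: nn_integral_L2_norm[OF L])
    then show "L2_norm ?M (\<lambda>z. F n z - g z) \<le> e"
      by (rule power2_le_imp_le) (use e in simp)
  qed
  obtain N where N: "\<And>m n. m \<ge> N \<Longrightarrow> n \<ge> N \<Longrightarrow> L2_norm ?M (\<lambda>z. F m z - F n z) < 1"
    using Cau[of 1] by auto
  have "(\<lambda>z. F N z - g z) \<in> L2_fun ?M"
    using diffL[of 1 N N] N by (simp add: less_imp_le)
  from L2_fun_diff[OF FL[of N] this] have "g \<in> L2_fun ?M" by simp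
  then have "g \<in> bergman_space \<alpha>"
    using ghol by (simp add: bergman_space_def g_def)
  moreover have "(\<lambda>n. L2_norm ?M (\<lambda>z. F n z - g z)) \<longlonglongrightarrow> 0"
  proof (rule LIMSEQ_I)
    fix e :: real assume e: "e > 0"
    obtain N where N: "\<And>m n. m \<ge> N \<Longrightarrow> n \<ge> N \<Longrightarrow> L2_norm ?M (\<lambda>z. F m z - F n z) < e / 2"
      using Cau[of "e / 2"] e by auto
    have "norm (L2_norm ?M (\<lambda>z. F n z - g z) - 0) < e" if "n \<ge> N" for n
    proof -
      have "L2_norm ?M (\<lambda>z. F n z - g z) \<le> e / 2"
        using diffL[of "e / 2" N n] N[OF that] e by (simp add: less_imp_le)
      then show ?thesis using e by simp
    qed
    then show "\<exists>no. \<forall>n\<ge>no. norm (L2_norm ?M (\<lambda>z. F n z - g z) - 0) < e" by blast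
  qed
  ultimately show ?thesis by blast
qed

lemma bergman_l2_subspace:
  assumes \<alpha>: "\<alpha> > -1" shows "l2_subspace (weighted_area \<alpha>) (bergman_space \<alpha>)"
proof
  show "(\<lambda>_. 0) \<in> bergman_space \<alpha>" by (auto simp: bergman_space_def L2_fun_def)
  show "f = (\<lambda>_. 0)" if "f \<in> bergman_space \<alpha>" "L2_norm (weighted_area \<alpha>) f = 0" for f
  proof
    fix z show "f z = 0"
      using that L2_norm_zero_imp_zero[OF \<alpha>, of f z]
      by (cases "z \<in> unit_disk") (auto simp: bergman_space_def holomorphic_on_imp_continuous_on)
  qed
qed (use \<alpha> in \<open>auto intro: bergman_add bergman_scale bergman_complete\<close>, simp add: bergman_space_def)

lemma zero_ext_in_bergman:
  assumes "G holomorphic_on unit_disk"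
    "disk_integral \<alpha> (\<lambda>z. ennreal ((cmod (G z))\<^sup>2)) < \<infinity>"
  shows "zero_ext G \<in> bergman_space \<alpha>"
proof -
  have "zero_ext G holomorphic_on unit_disk"
    using assms(1) by (rule holomorphic_transform) (simp add: zero_ext_def)
  moreover have "zero_ext G \<in> L2_fun (weighted_area \<alpha>)"
  proof (subst L2_fun_weighted_area_iff)
    show "zero_ext G \<in> borel_measurable borel"
      by (intro zero_ext_borel holomorphic_on_imp_continuous_on assms)
    have "disk_integral \<alpha> (\<lambda>z. ennreal ((cmod (zero_ext G z))\<^sup>2)) =
      disk_integral \<alpha> (\<lambda>z. ennreal ((cmod (G z))\<^sup>2))"
      by (intro nn_integral_cong) (auto simp: zero_ext_def indicator_def)
    with assms(2) show "disk_integral \<alpha> (\<lambda>z. ennreal ((cmod (zero_ext G z))\<^sup>2)) < \<infinity>"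
      by simp
  qed
  ultimately show ?thesis by (auto simp: bergman_space_def zero_ext_def)
qed

text \<open>The orthogonality relation is between integrals with values in [0, \<infinity>], so it
  may be applied before either part is known to be square integrable, and then yields exactly
  that.\<close>

lemma harmonic_bergman_decomposition:
  assumes f: "f \<in> harmonic_bergman_space \<alpha>"
  obtains g h where "g \<in> bergman_space \<alpha>" "h \<in> bergman_space \<alpha>" "h 0 = 0" "f = (\<lambda>z. g z + cnj (h z))"
proof -
  have har: "harmonic_on unit_disk f" using f by (simp add: harmonic_bergman_space_def)
  obtain G H where G: "G holomorphic_on unit_disk" and H: "H holomorphic_on unit_disk" "H 0 = 0"
    and GH: "\<And>z. z \<in> unit_disk \<Longrightarrow> f z = G z + cnj (H z)"
    using harmonic_on_imp_holomorphic_decomposition[OF har, of 0] by auto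
  have "disk_integral \<alpha> (\<lambda>z. ennreal ((cmod (G z))\<^sup>2 + (cmod (H z))\<^sup>2)) =
      disk_integral \<alpha> (\<lambda>z. ennreal ((cmod (G z + cnj (H z)))\<^sup>2))"
    by (rule nn_integral_harmonic_orthogonal[OF G H, symmetric]) (auto simp: disk_density_rotate)
  also have "\<dots> = disk_integral \<alpha> (\<lambda>z. ennreal ((cmod (f z))\<^sup>2))"
    using GH by (intro nn_integral_cong) (auto simp: indicator_def)
  also have "\<dots> < \<infinity>"
    using f L2_fun_weighted_area_iff[OF harmonic_bergman_space_borel[OF f]] by (simp add: harmonic_bergman_space_def)
  finally have fin: "disk_integral \<alpha> (\<lambda>z. ennreal ((cmod (G z))\<^sup>2 + (cmod (H z))\<^sup>2)) < \<infinity>" .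
  have z1: "zero_ext G \<in> bergman_space \<alpha>"
    by (rule zero_ext_in_bergman[OF G], rule le_less_trans[OF _ fin])
      (intro nn_integral_mono mult_left_mono mult_right_mono ennreal_leI, auto)
  have z2: "zero_ext H \<in> bergman_space \<alpha>"
    by (rule zero_ext_in_bergman[OF H(1)], rule le_less_trans[OF _ fin])
      (intro nn_integral_mono mult_left_mono mult_right_mono ennreal_leI, auto)
  have z3: "f = (\<lambda>z. zero_ext G z + cnj (zero_ext H z))"
    using f GH by (auto simp: zero_ext_def harmonic_bergman_space_def)
  show ?thesis
    by (rule that[OF z1 z2 _ z3]) (simp add: zero_ext_def H(2))
qed

section \<open>The harmonic Bergman space as an orthogonal sum\<close>

lemma L2_fun_cnj: "f \<in> L2_fun M \<Longrightarrow> (\<lambda>z. cnj (f z)) \<in> L2_fun M"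
  by (auto simp: L2_fun_def)

lemma L2_norm_cnj: "L2_norm M (\<lambda>z. cnj (f z)) = L2_norm M f"
  by (simp add: L2_norm_def)

lemma bergman_add_cnj:
  assumes "g \<in> bergman_space \<alpha>" "h \<in> bergman_space \<alpha>"
  shows "(\<lambda>z. g z + cnj (h z)) \<in> harmonic_bergman_space \<alpha>"
  using assms unfolding harmonic_bergman_space_def
  by (auto simp: bergman_space_def intro!: harmonic_on_holomorphic_add_cnj[of _ g h] L2_fun_add L2_fun_cnj)

lemma L2_norm_bergman_add_cnj:
  assumes g: "g \<in> bergman_space \<alpha>" and h: "h \<in> bergman_space \<alpha>" and "h 0 = 0"
  shows "(L2_norm (weighted_area \<alpha>) (\<lambda>z. g z + cnj (h z)))\<^sup>2 =
    (L2_norm (weighted_area \<alpha>) g)\<^sup>2 + (L2_norm (weighted_area \<alpha>) h)\<^sup>2"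
proof -
  note [measurable] = bergman_space_borel[OF g] bergman_space_borel[OF h]
  have L: "g \<in> L2_fun (weighted_area \<alpha>)" "h \<in> L2_fun (weighted_area \<alpha>)"
    using g h by (auto simp: bergman_space_def)
  have "ennreal ((L2_norm (weighted_area \<alpha>) (\<lambda>z. g z + cnj (h z)))\<^sup>2) =
      disk_integral \<alpha> (\<lambda>z. ennreal ((cmod (g z + cnj (h z)))\<^sup>2))"
    by (rule L2_norm_weighted_area) (measurable, intro L2_fun_add L2_fun_cnj L)
  also have "\<dots> = disk_integral \<alpha> (\<lambda>z. ennreal ((cmod (g z))\<^sup>2 + (cmod (h z))\<^sup>2))"
    using g h \<open>h 0 = 0\<close>
    by (intro nn_integral_harmonic_orthogonal) (auto simp: bergman_space_def disk_density_rotate)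
  also have "\<dots> = (\<integral>\<^sup>+z. indicator unit_disk z * (ennreal ((cmod (g z))\<^sup>2) * ennreal (disk_density \<alpha> z)) +
      indicator unit_disk z * (ennreal ((cmod (h z))\<^sup>2) * ennreal (disk_density \<alpha> z)) \<partial>lborel)"
    by (intro nn_integral_cong) (simp add: ennreal_plus distrib_left distrib_right)
  also have "\<dots> = ennreal ((L2_norm (weighted_area \<alpha>) g)\<^sup>2) + ennreal ((L2_norm (weighted_area \<alpha>) h)\<^sup>2)"
    by (subst nn_integral_add) (auto simp: L2_norm_weighted_area L)
  finally show ?thesis
    by (simp flip: ennreal_plus)
qed

text \<open>Completeness is inherited from the analytic space: by Pythagoras the holomorphic and the
  antiholomorphic parts of a Cauchy sequence are Cauchy themselves. Fixing \<open>H n 0 = 0\<close>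
  makes the parts of a difference the differences of the parts.\<close>

lemma harmonic_bergman_l2_subspace:
  assumes \<alpha>: "\<alpha> > -1" shows "l2_subspace (weighted_area \<alpha>) (harmonic_bergman_space \<alpha>)"
proof
  let ?M = "weighted_area \<alpha>"
  interpret A: l2_subspace ?M "bergman_space \<alpha>" by (rule bergman_l2_subspace[OF \<alpha>])
  show "(\<lambda>_. 0) \<in> harmonic_bergman_space \<alpha>" using bergman_add_cnj[OF A.zero A.zero] by simp
  show "f \<in> L2_fun ?M" if "f \<in> harmonic_bergman_space \<alpha>" for f
    using that by (simp add: harmonic_bergman_space_def)
  show "f = (\<lambda>_. 0)" if f: "f \<in> harmonic_bergman_space \<alpha>" and "L2_norm ?M f = 0" for f
  proof
    fix z show "f z = 0"
      using that L2_norm_zero_imp_zero[OF \<alpha>, of f z]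
      by (cases "z \<in> unit_disk") (auto simp: harmonic_bergman_space_def harmonic_on_def C2_on_def C1_on_def)
  qed
  show "(\<lambda>z. f z + g z) \<in> harmonic_bergman_space \<alpha>"
    if fg: "f \<in> harmonic_bergman_space \<alpha>" "g \<in> harmonic_bergman_space \<alpha>" for f g
  proof -
    obtain a b where ab: "a \<in> bergman_space \<alpha>" "b \<in> bergman_space \<alpha>" "f = (\<lambda>z. a z + cnj (b z))"
      using harmonic_bergman_decomposition[OF fg(1)] by blast
    obtain c d where cd: "c \<in> bergman_space \<alpha>" "d \<in> bergman_space \<alpha>" "g = (\<lambda>z. c z + cnj (d z))"
      using harmonic_bergman_decomposition[OF fg(2)] by blast
    show ?thesis
      using bergman_add_cnj[OF bergman_add[OF ab(1) cd(1)] bergman_add[OF ab(2) cd(2)]]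
      by (simp add: ab(3) cd(3) algebra_simps)
  qed
  show "(\<lambda>z. c * f z) \<in> harmonic_bergman_space \<alpha>" if f: "f \<in> harmonic_bergman_space \<alpha>" for f c
  proof -
    obtain a b where ab: "a \<in> bergman_space \<alpha>" "b \<in> bergman_space \<alpha>" "f = (\<lambda>z. a z + cnj (b z))"
      using harmonic_bergman_decomposition[OF f] by blast
    show ?thesis
      using bergman_add_cnj[OF bergman_scale[OF ab(1), of c] bergman_scale[OF ab(2), of "cnj c"]]
      by (simp add: ab(3) algebra_simps)
  qed
  fix F :: "nat \<Rightarrow> complex \<Rightarrow> complex"
  assume F: "\<And>n. F n \<in> harmonic_bergman_space \<alpha>"
    and Cau: "\<And>e. e > 0 \<Longrightarrow> \<exists>N. \<forall>m\<ge>N. \<forall>n\<ge>N. L2_norm ?M (\<lambda>z. F m z - F n z) < e"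
  have "\<forall>n. \<exists>p. fst p \<in> bergman_space \<alpha> \<and> snd p \<in> bergman_space \<alpha> \<and> snd p 0 = 0 \<and> F n = (\<lambda>z. fst p z + cnj (snd p z))"
  proof
    fix n
    obtain g h where "g \<in> bergman_space \<alpha>" "h \<in> bergman_space \<alpha>" "h 0 = 0" "F n = (\<lambda>z. g z + cnj (h z))"
      using harmonic_bergman_decomposition[OF F[of n]] by blast
    then show "\<exists>p. fst p \<in> bergman_space \<alpha> \<and> snd p \<in> bergman_space \<alpha> \<and> snd p 0 = 0 \<and> F n = (\<lambda>z. fst p z + cnj (snd p z))"
      by (intro exI[of _ "(g, h)"]) simp
  qed
  from choice[OF this] obtain p where p: "\<And>n. fst (p n) \<in> bergman_space \<alpha>" "\<And>n. snd (p n) \<in> bergman_space \<alpha>"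
    "\<And>n. snd (p n) 0 = 0" "\<And>n. F n = (\<lambda>z. fst (p n) z + cnj (snd (p n) z))" by blast
  define G where "G n = fst (p n)" for n
  define H where "H n = snd (p n)" for n
  have GH: "G n \<in> bergman_space \<alpha>" "H n \<in> bergman_space \<alpha>" "H n 0 = 0" "F n = (\<lambda>z. G n z + cnj (H n z))" for n
    using p by (auto simp: G_def H_def)
  have le: "L2_norm ?M (\<lambda>z. G m z - G n z) \<le> L2_norm ?M (\<lambda>z. F m z - F n z)"
    "L2_norm ?M (\<lambda>z. H m z - H n z) \<le> L2_norm ?M (\<lambda>z. F m z - F n z)" for m n
  proof -
    have "(\<lambda>z. F m z - F n z) = (\<lambda>z. (G m z - G n z) + cnj (H m z - H n z))"
      by (simp add: GH(4) algebra_simps)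
    then have "(L2_norm ?M (\<lambda>z. F m z - F n z))\<^sup>2 = (L2_norm ?M (\<lambda>z. G m z - G n z))\<^sup>2 + (L2_norm ?M (\<lambda>z. H m z - H n z))\<^sup>2"
      using L2_norm_bergman_add_cnj[OF bergman_diff[OF GH(1)[of m] GH(1)[of n]] bergman_diff[OF GH(2)[of m] GH(2)[of n]]]
      by (simp add: GH(3))
    then show "L2_norm ?M (\<lambda>z. G m z - G n z) \<le> L2_norm ?M (\<lambda>z. F m z - F n z)"
      "L2_norm ?M (\<lambda>z. H m z - H n z) \<le> L2_norm ?M (\<lambda>z. F m z - F n z)"
      by (auto intro!: power2_le_imp_le[OF _ L2_norm_nonneg])
  qed
  have "\<exists>N. \<forall>m\<ge>N. \<forall>n\<ge>N. L2_norm ?M (\<lambda>z. G m z - G n z) < e"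
    "\<exists>N. \<forall>m\<ge>N. \<forall>n\<ge>N. L2_norm ?M (\<lambda>z. H m z - H n z) < e" if "e > 0" for e
    using Cau[OF that] le by (meson le_less_trans)+
  note CGH = this
  obtain g where g: "g \<in> bergman_space \<alpha>" "(\<lambda>n. L2_norm ?M (\<lambda>z. G n z - g z)) \<longlonglongrightarrow> 0"
    using bergman_complete[OF \<alpha> GH(1) CGH(1)] by blast
  obtain h where h: "h \<in> bergman_space \<alpha>" "(\<lambda>n. L2_norm ?M (\<lambda>z. H n z - h z)) \<longlonglongrightarrow> 0"
    using bergman_complete[OF \<alpha> GH(2) CGH(2)] by blast
  have "(\<lambda>n. L2_norm ?M (\<lambda>z. F n z - (g z + cnj (h z)))) \<longlonglongrightarrow> 0"
  proof (rule tendsto_sandwich[OF _ _ tendsto_const])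
    have "L2_norm ?M (\<lambda>z. F n z - (g z + cnj (h z))) \<le> L2_norm ?M (\<lambda>z. G n z - g z) + L2_norm ?M (\<lambda>z. H n z - h z)" for n
    proof -
      have "L2_norm ?M (\<lambda>z. (G n z - g z) - cnj (h z - H n z)) \<le> L2_norm ?M (\<lambda>z. G n z - g z) + L2_norm ?M (\<lambda>z. cnj (h z - H n z))"
        by (intro L2_norm_triangle_diff L2_fun_diff L2_fun_cnj A.sub GH g h)
      also have "L2_norm ?M (\<lambda>z. cnj (h z - H n z)) = L2_norm ?M (\<lambda>z. H n z - h z)"
        unfolding L2_norm_cnj by (simp add: L2_norm_def norm_minus_commute)
      finally show ?thesis by (simp add: GH(4) algebra_simps)
    qed
    then show "\<forall>\<^sub>F n in sequentially. L2_norm ?M (\<lambda>z. F n z - (g z + cnj (h z))) \<le>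
        L2_norm ?M (\<lambda>z. G n z - g z) + L2_norm ?M (\<lambda>z. H n z - h z)" by simp
    show "(\<lambda>n. L2_norm ?M (\<lambda>z. G n z - g z) + L2_norm ?M (\<lambda>z. H n z - h z)) \<longlonglongrightarrow> 0"
      using tendsto_add[OF g(2) h(2)] by simp
  qed simp
  then show "\<exists>f\<in>harmonic_bergman_space \<alpha>. (\<lambda>n. L2_norm ?M (\<lambda>z. F n z - f z)) \<longlonglongrightarrow> 0"
    using bergman_add_cnj[OF g(1) h(1)] by (intro bexI[of _ "\<lambda>z. g z + cnj (h z)"])
qed

section \<open>Zero sets of harmonic functions\<close>

lemma lborel_complex_eq_distr: "(lborel :: complex measure) = distr (lborel \<Otimes>\<^sub>M lborel) borel (\<lambda>p. Complex (fst p) (snd p))"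
proof (rule lborel_eqI)
  fix l u :: complex
  assume le: "\<And>b. b \<in> Basis \<Longrightarrow> l \<bullet> b \<le> u \<bullet> b"
  have [measurable]: "(\<lambda>p. Complex (fst p) (snd p)) \<in> borel_measurable (lborel \<Otimes>\<^sub>M lborel)"
    unfolding Complex_eq by measurable
  have "(\<lambda>p. Complex (fst p) (snd p)) -` box l u = box (Re l) (Re u) \<times> box (Im l) (Im u)"
    by (auto simp: box_def Basis_complex_def)
  then have "emeasure (distr (lborel \<Otimes>\<^sub>M lborel) borel (\<lambda>p. Complex (fst p) (snd p))) (box l u) =
      emeasure (lborel \<Otimes>\<^sub>M lborel) (box (Re l) (Re u) \<times> box (Im l) (Im u))"
    by (subst emeasure_distr) (auto simp: space_pair_measure)
  also have "\<dots> = emeasure lborel (box (Re l) (Re u)) * emeasure lborel (box (Im l) (Im u))"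
    by (intro lborel.emeasure_pair_measure_Times) auto
  also have "\<dots> = (\<Prod>b\<in>Basis. (u - l) \<bullet> b)"
    using le[of 1] le[of \<i>] by (simp add: Basis_complex_def ennreal_mult)
  finally show "emeasure (distr (lborel \<Otimes>\<^sub>M lborel) borel (\<lambda>p. Complex (fst p) (snd p))) (box l u) =
      (\<Prod>b\<in>Basis. (u - l) \<bullet> b)" .
qed simp

lemma emeasure_complex_slices:
  assumes [measurable]: "E \<in> sets borel"
  shows "emeasure lborel E = (\<integral>\<^sup>+y. emeasure lborel {x. Complex x y \<in> E} \<partial>lborel)"
proof -
  have [measurable]: "(\<lambda>p. Complex (fst p) (snd p)) \<in> borel_measurable (borel \<Otimes>\<^sub>M borel)"
    unfolding Complex_eq by measurable
  have sl: "{x. Complex x y \<in> E} \<in> sets borel" for y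
  proof -
    have "(\<lambda>x. Complex x y) \<in> borel_measurable borel" unfolding Complex_eq by measurable
    from measurable_sets_borel[OF this assms] show ?thesis by (simp add: vimage_def)
  qed
  have "emeasure lborel E = (\<integral>\<^sup>+z. indicator E z \<partial>lborel)" by simp
  also have "\<dots> = (\<integral>\<^sup>+p. indicator E (Complex (fst p) (snd p)) \<partial>(lborel \<Otimes>\<^sub>M lborel))"
    by (subst lborel_complex_eq_distr, subst nn_integral_distr) (auto cong: measurable_cong_sets)
  also have "\<dots> = (\<integral>\<^sup>+y. \<integral>\<^sup>+x. indicator E (Complex x y) \<partial>lborel \<partial>lborel)"
    by (subst lborel_pair.nn_integral_snd[symmetric]) (auto simp: case_prod_beta)
  also have "\<dots> = (\<integral>\<^sup>+y. emeasure lborel {x. Complex x y \<in> E} \<partial>lborel)"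
  proof (rule nn_integral_cong)
    fix y
    have "(\<lambda>x. indicator E (Complex x y)) = (indicator {x. Complex x y \<in> E} :: real \<Rightarrow> ennreal)"
      by (auto simp: indicator_def)
    then show "(\<integral>\<^sup>+x. indicator E (Complex x y) \<partial>lborel) = emeasure lborel {x. Complex x y \<in> E}"
      using sl[of y] by simp
  qed
  finally show ?thesis .
qed

text \<open>On a line, \<open>G + cnj H\<close> extends to a holomorphic function of the complexified parameter.\<close>

lemma harmonic_zero_on_line:
  assumes B: "open B" "convex B" and G: "G holomorphic_on B" and H: "H holomorphic_on B"
    and unc: "uncountable {t::real. p + of_real t * d \<in> B \<and> G (p + of_real t * d) + cnj (H (p + of_real t * d)) = 0}"
    and t: "p + of_real t * d \<in> B"
  shows "G (p + of_real t * d) + cnj (H (p + of_real t * d)) = 0"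
proof -
  define S where "S = {\<zeta>. p + \<zeta> * d \<in> B} \<inter> {\<zeta>. p + cnj \<zeta> * d \<in> B}"
  \<comment> \<open>Conjugating the parameter inside and the value outside keeps the second summand
    holomorphic; for real parameters \<open>F\<close> is the given function on the line.\<close>
  define F where "F \<zeta> = G (p + \<zeta> * d) + cnj (H (p + cnj \<zeta> * d))" for \<zeta>
  have "open ((\<lambda>\<zeta>. p + \<zeta> * d) -` B)" "open ((\<lambda>\<zeta>. p + cnj \<zeta> * d) -` B)"
    by (intro open_vimage B continuous_intros)+
  then have S: "open S" by (auto simp: S_def vimage_def)
  \<comment> \<open>Convexity of both preimages gives a connected domain, as the identity theorem
    demands.\<close>
  have "convex ((\<lambda>\<zeta>. \<zeta> * d) -` ((+) (-p) ` B))" "convex ((\<lambda>\<zeta>. cnj \<zeta> * d) -` ((+) (-p) ` B))"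
    by (intro convex_linear_vimage convex_translation B linearI; simp add: algebra_simps)+
  moreover have "((\<lambda>\<zeta>. \<zeta> * d) -` ((+) (-p) ` B)) = {\<zeta>. p + \<zeta> * d \<in> B}"
    "((\<lambda>\<zeta>. cnj \<zeta> * d) -` ((+) (-p) ` B)) = {\<zeta>. p + cnj \<zeta> * d \<in> B}"
    by (force simp: image_iff algebra_simps)+
  ultimately have conn: "connected S"
    unfolding S_def by (intro convex_connected convex_Int) auto
  have F: "F holomorphic_on S"
  proof -
    have "(\<lambda>\<zeta>. G (p + \<zeta> * d)) holomorphic_on S"
      by (rule holomorphic_on_compose_gen[OF _ G, unfolded o_def]) (auto simp: S_def intro!: holomorphic_intros)
    moreover have "(cnj \<circ> (\<lambda>\<zeta>. H (p + \<zeta> * d)) \<circ> cnj) holomorphic_on S"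
    proof (rule holomorphic_on_compose_cnj_cnj)
      show "(\<lambda>\<zeta>. H (p + \<zeta> * d)) holomorphic_on cnj ` S"
        by (rule holomorphic_on_compose_gen[OF _ H, unfolded o_def]) (auto simp: S_def intro!: holomorphic_intros)
    qed (rule S)
    ultimately show ?thesis
      unfolding F_def by (auto simp: o_def intro: holomorphic_on_add)
  qed
  let ?Z = "{t::real. p + of_real t * d \<in> B \<and> G (p + of_real t * d) + cnj (H (p + of_real t * d)) = 0}"
  have "complex_of_real ` ?Z \<subseteq> {\<zeta> \<in> S. F \<zeta> = 0}"
    by (auto simp: S_def F_def)
  moreover have "uncountable (complex_of_real ` ?Z)"
    using unc by (simp add: countable_image_inj_eq inj_on_def)
  ultimately have unc': "uncountable {\<zeta> \<in> S. F \<zeta> = 0}"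
    using countable_subset by blast
  have fsigmaS: "fsigma S"
  proof -
    obtain C :: "nat \<Rightarrow> complex set" where "\<And>n. compact (C n)" "\<Union>(range C) = S"
      using open_Union_compact_subsets[OF S] by metis
    then show ?thesis by (metis compact_imp_closed fsigma.intros)
  qed
  have "S \<subseteq> {\<zeta> \<in> S. F \<zeta> = 0}"
    using unc' by (intro holomorphic_countable_equal F S conn fsigmaS holomorphic_intros)
  then show ?thesis using t by (auto simp: S_def F_def)
qed

text \<open>By Tonelli it is enough that only countably many horizontal chords meet the zero set in
  uncountably many points. On each such chord the function vanishes identically. If there were
  uncountably many of them, then vertical lines near the imaginary axis would carry uncountably many
  zeros, so the function would vanish on a vertical strip, then on every segment from the centre,
  and in particular at \<open>w\<close>.\<close>

lemma harmonic_zero_set_null: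
  assumes G: "G holomorphic_on ball 0 R" and H: "H holomorphic_on ball 0 R"
    and w: "w \<in> ball 0 R" "G w + cnj (H w) \<noteq> 0"
  shows "emeasure lborel {z \<in> ball 0 R. G z + cnj (H z) = 0} = 0"
proof -
  let ?B = "ball 0 R :: complex set"
  let ?g = "\<lambda>z. G z + cnj (H z)"
  let ?E = "{z \<in> ?B. ?g z = 0}"
  define Y where "Y = {y. uncountable {x. Complex x y \<in> ?E}}"
  have R: "R > 0" using w(1) by (auto intro: le_less_trans[OF norm_ge_zero])
  have E: "?E \<in> sets borel"
  proof -
    have "continuous_on ?B ?g"
      using G H by (intro continuous_intros holomorphic_on_imp_continuous_on)
    then have "(\<lambda>z. indicator ?B z *\<^sub>R ?g z) \<in> borel_measurable borel"
      by (intro borel_measurable_continuous_on_indicator) auto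
    then have "{z \<in> space borel. indicator ?B z *\<^sub>R ?g z = 0} \<in> sets borel" by measurable
    then have "?B \<inter> {z \<in> space borel. indicator ?B z *\<^sub>R ?g z = 0} \<in> sets borel" by auto
    also have "?B \<inter> {z \<in> space borel. indicator ?B z *\<^sub>R ?g z = 0} = ?E" by auto
    finally show ?thesis .
  qed
  have row: "?g (Complex x y) = 0" if "y \<in> Y" "Complex x y \<in> ?B" for x y
  proof -
    have eq: "Complex 0 y + of_real t * 1 = Complex t y" for t by (simp add: complex_eq_iff)
    show ?thesis
      using harmonic_zero_on_line[OF open_ball convex_ball G H, of "Complex 0 y" 1 x] that
      unfolding eq by (simp add: Y_def)
  qed
  have "countable Y"
  proof (rule ccontr)
    assume "uncountable Y"
    \<comment> \<open>A countable exhaustion of the heights leaves uncountably many that keep a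
      fixed distance from \<open>R\<close> and \<open>-R\<close>. This distance \<open>e\<close> is
      the half-width of the strip: a point at such a height and at horizontal distance less than
      \<open>e\<close> from the axis is still in the ball.\<close>
    have "\<exists>n. uncountable (Y \<inter> {- (R - R / real (Suc n)) .. R - R / real (Suc n)})"
    proof (rule ccontr)
      assume "\<nexists>n. uncountable (Y \<inter> {- (R - R / real (Suc n)) .. R - R / real (Suc n)})"
      then have "countable (\<Union>n. Y \<inter> {- (R - R / real (Suc n)) .. R - R / real (Suc n)})"
        by (intro countable_UN) auto
      moreover have "Y \<subseteq> (\<Union>n. Y \<inter> {- (R - R / real (Suc n)) .. R - R / real (Suc n)})"
      proof
        fix y assume y: "y \<in> Y"
        then obtain x where "Complex x y \<in> ?B" unfolding Y_def by (metis (no_types, lifting) countable_empty empty_Collect_eq mem_Collect_eq)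
        then have "\<bar>y\<bar> < R" using abs_Im_le_cmod[of "Complex x y"] by auto
        then obtain n where "inverse (real (Suc n)) < (R - \<bar>y\<bar>) / R"
          using reals_Archimedean[of "(R - \<bar>y\<bar>) / R"] R by auto
        then have "R / real (Suc n) < R - \<bar>y\<bar>" using R by (simp add: field_simps)
        then have "y \<in> Y \<inter> {- (R - R / real (Suc n)) .. R - R / real (Suc n)}" using y by auto
        then show "y \<in> (\<Union>n. Y \<inter> {- (R - R / real (Suc n)) .. R - R / real (Suc n)})" by blast
      qed
      ultimately show False using \<open>uncountable Y\<close> countable_subset by blast
    qed
    then obtain n where n: "uncountable (Y \<inter> {- (R - R / real (Suc n)) .. R - R / real (Suc n)})" by blast
    define e where "e = R / real (Suc n)"
    have e: "e > 0" using R by (simp add: e_def)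
    have strip: "?g z = 0" if z: "z \<in> ?B" "\<bar>Re z\<bar> < e" for z
    proof -
      have eq: "of_real (Re z) + of_real t * \<i> = Complex (Re z) t" for t by (simp add: complex_eq_iff)
      have "Y \<inter> {- (R - e) .. R - e} \<subseteq> {t. Complex (Re z) t \<in> ?B \<and> ?g (Complex (Re z) t) = 0}"
      proof
        fix y assume y: "y \<in> Y \<inter> {- (R - e) .. R - e}"
        have "cmod (Complex (Re z) y) \<le> \<bar>Re z\<bar> + \<bar>y\<bar>" using cmod_le[of "Complex (Re z) y"] by simp
        also have "\<dots> < R" using y z by auto
        finally show "y \<in> {t. Complex (Re z) t \<in> ?B \<and> ?g (Complex (Re z) t) = 0}"
          using row[of y "Re z"] y by simp
      qed
      then have "uncountable {t. Complex (Re z) t \<in> ?B \<and> ?g (Complex (Re z) t) = 0}"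
        using n countable_subset unfolding e_def by blast
      then show ?thesis
        using harmonic_zero_on_line[OF open_ball convex_ball G H, of "of_real (Re z)" \<i> "Im z"] z(1)
        unfolding eq by simp
    qed
    have "?g w = 0"
    proof -
      \<comment> \<open>An initial piece of the segment from 0 to \<open>w\<close> lies in the
        strip; the summand 1 guards against \<open>Re w = 0\<close>.\<close>
      have "{0<..<min 1 (e / (1 + \<bar>Re w\<bar>))} \<subseteq> {t. 0 + of_real t * w \<in> ?B \<and> ?g (0 + of_real t * w) = 0}"
      proof
        fix t assume t: "t \<in> {0<..<min 1 (e / (1 + \<bar>Re w\<bar>))}"
        have "t * cmod w \<le> 1 * cmod w" using t by (intro mult_right_mono) auto
        then have 1: "of_real t * w \<in> ?B" using w(1) t by (simp add: norm_mult)
        have "t * \<bar>Re w\<bar> \<le> t * (1 + \<bar>Re w\<bar>)" using t by (simp add: distrib_left)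
        also have "\<dots> < e" using t by (simp add: field_simps)
        finally have "\<bar>Re (of_real t * w)\<bar> < e" using t by (simp add: abs_mult)
        then show "t \<in> {t. 0 + of_real t * w \<in> ?B \<and> ?g (0 + of_real t * w) = 0}"
          using strip[OF 1] 1 by simp
      qed
      moreover have "uncountable {0<..<min 1 (e / (1 + \<bar>Re w\<bar>))}"
        using e by (subst uncountable_open_interval) simp
      ultimately have "uncountable {t. 0 + of_real t * w \<in> ?B \<and> ?g (0 + of_real t * w) = 0}"
        using countable_subset by blast
      from harmonic_zero_on_line[OF open_ball convex_ball G H this, of 1] w(1) show ?thesis by simp
    qed
    then show False using w(2) by simp
  qed
  then have "AE y in lborel. y \<notin> Y"
    by (intro AE_not_in countable_imp_null_set_lborel)
  then have "AE y in lborel. emeasure lborel {x. Complex x y \<in> ?E} = 0"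
    by eventually_elim (auto simp: Y_def intro!: emeasure_lborel_countable)
  then have "(\<integral>\<^sup>+y. emeasure lborel {x. Complex x y \<in> ?E} \<partial>lborel) = (\<integral>\<^sup>+y. 0 \<partial>(lborel::real measure))"
    by (rule nn_integral_cong_AE)
  then show ?thesis using emeasure_complex_slices[OF E] by simp
qed

section \<open>A local lower bound by normal families\<close>

lemma continuous_on_add_cnj:
  assumes "G holomorphic_on S" "H holomorphic_on S"
  shows "continuous_on S (\<lambda>z. G z + cnj (H z))"
  using holomorphic_on_imp_continuous_on[OF assms(1)] holomorphic_on_imp_continuous_on[OF assms(2)]
  by (intro continuous_intros)

lemma add_cnj_indicator_borel:
  assumes "G holomorphic_on S" "H holomorphic_on S" "open S"
  shows "(\<lambda>z. indicator S z *\<^sub>R (G z + cnj (H z))) \<in> borel_measurable borel"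
  using assms(3) by (intro borel_measurable_continuous_on_indicator continuous_on_add_cnj assms(1,2)) auto

text \<open>The bound on the larger ball gives a subsequence converging uniformly on the smaller
  one, where unit mass prevents a zero limit. The limit is then small only on a set of small
  measure, too small to hold all the mass \<open>\<delta>\<close> of a symbol bounded by 1, so every
  symbol has mass left where the functions are bounded below.\<close>

lemma harmonic_sequence_no_vanishing:
  fixes G H :: "nat \<Rightarrow> complex \<Rightarrow> complex" and \<phi> :: "nat \<Rightarrow> complex \<Rightarrow> real"
  assumes \<rho>: "0 < \<rho>" "\<rho> < R" and K: "K \<ge> 0" and \<delta>: "\<delta> > 0"
    and G: "\<And>n. G n holomorphic_on ball 0 R" and H: "\<And>n. H n holomorphic_on ball 0 R" and H0: "\<And>n. H n 0 = 0"
    and bound: "\<And>n. ball_integral R (\<lambda>z. ennreal ((cmod (G n z + cnj (H n z)))\<^sup>2)) \<le> ennreal K"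
    and norm1: "\<And>n. ball_integral \<rho> (\<lambda>z. ennreal ((cmod (G n z + cnj (H n z)))\<^sup>2)) = 1"
    and \<phi>m [measurable]: "\<And>n. \<phi> n \<in> borel_measurable borel" and \<phi>01: "\<And>n z. 0 \<le> \<phi> n z" "\<And>n z. \<phi> n z \<le> 1"
    and dense: "\<And>n. ennreal \<delta> \<le> ball_integral \<rho> (\<lambda>z. ennreal (\<phi> n z))"
  shows "\<exists>\<eta>>0. \<forall>N. \<exists>n\<ge>N.
    ennreal \<eta> \<le> ball_integral \<rho> (\<lambda>z. ennreal (\<phi> n z * (cmod (G n z + cnj (H n z)))\<^sup>2))"
proof -
  let ?B = "ball 0 R :: complex set" and ?D = "ball 0 \<rho> :: complex set"
  define \<H> where "\<H> = {h. h holomorphic_on ?B \<and> ball_integral R (\<lambda>z. ennreal ((cmod (h z))\<^sup>2)) \<le> ennreal K}"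
  \<comment> \<open>The hypothesis bounds only \<open>G n + cnj (H n)\<close>. Orthogonality with
    constant weight bounds each part, so that Montel's theorem applies to holomorphic
    families.\<close>
  have sum: "ball_integral R (\<lambda>z. ennreal ((cmod (G n z))\<^sup>2 + (cmod (H n z))\<^sup>2)) \<le> ennreal K" for n
    using nn_integral_harmonic_orthogonal[OF G H H0, of "\<lambda>_. 1" n n] bound[of n] by simp
  have GH: "G n \<in> \<H>" "H n \<in> \<H>" for n
    unfolding \<H>_def using G H
    by (auto intro!: order_trans[OF _ sum[of n]] nn_integral_mono mult_left_mono ennreal_leI)
  have bdd: "\<exists>B. \<forall>h\<in>\<H>. \<forall>z\<in>C. cmod (h z) \<le> B" if C: "compact C" "C \<subseteq> ?B" for C
  proof (cases "C = {}")
    case False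
    obtain w where w: "w \<in> C" "\<And>z. z \<in> C \<Longrightarrow> cmod z \<le> cmod w"
      using continuous_attains_sup[OF C(1) False, of cmod] continuous_on_norm_id by (metis continuous_on_norm continuous_on_id)
    \<comment> \<open>As \<open>w\<close> has the largest modulus in \<open>C\<close>, disks of this
      radius about points of \<open>C\<close> stay in the ball.\<close>
    define s where "s = R - cmod w"
    have s: "s > 0" using w C by (auto simp: s_def)
    have "cmod (h z) \<le> sqrt (K / (pi * s\<^sup>2))" if h: "h \<in> \<H>" and z: "z \<in> C" for h z
    proof -
      have sub: "ball z s \<subseteq> ?B"
      proof
        fix u assume "u \<in> ball z s"
        then show "u \<in> ?B"
          using norm_triangle_sub[of u z] w(2)[OF z] by (simp add: s_def dist_norm norm_minus_commute)
      qed
      have "ennreal ((cmod (h z))\<^sup>2 * (pi * s\<^sup>2)) \<le> (\<integral>\<^sup>+u. indicator (ball z s) u * ennreal ((cmod (h u))\<^sup>2) \<partial>lborel)"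
        using h sub s by (intro holomorphic_square_le_ball_integral) (auto simp: \<H>_def intro: holomorphic_on_subset)
      also have "\<dots> \<le> ball_integral R (\<lambda>u. ennreal ((cmod (h u))\<^sup>2))"
      proof (rule nn_integral_mono)
        fix u show "indicator (ball z s) u * ennreal ((cmod (h u))\<^sup>2) \<le> indicator ?B u * ennreal ((cmod (h u))\<^sup>2)"
          using sub by (cases "u \<in> ball z s") (auto simp: indicator_def)
      qed
      also have "\<dots> \<le> ennreal K" using h by (simp add: \<H>_def)
      finally have "(cmod (h z))\<^sup>2 * (pi * s\<^sup>2) \<le> K" using K by (simp add: ennreal_le_iff)
      then have "(cmod (h z))\<^sup>2 \<le> K / (pi * s\<^sup>2)" using s by (simp add: field_simps)
      then show ?thesis by (rule real_le_rsqrt)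
    qed
    then show ?thesis by blast
  qed simp
  have hol: "\<And>h. h \<in> \<H> \<Longrightarrow> h holomorphic_on ?B" by (simp add: \<H>_def)
  have rG: "range G \<subseteq> \<H>" using GH by auto
  obtain g r where g: "g holomorphic_on ?B" and r: "strict_mono (r :: nat \<Rightarrow> nat)"
    and Gu: "\<And>C. compact C \<Longrightarrow> C \<subseteq> ?B \<Longrightarrow> uniform_limit C (G \<circ> r) g sequentially"
    using Montel[OF open_ball hol bdd rG] by metis
  \<comment> \<open>A second subsequence is extracted along the first one, so that both parts
    converge together.\<close>
  have rH: "range (H \<circ> r) \<subseteq> \<H>" using GH by auto
  obtain h q where h: "h holomorphic_on ?B" and q: "strict_mono (q :: nat \<Rightarrow> nat)"
    and Hu: "\<And>C. compact C \<Longrightarrow> C \<subseteq> ?B \<Longrightarrow> uniform_limit C (H \<circ> r \<circ> q) h sequentially"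
    using Montel[OF open_ball hol bdd rH] by metis
  define p where "p = r \<circ> q"
  have p: "strict_mono p" unfolding p_def using r q by (rule strict_mono_o)
  define f where "f n z = G (p n) z + cnj (H (p n) z)" for n z
  define k where "k z = g z + cnj (h z)" for z
  have cb: "compact (cball 0 \<rho> :: complex set)" "cball 0 \<rho> \<subseteq> ?B" using \<rho> by auto
  have unif: "\<exists>N. \<forall>n\<ge>N. \<forall>z\<in>?D. cmod (f n z - k z) < e" if e: "e > 0" for e
  proof -
    have "\<forall>\<^sub>F n in sequentially. \<forall>z\<in>cball 0 \<rho>. dist ((G \<circ> r) n z) (g z) < e / 2"
      using uniform_limitD[OF Gu[OF cb], of "e / 2"] e by auto
    then have 1: "\<forall>\<^sub>F n in sequentially. \<forall>z\<in>cball 0 \<rho>. dist ((G \<circ> r) (q n) z) (g z) < e / 2"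
      using filterlim_subseq[OF q] by (auto simp: filterlim_iff)
    have 2: "\<forall>\<^sub>F n in sequentially. \<forall>z\<in>cball 0 \<rho>. dist ((H \<circ> r \<circ> q) n z) (h z) < e / 2"
      using uniform_limitD[OF Hu[OF cb], of "e / 2"] e by auto
    have "\<forall>\<^sub>F n in sequentially. \<forall>z\<in>?D. cmod (f n z - k z) < e"
      using 1 2
    proof eventually_elim
      case (elim n)
      show ?case
      proof
        fix z :: complex assume z: "z \<in> ?D"
        have "f n z - k z = (G (p n) z - g z) + cnj (H (p n) z - h z)"
          by (simp add: f_def k_def)
        then have "cmod (f n z - k z) \<le> cmod (G (p n) z - g z) + cmod (H (p n) z - h z)"
          by (metis complex_mod_cnj norm_triangle_ineq)
        also have "\<dots> < e / 2 + e / 2"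
          using elim z by (intro add_strict_mono) (auto simp: p_def dist_norm)
        finally show "cmod (f n z - k z) < e" by simp
      qed
    qed
    then show ?thesis by (simp add: eventually_sequentially)
  qed
  have area: "emeasure lborel ?D = ennreal (pi * \<rho>\<^sup>2)"
    using \<rho> emeasure_ball[of \<rho> "0::complex"] by (simp add: unit_ball_vol_2)
  have "\<exists>w\<in>?B. k w \<noteq> 0"
  proof (rule ccontr)
    assume "\<not> (\<exists>w\<in>?B. k w \<noteq> 0)"
    then have k0: "k z = 0" if "z \<in> ?D" for z using that \<rho> by auto
    \<comment> \<open>Chosen so that \<open>e\<close> times the area of the smaller ball is below 1.
      A zero limit would push the mass of some \<open>f N\<close> below 1, against the
      normalisation.\<close>
    define e where "e = 1 / (2 * (1 + pi * \<rho>\<^sup>2))"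
    have pp: "1 + pi * \<rho>\<^sup>2 > 0" by (simp add: add_pos_nonneg)
    have e: "e > 0" "e * (pi * \<rho>\<^sup>2) < 1"
    proof -
      show "e > 0" using pp by (simp add: e_def)
      have "0 \<le> pi * \<rho>\<^sup>2" by simp
      then show "e * (pi * \<rho>\<^sup>2) < 1" using pp by (simp add: e_def field_simps)
    qed
    obtain N where N: "\<And>n z. n \<ge> N \<Longrightarrow> z \<in> ?D \<Longrightarrow> cmod (f n z - k z) < sqrt e"
      using unif[of "sqrt e"] e(1) by (simp only: real_sqrt_gt_0_iff) blast
    have "ball_integral \<rho> (\<lambda>z. ennreal ((cmod (f N z))\<^sup>2)) \<le> (\<integral>\<^sup>+z. ennreal e * indicator ?D z \<partial>lborel)"
    proof (rule nn_integral_mono)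
      fix z
      show "indicator ?D z * ennreal ((cmod (f N z))\<^sup>2) \<le> ennreal e * indicator ?D z"
      proof (cases "z \<in> ?D")
        case True
        then have "(cmod (f N z))\<^sup>2 \<le> (sqrt e)\<^sup>2"
          using N[of N z] k0[OF True] by (intro power_mono) auto
        then show ?thesis using True e by (simp add: ennreal_leI)
      qed simp
    qed
    also have "\<dots> = ennreal (e * (pi * \<rho>\<^sup>2))"
      using e by (subst nn_integral_cmult) (auto simp: area ennreal_mult)
    also have "\<dots> < 1" using e by (simp add: ennreal_less_one_iff)
    finally show False using norm1[of "p N"] by (simp add: f_def)
  qed
  then obtain w where w: "w \<in> ?B" "g w + cnj (h w) \<noteq> 0" by (auto simp: k_def)
  have kb: "(\<lambda>z. indicator ?B z *\<^sub>R k z) \<in> borel_measurable borel"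
    unfolding k_def by (rule add_cnj_indicator_borel[OF g h open_ball])
  \<comment> \<open>Sublevel sets of the limit on the smaller ball; they decrease to part of its
    zero set, hence their measures tend to 0.\<close>
  define Z where "Z m = {z \<in> ?D. cmod (k z) < inverse (real (Suc m))}" for m
  have Zm: "Z m \<in> sets borel" for m
  proof -
    have "{z \<in> space borel. cmod (indicator ?B z *\<^sub>R k z) < inverse (real (Suc m))} \<inter> ?D \<in> sets borel"
      using kb by measurable
    also have "{z \<in> space borel. cmod (indicator ?B z *\<^sub>R k z) < inverse (real (Suc m))} \<inter> ?D = Z m"
      using \<rho> by (auto simp: Z_def)
    finally show ?thesis .
  qed
  have "(\<lambda>m. emeasure lborel (Z m)) \<longlonglongrightarrow> emeasure lborel (\<Inter>m. Z m)"
  proof (rule Lim_emeasure_decseq)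
    show "decseq Z"
      unfolding decseq_Suc_iff Z_def by (auto elim!: less_trans simp: le_imp_inverse_le intro: less_le_trans)
    show "emeasure lborel (Z m) \<noteq> \<infinity>" for m
    proof -
      have "emeasure lborel (Z m) \<le> emeasure lborel ?D" by (rule emeasure_mono) (auto simp: Z_def)
      then show ?thesis using area by (auto simp: top_unique)
    qed
  qed (use Zm in auto)
  moreover have "emeasure lborel (\<Inter>m. Z m) = 0"
  proof -
    have "(\<Inter>m. Z m) \<subseteq> {z \<in> ?B. g z + cnj (h z) = 0}"
    proof
      fix z assume z: "z \<in> (\<Inter>m. Z m)"
      then have lt: "cmod (k z) < inverse (real (Suc m))" and zD: "z \<in> ?D" for m by (auto simp: Z_def)
      have "\<not> cmod (k z) > 0" using reals_Archimedean[of "cmod (k z)"] lt by (meson less_asym)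
      then show "z \<in> {z \<in> ?B. g z + cnj (h z) = 0}" using zD \<rho> by (auto simp: k_def)
    qed
    moreover have "{z \<in> ?B. g z + cnj (h z) = 0} \<in> sets borel"
    proof -
      have "{z \<in> space borel. indicator ?B z *\<^sub>R k z = 0} \<inter> ?B \<in> sets borel" using kb by measurable
      also have "{z \<in> space borel. indicator ?B z *\<^sub>R k z = 0} \<inter> ?B = {z \<in> ?B. g z + cnj (h z) = 0}"
        by (auto simp: k_def)
      finally show ?thesis .
    qed
    ultimately have "emeasure lborel (\<Inter>m. Z m) \<le> emeasure lborel {z \<in> ?B. g z + cnj (h z) = 0}"
      by (intro emeasure_mono) auto
    then show ?thesis using harmonic_zero_set_null[OF g h w] by simp
  qed
  ultimately have "\<forall>\<^sub>F m in sequentially. emeasure lborel (Z m) < ennreal (\<delta> / 2)"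
    using \<delta> by (intro order_tendstoD) auto
  then obtain m where m: "emeasure lborel (Z m) < ennreal (\<delta> / 2)"
    by (auto simp: eventually_sequentially)
  \<comment> \<open>Half of the threshold: off \<open>Z m\<close> the limit is at least
    \<open>2 * \<tau>\<close> in modulus, and uniform convergence up to \<open>\<tau>\<close> leaves
    at least \<open>\<tau>\<close> for \<open>f n\<close>.\<close>
  define \<tau> where "\<tau> = inverse (real (Suc m)) / 2"
  have \<tau>: "\<tau> > 0" by (simp add: \<tau>_def)
  obtain N where N: "\<And>n z. n \<ge> N \<Longrightarrow> z \<in> ?D \<Longrightarrow> cmod (f n z - k z) < \<tau>"
    using unif[OF \<tau>] by blast
  \<comment> \<open>Removing \<open>Z m\<close> costs at most \<open>\<delta> / 2\<close> of the
    mass of the symbol; the remaining half is weighted by at least \<open>\<tau>^2\<close>.\<close>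
  define \<eta> where "\<eta> = \<tau>\<^sup>2 * \<delta> / 2"
  have \<eta>: "\<eta> > 0" using \<tau> \<delta> by (simp add: \<eta>_def)
  have main: "ennreal \<eta> \<le> ball_integral \<rho> (\<lambda>z. ennreal (\<phi> (p n) z * (cmod (f n z))\<^sup>2))" if n: "n \<ge> N" for n
  proof -
    let ?X = "ball_integral \<rho> (\<lambda>z. ennreal (\<phi> (p n) z * (cmod (f n z))\<^sup>2))"
    have fb: "(\<lambda>z. indicator ?B z *\<^sub>R f n z) \<in> borel_measurable borel"
      unfolding f_def by (rule add_cnj_indicator_borel[OF G H open_ball])
    have meas: "(\<lambda>z. indicator ?D z * ennreal (\<phi> (p n) z * (cmod (f n z))\<^sup>2)) \<in> borel_measurable borel"
    proof -
      have "(\<lambda>z. indicator ?D z * ennreal (\<phi> (p n) z * (cmod (indicator ?B z *\<^sub>R f n z))\<^sup>2)) \<in> borel_measurable borel"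
        using fb by measurable
      also have "(\<lambda>z. indicator ?D z * ennreal (\<phi> (p n) z * (cmod (indicator ?B z *\<^sub>R f n z))\<^sup>2)) =
          (\<lambda>z. indicator ?D z * ennreal (\<phi> (p n) z * (cmod (f n z))\<^sup>2))"
        using \<rho> by (intro ext) (auto simp: indicator_def)
      finally show ?thesis .
    qed
    have "ennreal \<delta> \<le> ball_integral \<rho> (\<lambda>z. ennreal (\<phi> (p n) z))" by (rule dense)
    also have "\<dots> \<le> (\<integral>\<^sup>+z. ennreal (1 / \<tau>\<^sup>2) * (indicator ?D z * ennreal (\<phi> (p n) z * (cmod (f n z))\<^sup>2)) + indicator (Z m) z \<partial>lborel)"
    proof (rule nn_integral_mono)
      fix z
      show "indicator ?D z * ennreal (\<phi> (p n) z) \<le>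
        ennreal (1 / \<tau>\<^sup>2) * (indicator ?D z * ennreal (\<phi> (p n) z * (cmod (f n z))\<^sup>2)) + indicator (Z m) z"
      proof (cases "z \<in> ?D - Z m")
        case True
        then have "2 * \<tau> \<le> cmod (k z)" by (auto simp: Z_def \<tau>_def)
        moreover have "cmod (f n z - k z) < \<tau>" using N n True by auto
        ultimately have "\<tau> \<le> cmod (f n z)"
          using norm_triangle_ineq2[of "k z" "f n z"] by (simp add: norm_minus_commute)
        then have "\<tau>\<^sup>2 \<le> (cmod (f n z))\<^sup>2" using \<tau> by (intro power_mono) auto
        then have "\<phi> (p n) z * \<tau>\<^sup>2 \<le> \<phi> (p n) z * (cmod (f n z))\<^sup>2" using \<phi>01 by (intro mult_left_mono)
        then have "\<phi> (p n) z \<le> 1 / \<tau>\<^sup>2 * (\<phi> (p n) z * (cmod (f n z))\<^sup>2)" using \<tau> by (simp add: field_simps)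
        then have "ennreal (\<phi> (p n) z) \<le> ennreal (1 / \<tau>\<^sup>2) * ennreal (\<phi> (p n) z * (cmod (f n z))\<^sup>2)"
          by (simp add: ennreal_leI flip: ennreal_mult')
        then show ?thesis using True by (simp add: indicator_def)
      next
        case False
        then consider "z \<notin> ?D" | "z \<in> Z m" by blast
        then show ?thesis
        proof cases
          case 2
          have "indicator ?D z * ennreal (\<phi> (p n) z) \<le> 1"
            using \<phi>01(2)[of "p n" z] by (auto simp: indicator_def)
          also have "\<dots> \<le> ennreal (1 / \<tau>\<^sup>2) * (indicator ?D z * ennreal (\<phi> (p n) z * (cmod (f n z))\<^sup>2)) + indicator (Z m) z"
            using 2 by (simp add: add_increasing)
          finally show ?thesis .
        qed simp
      qed
    qed
    also have "\<dots> = ennreal (1 / \<tau>\<^sup>2) * ?X + emeasure lborel (Z m)"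
      using Zm[of m] meas by (subst nn_integral_add) (auto simp: nn_integral_cmult)
    also have "\<dots> \<le> ennreal (1 / \<tau>\<^sup>2) * ?X + ennreal (\<delta> / 2)"
      using m by (intro add_left_mono) auto
    finally have "ennreal (\<delta> / 2) + ennreal (\<delta> / 2) \<le> ennreal (1 / \<tau>\<^sup>2) * ?X + ennreal (\<delta> / 2)"
      using \<delta> by (simp flip: ennreal_plus)
    then have "ennreal (\<delta> / 2) \<le> ennreal (1 / \<tau>\<^sup>2) * ?X"
      by (simp add: ennreal_add_left_cancel_le add.commute)
    then have "ennreal (\<tau>\<^sup>2) * ennreal (\<delta> / 2) \<le> ennreal (\<tau>\<^sup>2) * (ennreal (1 / \<tau>\<^sup>2) * ?X)"
      by (rule mult_left_mono) simp
    moreover have "ennreal (\<tau>\<^sup>2) * ennreal (1 / \<tau>\<^sup>2) = 1"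
      using \<tau> by (simp flip: ennreal_mult')
    ultimately show ?thesis
      by (simp add: \<eta>_def mult.assoc[symmetric] flip: ennreal_mult')
  qed
  show ?thesis
  proof (intro exI[of _ \<eta>] conjI \<eta> allI)
    fix M
    have "p (max N M) \<ge> max N M" using strict_mono_imp_increasing[OF p] .
    then show "\<exists>n\<ge>M. ennreal \<eta> \<le> ball_integral \<rho> (\<lambda>z. ennreal (\<phi> n z * (cmod (G n z + cnj (H n z)))\<^sup>2))"
      using main[of "max N M"] by (intro exI[of _ "p (max N M)"]) (auto simp: f_def)
  qed
qed

text \<open>If no constant works, the failures at 1/(n+1) form a sequence which, rescaled to unit
  mass on the smaller ball, contradicts the preceding lemma. What matters is that the constant
  depends on \<open>\<rho>\<close>, \<open>R\<close>, \<open>K\<close> and \<open>\<delta>\<close>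
  only: it will be used at all centres at once.\<close>

lemma harmonic_local_lower_bound:
  assumes \<rho>: "0 < \<rho>" "\<rho> < R" and K: "K \<ge> 0" and \<delta>: "\<delta> > 0"
  shows "\<exists>\<eta>>0. \<forall>G H \<phi>. G holomorphic_on ball 0 R \<longrightarrow> H holomorphic_on ball 0 R \<longrightarrow>
    \<phi> \<in> borel_measurable borel \<longrightarrow> (\<forall>z. 0 \<le> \<phi> z \<and> \<phi> z \<le> 1) \<longrightarrow>
    ennreal \<delta> \<le> ball_integral \<rho> (\<lambda>z. ennreal (\<phi> z)) \<longrightarrow>
    ball_integral R (\<lambda>z. ennreal ((cmod (G z + cnj (H z)))\<^sup>2)) \<le>
      ennreal K * ball_integral \<rho> (\<lambda>z. ennreal ((cmod (G z + cnj (H z)))\<^sup>2)) \<longrightarrow>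
    ennreal \<eta> * ball_integral \<rho> (\<lambda>z. ennreal ((cmod (G z + cnj (H z)))\<^sup>2)) \<le>
      ball_integral \<rho> (\<lambda>z. ennreal (\<phi> z * (cmod (G z + cnj (H z)))\<^sup>2))"
    (is "\<exists>\<eta>>0. ?Q \<eta>")
proof (rule ccontr)
  let ?B = "ball 0 R :: complex set" and ?D = "ball 0 \<rho> :: complex set"
  define bad where "bad n G H \<phi> \<longleftrightarrow> G holomorphic_on ?B \<and> H holomorphic_on ?B \<and> \<phi> \<in> borel_measurable borel \<and>
    (\<forall>z. 0 \<le> \<phi> z \<and> \<phi> z \<le> (1::real)) \<and>
    ennreal \<delta> \<le> ball_integral \<rho> (\<lambda>z. ennreal (\<phi> z)) \<and>
    ball_integral R (\<lambda>z. ennreal ((cmod (G z + cnj (H z)))\<^sup>2)) \<le>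
      ennreal K * ball_integral \<rho> (\<lambda>z. ennreal ((cmod (G z + cnj (H z)))\<^sup>2)) \<and>
    ball_integral \<rho> (\<lambda>z. ennreal (\<phi> z * (cmod (G z + cnj (H z)))\<^sup>2)) <
    ennreal (inverse (real (Suc n))) * ball_integral \<rho> (\<lambda>z. ennreal ((cmod (G z + cnj (H z)))\<^sup>2))"
    for n G H \<phi>
  assume "\<not> (\<exists>\<eta>>0. ?Q \<eta>)"
  note no_eta = this
  have ex_bad: "\<exists>G H \<phi>. bad n G H \<phi>" for n
  proof (rule ccontr)
    assume no: "\<nexists>G H \<phi>. bad n G H \<phi>"
    have "?Q (inverse (real (Suc n)))"
    proof (intro allI impI, rule ccontr, goal_cases)
      case (1 G H \<phi>)
      then have "bad n G H \<phi>" unfolding bad_def not_le by (intro conjI)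
      with no show False by blast
    qed
    then have "\<exists>\<eta>>0. ?Q \<eta>"
      by (intro exI[of _ "inverse (real (Suc n))"] conjI) (simp, assumption)
    with no_eta show False by contradiction
  qed
  define good where "good n G H \<phi> \<longleftrightarrow> G holomorphic_on ?B \<and> H holomorphic_on ?B \<and> H 0 = 0 \<and> \<phi> \<in> borel_measurable borel \<and>
    (\<forall>z. 0 \<le> \<phi> z \<and> \<phi> z \<le> (1::real)) \<and>
    ennreal \<delta> \<le> ball_integral \<rho> (\<lambda>z. ennreal (\<phi> z)) \<and>
    ball_integral R (\<lambda>z. ennreal ((cmod (G z + cnj (H z)))\<^sup>2)) \<le> ennreal K \<and>
    ball_integral \<rho> (\<lambda>z. ennreal ((cmod (G z + cnj (H z)))\<^sup>2)) = 1 \<and>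
    ball_integral \<rho> (\<lambda>z. ennreal (\<phi> z * (cmod (G z + cnj (H z)))\<^sup>2)) < ennreal (inverse (real (Suc n)))" for n G H \<phi>
  have norm: "\<exists>G H \<phi>. good n G H \<phi>"
    for n
  proof -
    obtain G H \<phi> where bad: "bad n G H \<phi>" using ex_bad by blast
    then have G: "G holomorphic_on ?B" and H: "H holomorphic_on ?B" and [measurable]: "\<phi> \<in> borel_measurable borel"
      and \<phi>01: "\<And>z. 0 \<le> \<phi> z \<and> \<phi> z \<le> 1" by (auto simp: bad_def)
    define F where "F z = G z + cnj (H z)" for z
    define A where "A = ball_integral \<rho> (\<lambda>z. ennreal ((cmod (F z))\<^sup>2))"
    have cF: "continuous_on ?B F"
      unfolding F_def by (rule continuous_on_add_cnj[OF G H])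
    have FD [measurable]: "(\<lambda>z. indicator ?D z *\<^sub>R F z) \<in> borel_measurable borel"
      using \<rho> by (intro borel_measurable_continuous_on_indicator continuous_on_subset[OF cF]) auto
    have FB [measurable]: "(\<lambda>z. indicator ?B z *\<^sub>R F z) \<in> borel_measurable borel"
      by (intro borel_measurable_continuous_on_indicator cF) auto
    have "compact (F ` cball 0 \<rho>)"
      using \<rho> by (intro compact_continuous_image continuous_on_subset[OF cF]) auto
    then obtain b where b: "\<And>z. z \<in> cball 0 \<rho> \<Longrightarrow> cmod (F z) \<le> b"
      by (meson bounded_iff compact_imp_bounded imageI)
    have "A \<le> (\<integral>\<^sup>+z. ennreal (b\<^sup>2) * indicator ?D z \<partial>lborel)"
      unfolding A_def
    proof (rule nn_integral_mono)
      fix z show "indicator ?D z * ennreal ((cmod (F z))\<^sup>2) \<le> ennreal (b\<^sup>2) * indicator ?D z"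
        using b[of z] by (auto simp: indicator_def intro!: ennreal_leI power_mono)
    qed
    also have "\<dots> < \<infinity>"
      using emeasure_bounded_finite[of ?D] by (simp add: nn_integral_cmult ennreal_mult_less_top)
    finally obtain a where a: "A = ennreal a" "a \<ge> 0" by (cases A) auto
    have lt: "ball_integral \<rho> (\<lambda>z. ennreal (\<phi> z * (cmod (F z))\<^sup>2)) < ennreal (inverse (real (Suc n))) * A"
      using bad by (simp add: bad_def A_def F_def)
    \<comment> \<open>The failing inequality is strict, which rules out mass 0 and permits the
      rescaling.\<close>
    then have "a > 0" using a by (cases "a = 0") auto
    define c where "c = 1 / sqrt a"
    have c2: "c\<^sup>2 = 1 / a" and c: "c > 0" using \<open>a > 0\<close> by (auto simp: c_def power_divide)
    \<comment> \<open>The value \<open>H 0\<close> moves into the holomorphic part, so that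
      \<open>H' 0 = 0\<close> while the sum is only scaled.\<close>
    define G' where "G' z = of_real c * (G z + cnj (H 0))" for z
    define H' where "H' z = of_real c * (H z - H 0)" for z
    have GH': "G' z + cnj (H' z) = of_real c * F z" for z
      by (simp add: G'_def H'_def F_def algebra_simps)
    have sq: "(cmod (G' z + cnj (H' z)))\<^sup>2 = c\<^sup>2 * (cmod (F z))\<^sup>2" for z
      unfolding GH' using c by (simp add: norm_mult power_mult_distrib)
    have ca: "ennreal (c\<^sup>2) * A = 1" using \<open>a > 0\<close> by (simp add: a c2 flip: ennreal_mult')
    have pullD: "ball_integral \<rho> (\<lambda>z. ennreal (\<psi> z * (c\<^sup>2 * (cmod (F z))\<^sup>2))) =
        ennreal (c\<^sup>2) * ball_integral \<rho> (\<lambda>z. ennreal (\<psi> z * (cmod (F z))\<^sup>2))"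
      if [measurable]: "\<psi> \<in> borel_measurable borel" for \<psi>
    proof -
      have "ball_integral \<rho> (\<lambda>z. ennreal (\<psi> z * (c\<^sup>2 * (cmod (F z))\<^sup>2))) =
          (\<integral>\<^sup>+z. ennreal (c\<^sup>2) * (ennreal (\<psi> z * (cmod (indicator ?D z *\<^sub>R F z))\<^sup>2)) \<partial>lborel)"
        by (intro nn_integral_cong) (auto simp: indicator_def mult_ac simp flip: ennreal_mult')
      also have "\<dots> = ennreal (c\<^sup>2) * (\<integral>\<^sup>+z. ennreal (\<psi> z * (cmod (indicator ?D z *\<^sub>R F z))\<^sup>2) \<partial>lborel)"
        by (rule nn_integral_cmult) measurable
      also have "(\<integral>\<^sup>+z. ennreal (\<psi> z * (cmod (indicator ?D z *\<^sub>R F z))\<^sup>2) \<partial>lborel) =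
          ball_integral \<rho> (\<lambda>z. ennreal (\<psi> z * (cmod (F z))\<^sup>2))"
        by (intro nn_integral_cong) (auto simp: indicator_def)
      finally show ?thesis .
    qed
    have pullB: "ball_integral R (\<lambda>z. ennreal (c\<^sup>2 * (cmod (F z))\<^sup>2)) =
        ennreal (c\<^sup>2) * ball_integral R (\<lambda>z. ennreal ((cmod (F z))\<^sup>2))"
    proof -
      have "ball_integral R (\<lambda>z. ennreal (c\<^sup>2 * (cmod (F z))\<^sup>2)) =
          (\<integral>\<^sup>+z. ennreal (c\<^sup>2) * (ennreal ((cmod (indicator ?B z *\<^sub>R F z))\<^sup>2)) \<partial>lborel)"
        by (intro nn_integral_cong) (auto simp: indicator_def simp flip: ennreal_mult')
      also have "\<dots> = ennreal (c\<^sup>2) * (\<integral>\<^sup>+z. ennreal ((cmod (indicator ?B z *\<^sub>R F z))\<^sup>2) \<partial>lborel)"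
        by (rule nn_integral_cmult) measurable
      also have "(\<integral>\<^sup>+z. ennreal ((cmod (indicator ?B z *\<^sub>R F z))\<^sup>2) \<partial>lborel) =
          ball_integral R (\<lambda>z. ennreal ((cmod (F z))\<^sup>2))"
        by (intro nn_integral_cong) (auto simp: indicator_def)
      finally show ?thesis .
    qed
    show ?thesis
      unfolding good_def
    proof (rule exI[of _ G'], rule exI[of _ H'], rule exI[of _ \<phi>], intro conjI allI)
      show "G' holomorphic_on ?B"
        unfolding G'_def[abs_def] by (intro holomorphic_intros G)
      show "H' holomorphic_on ?B"
        unfolding H'_def[abs_def] by (intro holomorphic_intros H)
      show "H' 0 = 0" by (simp add: H'_def)
      show "ennreal \<delta> \<le> ball_integral \<rho> (\<lambda>z. ennreal (\<phi> z))" using bad by (simp add: bad_def)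
      have "ball_integral R (\<lambda>z. ennreal ((cmod (F z))\<^sup>2)) \<le> ennreal K * A"
        using bad by (simp add: bad_def A_def F_def)
      then have "ennreal (c\<^sup>2) * ball_integral R (\<lambda>z. ennreal ((cmod (F z))\<^sup>2)) \<le> ennreal (c\<^sup>2) * (ennreal K * A)"
        by (rule mult_left_mono) simp
      also have "\<dots> = ennreal K * (ennreal (c\<^sup>2) * A)" by (simp only: mult.left_commute)
      also have "\<dots> = ennreal K" by (simp add: ca)
      finally show "ball_integral R (\<lambda>z. ennreal ((cmod (G' z + cnj (H' z)))\<^sup>2)) \<le> ennreal K"
        unfolding sq pullB .
      show "ball_integral \<rho> (\<lambda>z. ennreal ((cmod (G' z + cnj (H' z)))\<^sup>2)) = 1"
        unfolding sq using pullD[of "\<lambda>_. 1"] ca by (simp add: A_def)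
      have "ennreal (c\<^sup>2) * ball_integral \<rho> (\<lambda>z. ennreal (\<phi> z * (cmod (F z))\<^sup>2)) <
          ennreal (c\<^sup>2) * (ennreal (inverse (real (Suc n))) * A)"
        using lt c by (intro ennreal_mult_strict_left_mono) auto
      also have "\<dots> = ennreal (inverse (real (Suc n))) * (ennreal (c\<^sup>2) * A)" by (simp only: mult.left_commute)
      also have "\<dots> = ennreal (inverse (real (Suc n)))" by (simp add: ca)
      finally show "ball_integral \<rho> (\<lambda>z. ennreal (\<phi> z * (cmod (G' z + cnj (H' z)))\<^sup>2)) < ennreal (inverse (real (Suc n)))"
        unfolding sq by (subst pullD) auto
    qed (use \<phi>01 in auto)
  qed
  obtain G H \<phi> where good: "\<And>n. good n (G n) (H n) (\<phi> n)" using norm by metis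
  have seq: "\<And>n. G n holomorphic_on ?B" "\<And>n. H n holomorphic_on ?B" "\<And>n. H n 0 = 0"
    "\<And>n. ball_integral R (\<lambda>z. ennreal ((cmod (G n z + cnj (H n z)))\<^sup>2)) \<le> ennreal K"
    "\<And>n. ball_integral \<rho> (\<lambda>z. ennreal ((cmod (G n z + cnj (H n z)))\<^sup>2)) = 1"
    "\<And>n. \<phi> n \<in> borel_measurable borel" "\<And>n z. 0 \<le> \<phi> n z" "\<And>n z. \<phi> n z \<le> 1"
    "\<And>n. ennreal \<delta> \<le> ball_integral \<rho> (\<lambda>z. ennreal (\<phi> n z))"
    and small: "\<And>n. ball_integral \<rho> (\<lambda>z. ennreal (\<phi> n z * (cmod (G n z + cnj (H n z)))\<^sup>2)) < ennreal (inverse (real (Suc n)))"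
    using good by (simp_all add: good_def)
  note ex_eta = harmonic_sequence_no_vanishing[where G = G and H = H and \<phi> = \<phi>, OF \<rho> K \<delta> seq]
  obtain \<eta> where \<eta>: "\<eta> > 0" "\<forall>N. \<exists>n\<ge>N.
    ennreal \<eta> \<le> ball_integral \<rho> (\<lambda>z. ennreal (\<phi> n z * (cmod (G n z + cnj (H n z)))\<^sup>2))"
    by (rule exE[OF ex_eta], erule conjE) (rule that)
  obtain N where N: "inverse (real (Suc N)) < \<eta>" using reals_Archimedean[OF \<eta>(1)] by blast
  obtain n where n: "n \<ge> N"
    "ennreal \<eta> \<le> ball_integral \<rho> (\<lambda>z. ennreal (\<phi> n z * (cmod (G n z + cnj (H n z)))\<^sup>2))"
    using \<eta>(2) by blast
  have "ennreal \<eta> < ennreal (inverse (real (Suc n)))" using n(2) small[of n] by (rule le_less_trans)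
  moreover have "inverse (real (Suc n)) \<le> inverse (real (Suc N))" using n(1) by (intro le_imp_inverse_le) auto
  moreover have "\<eta> < inverse (real (Suc n))"
    using calculation(1) \<eta>(1) by (simp only: ennreal_less_iff less_imp_le)
  ultimately show False using N by linarith
qed

section \<open>Averaging over pseudohyperbolic disks\<close>

text \<open>An involutive automorphism of the disk; \<open>cmod (mob z w)\<close> is the
  pseudohyperbolic distance of \<open>z\<close> and \<open>w\<close>.\<close>

definition mob :: "complex \<Rightarrow> complex \<Rightarrow> complex" where
  "mob z w = (z - w) / (1 - cnj z * w)"

text \<open>The Jacobian determinant of \<open>mob z\<close> at \<open>w\<close>, in a closed form
  that is visibly measurable in both arguments together.\<close>

definition mob_jac :: "complex \<Rightarrow> complex \<Rightarrow> real" where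
  "mob_jac z w = ((1 - (cmod z)\<^sup>2) / (cmod (1 - cnj z * w))\<^sup>2)\<^sup>2"

lemma mob_denom_nonzero:
  assumes "z \<in> unit_disk" "w \<in> unit_disk" shows "1 - cnj z * w \<noteq> 0"
proof
  assume "1 - cnj z * w = 0"
  then have "cmod (cnj z * w) = 1" by (metis eq_iff_diff_eq_0 norm_one)
  moreover have "cmod z * cmod w < 1 * 1" using assms by (intro mult_strict_mono') auto
  ultimately show False by (simp add: norm_mult)
qed

lemma mob_denom_commute: "cmod (1 - cnj w * z) = cmod (1 - cnj z * w)"
  by (metis complex_cnj_cnj complex_cnj_diff complex_cnj_mult complex_cnj_one complex_mod_cnj mult.commute)

lemma mob_norm_commute: "cmod (mob w z) = cmod (mob z w)"
  by (simp add: mob_def norm_divide mob_denom_commute[of w z] norm_minus_commute)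

lemma mob_norm:
  assumes "z \<in> unit_disk" "w \<in> unit_disk"
  shows "1 - (cmod (mob z w))\<^sup>2 = (1 - (cmod z)\<^sup>2) * (1 - (cmod w)\<^sup>2) / (cmod (1 - cnj z * w))\<^sup>2"
proof -
  have "(cmod (1 - cnj z * w))\<^sup>2 - (cmod (z - w))\<^sup>2 = (1 - (cmod z)\<^sup>2) * (1 - (cmod w)\<^sup>2)"
    unfolding cmod_power2 by (simp add: power2_eq_square algebra_simps)
  then show ?thesis
    using mob_denom_nonzero[OF assms] by (simp add: mob_def norm_divide power_divide field_simps)
qed

lemma mob_in_disk:
  assumes "z \<in> unit_disk" "w \<in> unit_disk" shows "mob z w \<in> unit_disk"
proof -
  have "0 < 1 - (cmod (mob z w))\<^sup>2"
    using one_minus_norm_square_pos[OF assms(1)] one_minus_norm_square_pos[OF assms(2)] mob_denom_nonzero[OF assms]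
    unfolding mob_norm[OF assms] by simp
  then show ?thesis by (simp add: abs_square_less_1)
qed

lemma mob_involution:
  assumes "z \<in> unit_disk" "w \<in> unit_disk" shows "mob z (mob z w) = w"
proof -
  have d: "1 - cnj z * w \<noteq> 0" by (rule mob_denom_nonzero[OF assms])
  have "1 - cnj z * z \<noteq> 0" by (rule mob_denom_nonzero[OF assms(1,1)])
  moreover have "z - mob z w = w * (1 - cnj z * z) / (1 - cnj z * w)"
    using d by (simp add: mob_def field_simps)
  moreover have "1 - cnj z * mob z w = (1 - cnj z * z) / (1 - cnj z * w)"
    using d by (simp add: mob_def field_simps)
  ultimately show ?thesis using d by (simp add: mob_def[of z "mob z w"])
qed

lemma mob_holomorphic: "z \<in> unit_disk \<Longrightarrow> mob z holomorphic_on unit_disk"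
  unfolding mob_def[abs_def] using mob_denom_nonzero[of z] by (intro holomorphic_intros) auto

lemma mob_inj: "z \<in> unit_disk \<Longrightarrow> inj_on (mob z) unit_disk"
  by (metis inj_onI mob_involution)

lemma mob_image: "z \<in> unit_disk \<Longrightarrow> mob z ` unit_disk = unit_disk"
proof (intro equalityI subsetI)
  fix w assume "z \<in> unit_disk" "w \<in> unit_disk"
  then show "w \<in> mob z ` unit_disk"
    by (intro image_eqI[of _ _ "mob z w"]) (simp_all only: mob_involution mob_in_disk)
qed (use mob_in_disk in blast)

lemma mob_deriv:
  assumes z: "z \<in> unit_disk" and w: "w \<in> unit_disk"
  shows "(cmod (deriv (mob z) w))\<^sup>2 = mob_jac z w"
proof -
  have d: "1 - cnj z * w \<noteq> 0" by (rule mob_denom_nonzero[OF assms])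
  have "(mob z has_field_derivative - (1 - z * cnj z) / (1 - cnj z * w)\<^sup>2) (at w)"
    unfolding mob_def[abs_def] using d
    by (auto intro!: derivative_eq_intros simp: power2_eq_square field_simps)
  then have "deriv (mob z) w = - (1 - z * cnj z) / (1 - cnj z * w)\<^sup>2" by (rule DERIV_imp_deriv)
  also have "1 - z * cnj z = of_real (1 - (cmod z)\<^sup>2)" by (simp flip: complex_norm_square)
  finally have "cmod (deriv (mob z) w) = \<bar>1 - (cmod z)\<^sup>2\<bar> / (cmod (1 - cnj z * w))\<^sup>2"
    by (simp only: norm_divide norm_minus_cancel norm_of_real norm_power)
  then show ?thesis by (simp add: mob_jac_def power_divide)
qed

lemma mob_jac_nonneg [simp]: "mob_jac z w \<ge> 0"
  by (simp add: mob_jac_def)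

lemma mob_jac_swap:
  assumes "z \<in> unit_disk" "w \<in> unit_disk"
  shows "mob_jac z w = ((1 - (cmod z)\<^sup>2) / (1 - (cmod w)\<^sup>2))\<^sup>2 * mob_jac w z"
  using one_minus_norm_square_pos[OF assms(2)]
  by (simp add: mob_jac_def mob_denom_commute[of w z] power_mult_distrib power_divide)

lemma mob_measurable [measurable (raw)]:
  assumes [measurable]: "f \<in> borel_measurable M" "g \<in> borel_measurable M"
  shows "(\<lambda>x. mob (f x) (g x)) \<in> borel_measurable M"
  unfolding mob_def by measurable

lemma mob_jac_measurable [measurable (raw)]:
  assumes [measurable]: "f \<in> borel_measurable M" "g \<in> borel_measurable M"
  shows "(\<lambda>x. mob_jac (f x) (g x)) \<in> borel_measurable M"
  unfolding mob_jac_def by measurable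

lemma nn_integral_mob:
  assumes z: "z \<in> unit_disk" and [measurable]: "F \<in> borel_measurable borel"
  shows "(\<integral>\<^sup>+u. indicator unit_disk u * F (mob z u) \<partial>lborel) =
    (\<integral>\<^sup>+w. indicator unit_disk w * (F w * ennreal (mob_jac z w)) \<partial>lborel)"
proof -
  have "(\<integral>\<^sup>+u. indicator (mob z ` unit_disk) u * F (mob z u) \<partial>lborel) =
      (\<integral>\<^sup>+w. indicator unit_disk w * (F (mob z (mob z w)) * ennreal ((cmod (deriv (mob z) w))\<^sup>2)) \<partial>lborel)"
  proof (rule nn_integral_holomorphic_image[OF open_ball mob_holomorphic[OF z] mob_inj[OF z]])
    show "bounded (mob z ` unit_disk)" unfolding mob_image[OF z] by (rule bounded_ball)
    show "(\<lambda>u. F (mob z u)) \<in> borel_measurable borel" by measurable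
  qed
  also have "\<dots> = (\<integral>\<^sup>+w. indicator unit_disk w * (F w * ennreal (mob_jac z w)) \<partial>lborel)"
  proof (rule nn_integral_cong)
    fix w show "indicator unit_disk w * (F (mob z (mob z w)) * ennreal ((cmod (deriv (mob z) w))\<^sup>2)) =
        indicator unit_disk w * (F w * ennreal (mob_jac z w))"
      by (cases "w \<in> unit_disk") (simp_all only: mob_involution[OF z] mob_deriv[OF z], simp)
  qed
  finally show ?thesis unfolding mob_image[OF z] .
qed

text \<open>By \<open>mob_norm\<close> the ratio equals (1 - |u|^2) / |1 - cnj w u|^2, and the
  modulus in the denominator lies between 1 - r and 2. So 1 - |.|^2 changes by a bounded factor over
  a pseudohyperbolic disk, uniformly in its centre.\<close>

lemma mob_ratio_bounds:
  assumes w: "w \<in> unit_disk" and u: "cmod u < r" and r: "0 < r" "r < 1"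
  shows "(1 - r\<^sup>2) / 4 \<le> (1 - (cmod (mob w u))\<^sup>2) / (1 - (cmod w)\<^sup>2)"
    "(1 - (cmod (mob w u))\<^sup>2) / (1 - (cmod w)\<^sup>2) \<le> 1 / (1 - r)\<^sup>2"
proof -
  have uD: "u \<in> unit_disk" using u r by simp
  let ?d = "cmod (1 - cnj w * u)"
  have eq: "(1 - (cmod (mob w u))\<^sup>2) / (1 - (cmod w)\<^sup>2) = (1 - (cmod u)\<^sup>2) / ?d\<^sup>2"
    using one_minus_norm_square_pos[OF w] unfolding mob_norm[OF w uD] by simp
  have wu: "cmod w * cmod u \<le> 1 * r" using w u by (intro mult_mono) auto
  have "?d \<le> 1 + cmod w * cmod u" using norm_triangle_ineq4[of 1 "cnj w * u"] by (simp add: norm_mult)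
  then have d2: "?d \<le> 2" using wu r by simp
  have "1 - cmod w * cmod u \<le> ?d" using norm_triangle_ineq2[of 1 "cnj w * u"] by (simp add: norm_mult)
  then have d1: "1 - r \<le> ?d" using wu by simp
  have dpos: "?d > 0" using d1 r by linarith
  have dd: "?d\<^sup>2 \<le> 4" using power_mono[OF d2, of 2] by simp
  have du: "(1 - r)\<^sup>2 \<le> ?d\<^sup>2" using d1 r by (intro power_mono) auto
  have u2: "(cmod u)\<^sup>2 \<le> r\<^sup>2" using u by (intro power_mono) auto
  have r2: "r\<^sup>2 \<le> 1" using r by (simp add: power_le_one)
  show "(1 - r\<^sup>2) / 4 \<le> (1 - (cmod (mob w u))\<^sup>2) / (1 - (cmod w)\<^sup>2)"
    unfolding eq using u2 r2 dd dpos by (intro frac_le) auto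
  show "(1 - (cmod (mob w u))\<^sup>2) / (1 - (cmod w)\<^sup>2) \<le> 1 / (1 - r)\<^sup>2"
    unfolding eq using u2 r2 du r by (intro frac_le) auto
qed

text \<open>The exponent collects \<alpha> from the weight and 2 from the factor that
  \<open>mob_jac_swap\<close> produces.\<close>

lemma disk_density_mob:
  assumes w: "w \<in> unit_disk" and u: "u \<in> unit_disk"
  shows "disk_density \<alpha> (mob w u) * ((1 - (cmod (mob w u))\<^sup>2) / (1 - (cmod w)\<^sup>2))\<^sup>2 =
    disk_density \<alpha> w * ((1 - (cmod (mob w u))\<^sup>2) / (1 - (cmod w)\<^sup>2)) powr (\<alpha> + 2)"
proof -
  let ?m = "1 - (cmod (mob w u))\<^sup>2" and ?w = "1 - (cmod w)\<^sup>2"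
  have pos: "?m > 0" "?w > 0" using one_minus_norm_square_pos mob_in_disk[OF w u] w by auto
  have "(?m / ?w) powr (\<alpha> + 2) = ?m powr \<alpha> / ?w powr \<alpha> * (?m / ?w)\<^sup>2"
    using pos by (simp add: powr_add powr_divide flip: powr_numeral)
  then show ?thesis
    using pos by (simp add: disk_density_def disk_weight_def)
qed

text \<open>Exchanging the order of integration and using \<open>cmod (mob z w) = cmod (mob w z)\<close> turns the inner
  integral into one over the fixed ball \<open>ball 0 r\<close>.\<close>

lemma averaging_identity:
  assumes r: "0 < r" "r < 1" and [measurable]: "F \<in> borel_measurable borel"
  shows "(\<integral>\<^sup>+z. indicator unit_disk z * (ennreal (disk_density \<alpha> z) * ball_integral r (\<lambda>u. F (mob z u))) \<partial>lborel) =
    (\<integral>\<^sup>+w. indicator unit_disk w * (F w * ennreal (disk_density \<alpha> w)) *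
      ball_integral r (\<lambda>u. ennreal (((1 - (cmod (mob w u))\<^sup>2) / (1 - (cmod w)\<^sup>2)) powr (\<alpha> + 2))) \<partial>lborel)"
    (is "?L = ?R")
proof -
  let ?I = "indicator unit_disk :: complex \<Rightarrow> ennreal" and ?b = "indicator (ball 0 r) :: complex \<Rightarrow> ennreal"
  let ?dd = "\<lambda>z. ennreal (disk_density \<alpha> z)" and ?J = "\<lambda>z w. ennreal (mob_jac z w)"
  have sub: "?I u * (?b u * x) = ?b u * x" for u x using r by (auto simp: indicator_def)
  \<comment> \<open>Substituting \<open>mob z w\<close> for \<open>u\<close> turns the fixed ball
    into a condition on the pseudohyperbolic distance of \<open>z\<close> and \<open>w\<close>,
    which is symmetric.\<close>
  have inner: "ball_integral r (\<lambda>u. F (mob z u)) = (\<integral>\<^sup>+w. ?I w * (?b (mob z w) * F w * ?J z w) \<partial>lborel)"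
    if z: "z \<in> unit_disk" for z
  proof -
    have [measurable]: "(\<lambda>w. ?b (mob z w) * F w) \<in> borel_measurable borel" by measurable
    have "ball_integral r (\<lambda>u. F (mob z u)) = (\<integral>\<^sup>+u. ?I u * (?b (mob z (mob z u)) * F (mob z u)) \<partial>lborel)"
      using r by (intro nn_integral_cong) (auto simp: indicator_def mob_involution[OF z])
    also have "\<dots> = (\<integral>\<^sup>+w. ?I w * ((?b (mob z w) * F w) * ?J z w) \<partial>lborel)"
      by (rule nn_integral_mob[OF z]) measurable
    finally show ?thesis .
  qed
  have "?L = (\<integral>\<^sup>+z. ?I z * (?dd z * (\<integral>\<^sup>+w. ?I w * (?b (mob z w) * F w * ?J z w) \<partial>lborel)) \<partial>lborel)"
  proof (rule nn_integral_cong)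
    fix z show "?I z * (?dd z * ball_integral r (\<lambda>u. F (mob z u))) =
        ?I z * (?dd z * (\<integral>\<^sup>+w. ?I w * (?b (mob z w) * F w * ?J z w) \<partial>lborel))"
      by (cases "z \<in> unit_disk") (simp_all only: inner, simp)
  qed
  also have "\<dots> = (\<integral>\<^sup>+z. (\<integral>\<^sup>+w. ?I z * ?dd z * (?I w * (?b (mob z w) * F w * ?J z w)) \<partial>lborel) \<partial>lborel)"
  proof (rule nn_integral_cong)
    fix z
    have "(\<lambda>w. ?I w * (?b (mob z w) * F w * ?J z w)) \<in> borel_measurable borel" by measurable
    then show "?I z * (?dd z * (\<integral>\<^sup>+w. ?I w * (?b (mob z w) * F w * ?J z w) \<partial>lborel)) =
        (\<integral>\<^sup>+w. ?I z * ?dd z * (?I w * (?b (mob z w) * F w * ?J z w)) \<partial>lborel)"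
      by (simp add: nn_integral_cmult mult.assoc)
  qed
  also have "\<dots> = (\<integral>\<^sup>+w. (\<integral>\<^sup>+z. ?I z * ?dd z * (?I w * (?b (mob z w) * F w * ?J z w)) \<partial>lborel) \<partial>lborel)"
    by (rule lborel_pair.Fubini') measurable
  also have "\<dots> = ?R"
  proof (rule nn_integral_cong)
    fix w
    show "(\<integral>\<^sup>+z. ?I z * ?dd z * (?I w * (?b (mob z w) * F w * ?J z w)) \<partial>lborel) =
      ?I w * (F w * ?dd w) * ball_integral r (\<lambda>u. ennreal (((1 - (cmod (mob w u))\<^sup>2) / (1 - (cmod w)\<^sup>2)) powr (\<alpha> + 2)))"
    proof (cases "w \<in> unit_disk")
      case w: True
      define q where "q z = (1 - (cmod z)\<^sup>2) / (1 - (cmod w)\<^sup>2)" for z :: complex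
      have [measurable]: "q \<in> borel_measurable borel" unfolding q_def[abs_def] by measurable
      have "(\<integral>\<^sup>+z. ?I z * ?dd z * (?I w * (?b (mob z w) * F w * ?J z w)) \<partial>lborel) =
          (\<integral>\<^sup>+z. F w * (?I z * ((?b (mob w z) * ennreal (disk_density \<alpha> z * (q z)\<^sup>2)) * ?J w z)) \<partial>lborel)"
      proof (rule nn_integral_cong)
        fix z
        show "?I z * ?dd z * (?I w * (?b (mob z w) * F w * ?J z w)) =
            F w * (?I z * ((?b (mob w z) * ennreal (disk_density \<alpha> z * (q z)\<^sup>2)) * ?J w z))"
        proof (cases "z \<in> unit_disk")
          case z: True
          have "?b (mob z w) = ?b (mob w z)" using mob_norm_commute[of w z] by (simp add: indicator_def)
          moreover have "?J z w = ennreal ((q z)\<^sup>2) * ?J w z"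
            unfolding mob_jac_swap[OF z w] q_def by (rule ennreal_mult') simp
          moreover have "ennreal (disk_density \<alpha> z * (q z)\<^sup>2) = ?dd z * ennreal ((q z)\<^sup>2)"
            by (rule ennreal_mult'') simp
          ultimately show ?thesis using z w by (simp add: mult_ac)
        qed simp
      qed
      also have "\<dots> = F w * (\<integral>\<^sup>+z. ?I z * ((?b (mob w z) * ennreal (disk_density \<alpha> z * (q z)\<^sup>2)) * ?J w z) \<partial>lborel)"
        by (rule nn_integral_cmult) measurable
      also have "(\<integral>\<^sup>+z. ?I z * ((?b (mob w z) * ennreal (disk_density \<alpha> z * (q z)\<^sup>2)) * ?J w z) \<partial>lborel) =
          (\<integral>\<^sup>+u. ?I u * (?b (mob w (mob w u)) * ennreal (disk_density \<alpha> (mob w u) * (q (mob w u))\<^sup>2)) \<partial>lborel)"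
        by (rule nn_integral_mob[OF w, symmetric]) measurable
      also have "\<dots> = (\<integral>\<^sup>+u. ?dd w * (?b u * ennreal (q (mob w u) powr (\<alpha> + 2))) \<partial>lborel)"
      proof (rule nn_integral_cong)
        fix u
        show "?I u * (?b (mob w (mob w u)) * ennreal (disk_density \<alpha> (mob w u) * (q (mob w u))\<^sup>2)) =
            ?dd w * (?b u * ennreal (q (mob w u) powr (\<alpha> + 2)))"
        proof (cases "u \<in> unit_disk")
          case u: True
          have "ennreal (disk_density \<alpha> (mob w u) * (q (mob w u))\<^sup>2) = ?dd w * ennreal (q (mob w u) powr (\<alpha> + 2))"
            unfolding q_def disk_density_mob[OF w u] by (rule ennreal_mult'') simp
          then show ?thesis using u by (simp add: mob_involution[OF w u] mult_ac del: mem_ball)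
        next
          case False
          then show ?thesis using r by (auto simp: indicator_def)
        qed
      qed
      also have "\<dots> = ?dd w * ball_integral r (\<lambda>u. ennreal (q (mob w u) powr (\<alpha> + 2)))"
        by (rule nn_integral_cmult) measurable
      finally show ?thesis using w by (simp add: q_def mult.assoc)
    qed simp
  qed
  finally show ?thesis .
qed

text \<open>In the averaging identity the inner integrand lies between powers of the two bounds for
  the ratio, monotone because \<alpha> + 2 is positive. The factor \<open>pi * r^2\<close> is the
  area of the ball.\<close>

lemma averaging_bounds:
  assumes \<alpha>: "\<alpha> > -1" and r: "0 < r" "r < 1"
  obtains k1 k2 where "k1 > 0" "k2 > 0"
    "\<And>F. F \<in> borel_measurable borel \<Longrightarrow>
      ennreal k1 * disk_integral \<alpha> F \<le>
      (\<integral>\<^sup>+z. indicator unit_disk z * (ennreal (disk_density \<alpha> z) * ball_integral r (\<lambda>u. F (mob z u))) \<partial>lborel)"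
    "\<And>F. F \<in> borel_measurable borel \<Longrightarrow>
      (\<integral>\<^sup>+z. indicator unit_disk z * (ennreal (disk_density \<alpha> z) * ball_integral r (\<lambda>u. F (mob z u))) \<partial>lborel) \<le>
      ennreal k2 * disk_integral \<alpha> F"
proof -
  let ?q = "\<lambda>w u. ((1 - (cmod (mob w u))\<^sup>2) / (1 - (cmod w)\<^sup>2)) powr (\<alpha> + 2)"
  let ?b = "indicator (ball 0 r) :: complex \<Rightarrow> ennreal"
  define k1 where "k1 = ((1 - r\<^sup>2) / 4) powr (\<alpha> + 2) * (pi * r\<^sup>2)"
  define k2 where "k2 = (1 / (1 - r)\<^sup>2) powr (\<alpha> + 2) * (pi * r\<^sup>2)"
  have "r\<^sup>2 < 1" using r by (simp add: power_less_one_iff)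
  then have k: "k1 > 0" "k2 > 0" using r by (auto simp: k1_def k2_def)
  have area: "(\<integral>\<^sup>+u. ennreal c * ?b u \<partial>lborel) = ennreal (c * (pi * r\<^sup>2))" if "c \<ge> 0" for c
    using that r emeasure_ball[of r "0::complex"] by (simp add: nn_integral_cmult unit_ball_vol_2 ennreal_mult)
  have lo: "ennreal k1 \<le> ball_integral r (\<lambda>u. ennreal (?q w u))" if w: "w \<in> unit_disk" for w
    unfolding k1_def
  proof (subst area[symmetric], simp, rule nn_integral_mono)
    fix u
    show "ennreal (((1 - r\<^sup>2) / 4) powr (\<alpha> + 2)) * ?b u \<le> ?b u * ennreal (?q w u)"
    proof (cases "u \<in> ball 0 r")
      case True
      then have "((1 - r\<^sup>2) / 4) powr (\<alpha> + 2) \<le> ?q w u"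
        using mob_ratio_bounds(1)[OF w _ r, of u] \<open>r\<^sup>2 < 1\<close> \<alpha> by (intro powr_mono2) auto
      then show ?thesis using True by (simp add: ennreal_leI)
    qed simp
  qed
  have hi: "ball_integral r (\<lambda>u. ennreal (?q w u)) \<le> ennreal k2" if w: "w \<in> unit_disk" for w
    unfolding k2_def
  proof (subst area[symmetric], simp, rule nn_integral_mono)
    fix u
    show "?b u * ennreal (?q w u) \<le> ennreal ((1 / (1 - r)\<^sup>2) powr (\<alpha> + 2)) * ?b u"
    proof (cases "u \<in> ball 0 r")
      case True
      then have "u \<in> unit_disk" using r by auto
      then have "0 \<le> (1 - (cmod (mob w u))\<^sup>2) / (1 - (cmod w)\<^sup>2)"
        using one_minus_norm_square_pos[OF w] one_minus_norm_square_pos[OF mob_in_disk[OF w]]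
        by (intro divide_nonneg_nonneg) (simp_all add: less_imp_le)
      then have "?q w u \<le> (1 / (1 - r)\<^sup>2) powr (\<alpha> + 2)"
        using mob_ratio_bounds(2)[OF w _ r, of u] True \<alpha> by (intro powr_mono2) auto
      then show ?thesis using True by (simp add: ennreal_leI)
    qed simp
  qed
  show ?thesis
  proof (rule that[OF k])
    fix F :: "complex \<Rightarrow> ennreal" assume F [measurable]: "F \<in> borel_measurable borel"
    have cm: "ennreal k * disk_integral \<alpha> F =
        (\<integral>\<^sup>+w. ennreal k * (indicator unit_disk w * (F w * ennreal (disk_density \<alpha> w))) \<partial>lborel)" for k
      by (rule nn_integral_cmult[symmetric]) measurable
    show "ennreal k1 * disk_integral \<alpha> F \<le>
      (\<integral>\<^sup>+z. indicator unit_disk z * (ennreal (disk_density \<alpha> z) * ball_integral r (\<lambda>u. F (mob z u))) \<partial>lborel)"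
      unfolding averaging_identity[OF r F] cm
    proof (rule nn_integral_mono)
      fix w
      show "ennreal k1 * (indicator unit_disk w * (F w * ennreal (disk_density \<alpha> w))) \<le>
        indicator unit_disk w * (F w * ennreal (disk_density \<alpha> w)) * ball_integral r (\<lambda>u. ennreal (?q w u))"
      proof (cases "w \<in> unit_disk")
        case True
        show ?thesis
          using mult_left_mono[OF lo[OF True], of "F w * ennreal (disk_density \<alpha> w)"] True
          by (simp add: mult.commute[of "ennreal k1"])
      qed simp
    qed
    show "(\<integral>\<^sup>+z. indicator unit_disk z * (ennreal (disk_density \<alpha> z) * ball_integral r (\<lambda>u. F (mob z u))) \<partial>lborel) \<le>
      ennreal k2 * disk_integral \<alpha> F"
      unfolding averaging_identity[OF r F] cm
    proof (rule nn_integral_mono)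
      fix w
      show "indicator unit_disk w * (F w * ennreal (disk_density \<alpha> w)) * ball_integral r (\<lambda>u. ennreal (?q w u)) \<le>
        ennreal k2 * (indicator unit_disk w * (F w * ennreal (disk_density \<alpha> w)))"
      proof (cases "w \<in> unit_disk")
        case True
        show ?thesis
          using mult_left_mono[OF hi[OF True], of "F w * ennreal (disk_density \<alpha> w)"] True
          by (simp add: mult.commute[of "ennreal k2"])
      qed simp
    qed
  qed
qed

section \<open>Concentration of the weight and the reverse estimate\<close>

lemma ennreal_add_right_cancelI:
  fixes a b c :: ennreal
  assumes "a + c \<le> b + c" "c < \<infinity>"
  shows "a \<le> b"
proof -
  have "c + a \<le> c + b" using assms(1) by (simp only: add.commute)
  then show ?thesis using assms(2) by (auto simp: ennreal_add_left_cancel_le)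
qed

lemma disk_mass_concentrated:
  assumes \<alpha>: "\<alpha> > -1" and e: "e > 0"
  obtains \<rho> where "0 < \<rho>" "\<rho> < 1"
    "(\<integral>\<^sup>+u. indicator (unit_disk - ball 0 \<rho>) u * ennreal (disk_density \<alpha> u) \<partial>lborel) < ennreal e"
proof -
  \<comment> \<open>Starting at 1/2, so that all radii are positive; the annuli outside them
    decrease to the empty set.\<close>
  define r where "r n = 1 - 1 / real (n + 2)" for n :: nat
  let ?N = "density lborel (\<lambda>u. indicator unit_disk u * ennreal (disk_density \<alpha> u))"
  let ?S = "\<lambda>n. unit_disk - ball 0 (r n)"
  have em: "emeasure ?N A = (\<integral>\<^sup>+u. indicator (unit_disk \<inter> A) u * ennreal (disk_density \<alpha> u) \<partial>lborel)"
    if "A \<in> sets borel" for A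
    using that by (subst emeasure_density) (auto intro!: nn_integral_cong simp: indicator_def)
  have lim: "(\<lambda>n. emeasure ?N (?S n)) \<longlonglongrightarrow> emeasure ?N (\<Inter>n. ?S n)"
  proof (rule Lim_emeasure_decseq)
    have mono: "r m \<le> r n" if "m \<le> n" for m n using that by (simp add: r_def frac_le)
    show "decseq ?S"
      unfolding decseq_def
    proof (intro allI impI subsetI)
      fix m n z assume "m \<le> n" "z \<in> ?S n"
      then show "z \<in> ?S m" using mono[of m n] by auto
    qed
    have "emeasure ?N (?S n) \<le> emeasure ?N unit_disk" for n
      by (intro emeasure_mono) auto
    also have "emeasure ?N unit_disk = 1" by (simp add: em nn_integral_disk_density[OF \<alpha>])
    finally have "emeasure ?N (?S n) < \<infinity>" for n by (rule le_less_trans) simp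
    then show "emeasure ?N (?S n) \<noteq> \<infinity>" for n by (simp add: less_top)
  qed auto
  have empty: "(\<Inter>n. ?S n) = {}"
  proof (rule ccontr)
    assume "(\<Inter>n. ?S n) \<noteq> {}"
    then obtain z where "z \<in> (\<Inter>n. ?S n)" by blast
    then have "z \<in> ?S n" for n by blast
    then have z: "cmod z < 1" "\<And>n. r n \<le> cmod z" by (auto simp: not_less)
    obtain n where "inverse (real (Suc n)) < 1 - cmod z" using reals_Archimedean[of "1 - cmod z"] z(1) by auto
    moreover have "1 / real (n + 2) \<le> inverse (real (Suc n))" by (simp add: field_simps)
    ultimately show False using z(2)[of n] by (simp add: r_def)
  qed
  have "\<forall>\<^sub>F n in sequentially. emeasure ?N (?S n) < ennreal e"
    using e by (intro order_tendstoD(2)[OF lim[unfolded empty emeasure_empty]]) simp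
  then obtain n where n: "emeasure ?N (?S n) < ennreal e"
    by (meson eventually_happens sequentially_bot)
  have eq: "unit_disk \<inter> ?S n = ?S n" by blast
  have "?S n \<in> sets borel" by measurable
  from n[unfolded em[OF this] eq] have "(\<integral>\<^sup>+u. indicator (?S n) u * ennreal (disk_density \<alpha> u) \<partial>lborel) < ennreal e"
    .
  then show ?thesis by (intro that[of "r n"]) (auto simp: r_def field_simps)
qed

lemma disk_density_upper_bound:
  assumes r: "0 \<le> r" "r < 1"
  obtains k where "k > 0" "\<And>z. cmod z \<le> r \<Longrightarrow> disk_density \<alpha> z \<le> k"
proof -
  have "1 - (cmod z)\<^sup>2 \<noteq> 0" if "z \<in> cball 0 r" for z
    using one_minus_norm_square_pos[of z] that r by auto
  then have "continuous_on (cball 0 r) (disk_density \<alpha>)"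
    unfolding disk_density_def[abs_def] disk_weight_def[abs_def] by (intro continuous_intros) auto
  then have "bounded (disk_density \<alpha> ` cball 0 r)"
    by (intro compact_imp_bounded compact_continuous_image) auto
  then obtain b where "b > 0" "\<And>z. z \<in> cball 0 r \<Longrightarrow> norm (disk_density \<alpha> z) \<le> b"
    by (auto simp: bounded_pos)
  then show ?thesis by (intro that[of b]) (auto dest: abs_le_D1)
qed

text \<open>Points \<open>z\<close> at which the mass of the function grows by more than the factor \<open>K\<close> from the
  pseudohyperbolic disk of radius \<open>\<rho>\<close> to that of radius \<open>R\<close> carry at most half of the total
  mass if \<open>K\<close> is large; at the other points the local lower bound applies.\<close>

lemma harmonic_reverse_estimate:
  assumes \<alpha>: "\<alpha> > -1" and \<phi>m [measurable]: "\<phi> \<in> borel_measurable borel" and \<phi>01: "\<And>z. 0 \<le> \<phi> z" "\<And>z. \<phi> z \<le> 1"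
    and c: "c > 0"
    and dense: "AE z in lborel. z \<in> unit_disk \<longrightarrow>
      ennreal c \<le> disk_integral \<alpha> (\<lambda>u. ennreal (\<phi> (mob z u)))"
  shows "\<exists>k>0. \<forall>G H. G holomorphic_on unit_disk \<longrightarrow> H holomorphic_on unit_disk \<longrightarrow>
    disk_integral \<alpha> (\<lambda>w. ennreal ((cmod (G w + cnj (H w)))\<^sup>2)) < \<infinity> \<longrightarrow>
    ennreal k * disk_integral \<alpha> (\<lambda>w. ennreal ((cmod (G w + cnj (H w)))\<^sup>2)) \<le>
    disk_integral \<alpha> (\<lambda>w. ennreal (\<phi> w * (cmod (G w + cnj (H w)))\<^sup>2))"
proof -
  let ?dd = "\<lambda>z. ennreal (disk_density \<alpha> z)" and ?I = "indicator unit_disk :: complex \<Rightarrow> ennreal"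
  \<comment> \<open>As \<open>\<phi> \<le> 1\<close>, the annulus outside this radius accounts for
    less than \<open>c / 2\<close> of any mean; the rest must come from the ball, whatever the
    centre.\<close>
  obtain \<rho> where \<rho>: "0 < \<rho>" "\<rho> < 1"
    and tail: "(\<integral>\<^sup>+u. indicator (unit_disk - ball 0 \<rho>) u * ?dd u \<partial>lborel) < ennreal (c / 2)"
    using disk_mass_concentrated[OF \<alpha>, of "c / 2"] c by auto
  obtain M where M: "M > 0" "\<And>z. cmod z \<le> \<rho> \<Longrightarrow> disk_density \<alpha> z \<le> M"
    using disk_density_upper_bound[of \<rho> \<alpha>] \<rho> by auto
  \<comment> \<open>Compactness asks for a strictly larger ball, the averaging bounds for a radius
    below 1.\<close>
  define R where "R = (1 + \<rho>) / 2"
  have R: "0 < R" "\<rho> < R" "R < 1" using \<rho> by (auto simp: R_def)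
  \<comment> \<open>The remaining \<open>c / 2\<close>, with the density removed at the cost of its
    upper bound \<open>M\<close>.\<close>
  define \<delta> where "\<delta> = c / (2 * M)"
  have \<delta>: "\<delta> > 0" using c M by (simp add: \<delta>_def)
  let ?D = "indicator (ball 0 \<rho>) :: complex \<Rightarrow> ennreal" and ?B = "indicator (ball 0 R) :: complex \<Rightarrow> ennreal"
  have local_dense: "ennreal \<delta> \<le> ball_integral \<rho> (\<lambda>u. ennreal (\<phi> (mob z u)))"
    if "ennreal c \<le> disk_integral \<alpha> (\<lambda>u. ennreal (\<phi> (mob z u)))" for z
  proof -
    have "ennreal c \<le> disk_integral \<alpha> (\<lambda>u. ennreal (\<phi> (mob z u)))" by (rule that)
    also have "\<dots> \<le> (\<integral>\<^sup>+u. ennreal M * (?D u * ennreal (\<phi> (mob z u))) + indicator (unit_disk - ball 0 \<rho>) u * ?dd u \<partial>lborel)"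
    proof (rule nn_integral_mono)
      fix u
      consider "u \<notin> unit_disk" | "u \<in> ball 0 \<rho>" | "u \<in> unit_disk - ball 0 \<rho>" by blast
      then show "?I u * (ennreal (\<phi> (mob z u)) * ?dd u) \<le>
        ennreal M * (?D u * ennreal (\<phi> (mob z u))) + indicator (unit_disk - ball 0 \<rho>) u * ?dd u"
      proof cases
        case 2
        then have "?dd u \<le> ennreal M" using M(2)[of u] by (intro ennreal_leI) auto
        then have "ennreal (\<phi> (mob z u)) * ?dd u \<le> ennreal (\<phi> (mob z u)) * ennreal M" by (rule mult_left_mono) simp
        then show ?thesis using 2 \<rho> by (simp add: mult.commute)
      next
        case 3
        have "ennreal (\<phi> (mob z u)) * ?dd u \<le> 1 * ?dd u" using \<phi>01 by (intro mult_right_mono) auto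
        then show ?thesis using 3 by (simp add: indicator_def)
      qed simp
    qed
    also have "\<dots> = ennreal M * ball_integral \<rho> (\<lambda>u. ennreal (\<phi> (mob z u))) + (\<integral>\<^sup>+u. indicator (unit_disk - ball 0 \<rho>) u * ?dd u \<partial>lborel)"
      by (simp add: nn_integral_add nn_integral_cmult)
    also have "\<dots> \<le> ennreal M * ball_integral \<rho> (\<lambda>u. ennreal (\<phi> (mob z u))) + ennreal (c / 2)"
      using tail by (intro add_left_mono) auto
    finally have "ennreal (c / 2) + ennreal (c / 2) \<le> ennreal M * ball_integral \<rho> (\<lambda>u. ennreal (\<phi> (mob z u))) + ennreal (c / 2)"
      using c by (simp flip: ennreal_plus)
    then have "ennreal (c / 2) \<le> ennreal M * ball_integral \<rho> (\<lambda>u. ennreal (\<phi> (mob z u)))"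
      by (simp add: ennreal_add_left_cancel_le add.commute)
    then have "ennreal (1 / M) * ennreal (c / 2) \<le> ennreal (1 / M) * (ennreal M * ball_integral \<rho> (\<lambda>u. ennreal (\<phi> (mob z u))))"
      by (rule mult_left_mono) simp
    moreover have "ennreal (1 / M) * ennreal M = 1" using M by (simp flip: ennreal_mult')
    ultimately show ?thesis
      using M c by (simp add: \<delta>_def mult.assoc[symmetric] mult.commute flip: ennreal_mult')
  qed
  obtain k1 k1' where k1: "k1 > 0" "k1' > 0"
    "\<And>F. F \<in> borel_measurable borel \<Longrightarrow> ennreal k1 * disk_integral \<alpha> F \<le>
      (\<integral>\<^sup>+z. ?I z * (?dd z * ball_integral \<rho> (\<lambda>u. F (mob z u))) \<partial>lborel)"
    "\<And>F. F \<in> borel_measurable borel \<Longrightarrow> (\<integral>\<^sup>+z. ?I z * (?dd z * ball_integral \<rho> (\<lambda>u. F (mob z u))) \<partial>lborel) \<le>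
      ennreal k1' * disk_integral \<alpha> F"
    using averaging_bounds[OF \<alpha> \<rho>] by blast
  obtain k2 k2' where k2: "k2 > 0" "k2' > 0"
    "\<And>F. F \<in> borel_measurable borel \<Longrightarrow> ennreal k2 * disk_integral \<alpha> F \<le>
      (\<integral>\<^sup>+z. ?I z * (?dd z * ball_integral R (\<lambda>u. F (mob z u))) \<partial>lborel)"
    "\<And>F. F \<in> borel_measurable borel \<Longrightarrow> (\<integral>\<^sup>+z. ?I z * (?dd z * ball_integral R (\<lambda>u. F (mob z u))) \<partial>lborel) \<le>
      ennreal k2' * disk_integral \<alpha> F"
    using averaging_bounds[OF \<alpha> R(1,3)] by blast
  \<comment> \<open>Makes \<open>k2' / K\<close> equal to \<open>k1 / 2\<close>: the centres with
    large growth contribute at most half of the lower bound \<open>k1 * ?X\<close>.\<close>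
  define K where "K = 2 * k2' / k1"
  have K: "K > 0" using k1 k2 by (simp add: K_def)
  obtain \<eta> where \<eta>: "\<eta> > 0" and loc: "\<forall>G H \<phi>. G holomorphic_on ball 0 R \<longrightarrow> H holomorphic_on ball 0 R \<longrightarrow>
    \<phi> \<in> borel_measurable borel \<longrightarrow> (\<forall>z. 0 \<le> \<phi> z \<and> \<phi> z \<le> 1) \<longrightarrow>
    ennreal \<delta> \<le> ball_integral \<rho> (\<lambda>z. ennreal (\<phi> z)) \<longrightarrow>
    ball_integral R (\<lambda>z. ennreal ((cmod (G z + cnj (H z)))\<^sup>2)) \<le>
      ennreal K * ball_integral \<rho> (\<lambda>z. ennreal ((cmod (G z + cnj (H z)))\<^sup>2)) \<longrightarrow>
    ennreal \<eta> * ball_integral \<rho> (\<lambda>z. ennreal ((cmod (G z + cnj (H z)))\<^sup>2)) \<le>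
      ball_integral \<rho> (\<lambda>z. ennreal (\<phi> z * (cmod (G z + cnj (H z)))\<^sup>2))"
    using harmonic_local_lower_bound[OF \<rho>(1) R(2) less_imp_le[OF K] \<delta>] by (elim exE conjE)
  define k where "k = k1 * \<eta> / (2 * k1')"
  have k: "k > 0" using k1 \<eta> by (simp add: k_def)
  show ?thesis
  proof (intro exI[of _ k] conjI k allI impI)
    fix G H assume G: "G holomorphic_on unit_disk" and H: "H holomorphic_on unit_disk"
      and fin: "disk_integral \<alpha> (\<lambda>w. ennreal ((cmod (G w + cnj (H w)))\<^sup>2)) < \<infinity>"
    define f where "f z = indicator unit_disk z *\<^sub>R (G z + cnj (H z))" for z
    have fb [measurable]: "f \<in> borel_measurable borel"
      unfolding f_def[abs_def] by (rule add_cnj_indicator_borel[OF G H open_ball])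
    define F where "F z = ennreal ((cmod (f z))\<^sup>2)" for z
    define F\<phi> where "F\<phi> z = ennreal (\<phi> z * (cmod (f z))\<^sup>2)" for z
    have Fm [measurable]: "F \<in> borel_measurable borel" "F\<phi> \<in> borel_measurable borel"
      unfolding F_def[abs_def] F\<phi>_def[abs_def] by measurable
    let ?X = "disk_integral \<alpha> F" and ?Y = "disk_integral \<alpha> F\<phi>"
    have XG: "disk_integral \<alpha> (\<lambda>w. ennreal ((cmod (G w + cnj (H w)))\<^sup>2)) = ?X"
      by (intro nn_integral_cong) (auto simp: F_def f_def indicator_def)
    have YG: "disk_integral \<alpha> (\<lambda>w. ennreal (\<phi> w * (cmod (G w + cnj (H w)))\<^sup>2)) = ?Y"
      by (intro nn_integral_cong) (auto simp: F\<phi>_def f_def indicator_def)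
    let ?A = "\<lambda>z. ball_integral \<rho> (\<lambda>u. F (mob z u))" and ?A' = "\<lambda>z. ball_integral R (\<lambda>u. F (mob z u))"
      and ?A\<phi> = "\<lambda>z. ball_integral \<rho> (\<lambda>u. F\<phi> (mob z u))"
    have Am: "?A' \<in> borel_measurable borel" "?A\<phi> \<in> borel_measurable borel" by measurable
    \<comment> \<open>At each centre one of the two summands dominates. Adding them covers both
      cases at once, without splitting the disk into two sets of centres.\<close>
    have pt: "?A z \<le> ennreal (1 / \<eta>) * ?A\<phi> z + ennreal (1 / K) * ?A' z"
      if z: "z \<in> unit_disk" and dz: "ennreal c \<le> disk_integral \<alpha> (\<lambda>u. ennreal (\<phi> (mob z u)))" for z
    proof (cases "?A' z \<le> ennreal K * ?A z")
      case True
      have fm: "f (mob z u) = G (mob z u) + cnj (H (mob z u))" if "u \<in> unit_disk" for u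
        using mob_in_disk[OF z that] by (simp add: f_def)
      have e1: "?A z = ball_integral \<rho> (\<lambda>u. ennreal ((cmod (G (mob z u) + cnj (H (mob z u))))\<^sup>2))"
        using \<rho> by (intro nn_integral_cong) (auto simp: F_def fm indicator_def)
      have e2: "?A' z = ball_integral R (\<lambda>u. ennreal ((cmod (G (mob z u) + cnj (H (mob z u))))\<^sup>2))"
        using R by (intro nn_integral_cong) (auto simp: F_def fm indicator_def)
      have e3: "?A\<phi> z = ball_integral \<rho> (\<lambda>u. ennreal (\<phi> (mob z u) * (cmod (G (mob z u) + cnj (H (mob z u))))\<^sup>2))"
        using \<rho> by (intro nn_integral_cong) (auto simp: F\<phi>_def fm indicator_def)
      have sub: "ball 0 R \<subseteq> (unit_disk :: complex set)" using R by auto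
      \<comment> \<open>Composition with \<open>mob z\<close> preserves the form
        \<open>G + cnj H\<close>, so the local bound around 0 applies to the transported
        function.\<close>
      have hol: "(\<lambda>u. G (mob z u)) holomorphic_on ball 0 R" "(\<lambda>u. H (mob z u)) holomorphic_on ball 0 R"
        using holomorphic_on_compose_gen[OF mob_holomorphic[OF z] G] holomorphic_on_compose_gen[OF mob_holomorphic[OF z] H]
          mob_image[OF z] sub by (auto simp: o_def intro: holomorphic_on_subset)
      have "(\<lambda>u. \<phi> (mob z u)) \<in> borel_measurable borel" by measurable
      then have "ennreal \<eta> * ?A z \<le> ?A\<phi> z"
        using loc[rule_format, OF hol, of "\<lambda>u. \<phi> (mob z u)"] \<phi>01 local_dense[OF dz] True
        unfolding e1 e2 e3 by blast
      then have "ennreal (1 / \<eta>) * (ennreal \<eta> * ?A z) \<le> ennreal (1 / \<eta>) * ?A\<phi> z"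
        by (rule mult_left_mono) simp
      moreover have "ennreal (1 / \<eta>) * ennreal \<eta> = 1" using \<eta> by (simp flip: ennreal_mult')
      ultimately have "?A z \<le> ennreal (1 / \<eta>) * ?A\<phi> z" by (simp add: mult.assoc[symmetric])
      then show ?thesis by (simp add: add_increasing2)
    next
      case False
      then have "ennreal (1 / K) * (ennreal K * ?A z) \<le> ennreal (1 / K) * ?A' z"
        by (intro mult_left_mono) auto
      moreover have "ennreal (1 / K) * ennreal K = 1" using K by (simp flip: ennreal_mult')
      ultimately have "?A z \<le> ennreal (1 / K) * ?A' z" by (simp add: mult.assoc[symmetric])
      then show ?thesis by (simp add: add_increasing)
    qed
    have "ennreal k1 * ?X \<le> (\<integral>\<^sup>+z. ?I z * (?dd z * ?A z) \<partial>lborel)" by (rule k1(3)) measurable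
    also have "\<dots> \<le> (\<integral>\<^sup>+z. ennreal (1 / \<eta>) * (?I z * (?dd z * ?A\<phi> z)) + ennreal (1 / K) * (?I z * (?dd z * ?A' z)) \<partial>lborel)"
    proof (rule nn_integral_mono_AE, use dense in eventually_elim)
      fix z assume dz: "z \<in> unit_disk \<longrightarrow> ennreal c \<le> disk_integral \<alpha> (\<lambda>u. ennreal (\<phi> (mob z u)))"
      show "?I z * (?dd z * ?A z) \<le> ennreal (1 / \<eta>) * (?I z * (?dd z * ?A\<phi> z)) + ennreal (1 / K) * (?I z * (?dd z * ?A' z))"
      proof (cases "z \<in> unit_disk")
        case True
        have "?dd z * ?A z \<le> ?dd z * (ennreal (1 / \<eta>) * ?A\<phi> z + ennreal (1 / K) * ?A' z)"
          using pt[OF True] dz True by (intro mult_left_mono) auto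
        then show ?thesis using True by (simp add: distrib_left mult.left_commute)
      qed simp
    qed
    also have "\<dots> = ennreal (1 / \<eta>) * (\<integral>\<^sup>+z. ?I z * (?dd z * ?A\<phi> z) \<partial>lborel) + ennreal (1 / K) * (\<integral>\<^sup>+z. ?I z * (?dd z * ?A' z) \<partial>lborel)"
      using Am by (simp add: nn_integral_add nn_integral_cmult)
    also have "\<dots> \<le> ennreal (1 / \<eta>) * (ennreal k1' * ?Y) + ennreal (1 / K) * (ennreal k2' * ?X)"
      by (intro add_mono mult_left_mono k1(4) k2(4) Fm) auto
    also have "ennreal (1 / K) * (ennreal k2' * ?X) = ennreal (k1 / 2) * ?X"
    proof -
      have e: "1 / K * k2' = k1 / 2" using k1(1) k2(2) by (simp add: K_def field_simps)
      have "ennreal (1 / K) * ennreal k2' = ennreal (1 / K * k2')"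
        using K by (subst ennreal_mult'[symmetric]) simp_all
      then show ?thesis by (simp only: e mult.assoc[symmetric])
    qed
    finally have "ennreal (k1 / 2) * ?X + ennreal (k1 / 2) * ?X \<le> ennreal (1 / \<eta>) * (ennreal k1' * ?Y) + ennreal (k1 / 2) * ?X"
      using k1 by (simp add: distrib_right[symmetric] flip: ennreal_plus)
    \<comment> \<open>Finiteness allows the term from large growth to be absorbed into the left-hand
      side.\<close>
    moreover have "ennreal (k1 / 2) * ?X < \<infinity>" using fin unfolding XG by (simp add: ennreal_mult_less_top)
    ultimately have "ennreal (k1 / 2) * ?X \<le> ennreal (1 / \<eta>) * (ennreal k1' * ?Y)"
      by (rule ennreal_add_right_cancelI)
    then have "ennreal (\<eta> / k1') * (ennreal (k1 / 2) * ?X) \<le> ennreal (\<eta> / k1') * (ennreal (1 / \<eta>) * (ennreal k1' * ?Y))"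
      by (rule mult_left_mono) simp
    moreover have "ennreal (\<eta> / k1') * (ennreal (1 / \<eta>) * (ennreal k1' * ?Y)) = ?Y"
    proof -
      have e: "ennreal (\<eta> / k1') * ennreal (1 / \<eta>) * ennreal k1' = 1"
        using \<eta> k1(2) by (simp flip: ennreal_mult')
      show ?thesis by (simp only: mult.assoc[symmetric] e mult_1)
    qed
    moreover have "ennreal (\<eta> / k1') * (ennreal (k1 / 2) * ?X) = ennreal k * ?X"
    proof -
      have "\<eta> / k1' * (k1 / 2) = k" by (simp add: k_def mult_ac)
      then have e: "ennreal (\<eta> / k1') * ennreal (k1 / 2) = ennreal k"
        using \<eta> k1(2) by (subst ennreal_mult'[symmetric]) simp_all
      show ?thesis by (simp only: mult.assoc[symmetric] e)
    qed
    ultimately show "ennreal k * disk_integral \<alpha> (\<lambda>w. ennreal ((cmod (G w + cnj (H w)))\<^sup>2)) \<le>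
      disk_integral \<alpha> (\<lambda>w. ennreal (\<phi> w * (cmod (G w + cnj (H w)))\<^sup>2))"
      unfolding XG YG by simp
  qed
qed

section \<open>Kernels and Berezin transforms\<close>

lemma Re_one_minus_cnj_mult_pos:
  assumes "z \<in> unit_disk" "w \<in> unit_disk" shows "Re (1 - cnj z * w) > 0"
proof -
  have "Re (cnj z * w) \<le> cmod z * cmod w" using complex_Re_le_cmod[of "cnj z * w"] by (simp add: norm_mult)
  also have "\<dots> < 1 * 1" using assms by (intro mult_strict_mono') auto
  finally show ?thesis by simp
qed

lemma bergman_kernel_holomorphic:
  assumes "z \<in> unit_disk" shows "bergman_kernel \<alpha> z holomorphic_on unit_disk"
proof -
  have "1 - cnj z * w \<notin> \<real>\<^sub>\<le>\<^sub>0" if "w \<in> unit_disk" for w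
    using Re_one_minus_cnj_mult_pos[OF assms that] by (auto simp: complex_nonpos_Reals_iff)
  then show ?thesis
    unfolding bergman_kernel_def[abs_def] by (intro holomorphic_intros) auto
qed

lemma bergman_kernel_0 [simp]: "bergman_kernel \<alpha> z 0 = 1"
  by (simp add: bergman_kernel_def)

lemma norm_bergman_kernel:
  assumes "z \<in> unit_disk" "w \<in> unit_disk"
  shows "cmod (bergman_kernel \<alpha> z w) = cmod (1 - cnj z * w) powr (- (2 + \<alpha>))"
  using mob_denom_nonzero[OF assms] by (simp add: bergman_kernel_def powr_def norm_exp_eq_Re)

text \<open>|1 - cnj z w| is at most 2. The bound lets the constant term of the harmonic kernel be
  absorbed into the analytic one.\<close>

lemma norm_bergman_kernel_ge:
  assumes \<alpha>: "\<alpha> > -1" and z: "z \<in> unit_disk" and w: "w \<in> unit_disk"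
  shows "1 \<le> 2 powr (2 + \<alpha>) * cmod (bergman_kernel \<alpha> z w)"
proof -
  let ?d = "cmod (1 - cnj z * w)"
  have "cmod z * cmod w \<le> 1 * 1" using z w by (intro mult_mono) auto
  moreover have "?d \<le> 1 + cmod z * cmod w" using norm_triangle_ineq4[of 1 "cnj z * w"] by (simp add: norm_mult)
  ultimately have "?d \<le> 2" by simp
  moreover have "?d > 0" using mob_denom_nonzero[OF z w] by simp
  ultimately have "?d powr (2 + \<alpha>) * inverse (?d powr (2 + \<alpha>)) \<le> 2 powr (2 + \<alpha>) * inverse (?d powr (2 + \<alpha>))"
    using \<alpha> by (intro mult_right_mono powr_mono2) auto
  moreover have "?d powr (2 + \<alpha>) * inverse (?d powr (2 + \<alpha>)) = 1" using \<open>?d > 0\<close> by simp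
  ultimately show ?thesis
    by (simp only: norm_bergman_kernel[OF z w] powr_minus)
qed

lemma bergman_kernel_measurable [measurable (raw)]:
  assumes [measurable]: "f \<in> borel_measurable M" "g \<in> borel_measurable M"
  shows "(\<lambda>x. bergman_kernel \<alpha> (f x) (g x)) \<in> borel_measurable M"
proof -
  have [measurable]: "(exp :: complex \<Rightarrow> complex) \<in> borel_measurable borel"
    by (intro borel_measurable_continuous_onI continuous_intros)
  show ?thesis unfolding bergman_kernel_def powr_def by measurable
qed

lemma harmonic_bergman_kernel_measurable [measurable (raw)]:
  assumes [measurable]: "f \<in> borel_measurable M" "g \<in> borel_measurable M"
  shows "(\<lambda>x. harmonic_bergman_kernel \<alpha> (f x) (g x)) \<in> borel_measurable M"
  unfolding harmonic_bergman_kernel_def by measurable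

text \<open>By \<open>mob_norm\<close> the weight brings exponent \<alpha> and the Jacobian exponent
  2; together they produce the squared kernel, whose exponent is 2 + \<alpha>. This is the origin of
  the Moebius invariance of the transform.\<close>

lemma disk_density_mob_jac:
  assumes z: "z \<in> unit_disk" and w: "w \<in> unit_disk"
  shows "disk_density \<alpha> (mob z w) * mob_jac z w =
    (1 - (cmod z)\<^sup>2) powr (2 + \<alpha>) * ((cmod (bergman_kernel \<alpha> z w))\<^sup>2 * disk_density \<alpha> w)"
proof -
  let ?d = "cmod (1 - cnj z * w)" and ?z = "1 - (cmod z)\<^sup>2" and ?w = "1 - (cmod w)\<^sup>2"
  have pos: "?d > 0" "?z > 0" "?w > 0"
    using mob_denom_nonzero[OF z w] one_minus_norm_square_pos[OF z] one_minus_norm_square_pos[OF w] by auto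
  have a: "disk_density \<alpha> (mob z w) = (1 + \<alpha>) * (?z powr \<alpha> * ?w powr \<alpha> / (?d\<^sup>2) powr \<alpha>) / pi"
    unfolding disk_density_def disk_weight_def mob_norm[OF z w] using pos by (simp add: powr_mult powr_divide)
  have b: "mob_jac z w = ?z powr 2 / (?d\<^sup>2) powr 2"
    using pos by (simp add: mob_jac_def power_divide)
  have c: "(cmod (bergman_kernel \<alpha> z w))\<^sup>2 = 1 / (?d\<^sup>2) powr (2 + \<alpha>)"
  proof -
    have "(?d\<^sup>2) powr (2 + \<alpha>) = (?d powr (2 + \<alpha>))\<^sup>2"
      using pos by (simp add: power2_eq_square powr_mult)
    then show ?thesis
      by (simp only: norm_bergman_kernel[OF z w] powr_minus inverse_eq_divide power_one_over)
  qed
  have "(1 + \<alpha>) * (x * y / u) / pi * (x' / u') = (x' * x) * (1 / (u' * u) * ((1 + \<alpha>) * y / pi))"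
    for x y u x' u' :: real by (simp add: mult_ac)
  then show ?thesis
    unfolding a b c unfolding disk_density_def disk_weight_def powr_add .
qed

text \<open>The change of variables \<open>u = mob z w\<close> turns the Berezin transform into the mean of the
  function composed with \<open>mob z\<close>.\<close>

lemma nn_integral_mob_kernel:
  assumes z: "z \<in> unit_disk" and [measurable]: "F \<in> borel_measurable borel"
  shows "disk_integral \<alpha> (\<lambda>u. F (mob z u)) =
    ennreal ((1 - (cmod z)\<^sup>2) powr (2 + \<alpha>)) *
    disk_integral \<alpha> (\<lambda>w. F w * ennreal ((cmod (bergman_kernel \<alpha> z w))\<^sup>2))"
proof -
  have "disk_integral \<alpha> (\<lambda>u. F (mob z u)) =
      (\<integral>\<^sup>+u. indicator unit_disk u * (F (mob z u) * ennreal (disk_density \<alpha> (mob z (mob z u)))) \<partial>lborel)"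
    by (intro nn_integral_cong) (auto simp: indicator_def mob_involution[OF z])
  also have "\<dots> = (\<integral>\<^sup>+w. indicator unit_disk w * ((F w * ennreal (disk_density \<alpha> (mob z w))) * ennreal (mob_jac z w)) \<partial>lborel)"
    by (rule nn_integral_mob[OF z]) measurable
  also have "\<dots> = (\<integral>\<^sup>+w. ennreal ((1 - (cmod z)\<^sup>2) powr (2 + \<alpha>)) *
      (indicator unit_disk w * (F w * ennreal ((cmod (bergman_kernel \<alpha> z w))\<^sup>2) * ennreal (disk_density \<alpha> w))) \<partial>lborel)"
  proof (rule nn_integral_cong)
    fix w
    show "indicator unit_disk w * ((F w * ennreal (disk_density \<alpha> (mob z w))) * ennreal (mob_jac z w)) =
      ennreal ((1 - (cmod z)\<^sup>2) powr (2 + \<alpha>)) *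
      (indicator unit_disk w * (F w * ennreal ((cmod (bergman_kernel \<alpha> z w))\<^sup>2) * ennreal (disk_density \<alpha> w)))"
    proof (cases "w \<in> unit_disk")
      case w: True
      have "ennreal (disk_density \<alpha> (mob z w)) * ennreal (mob_jac z w) = ennreal (disk_density \<alpha> (mob z w) * mob_jac z w)"
        by (rule ennreal_mult''[symmetric]) simp
      also have "\<dots> = ennreal ((1 - (cmod z)\<^sup>2) powr (2 + \<alpha>)) * (ennreal ((cmod (bergman_kernel \<alpha> z w))\<^sup>2) * ennreal (disk_density \<alpha> w))"
        unfolding disk_density_mob_jac[OF z w] by (simp add: ennreal_mult')
      finally show ?thesis using w by (simp add: mult_ac)
    qed simp
  qed
  also have "\<dots> = ennreal ((1 - (cmod z)\<^sup>2) powr (2 + \<alpha>)) *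
    disk_integral \<alpha> (\<lambda>w. F w * ennreal ((cmod (bergman_kernel \<alpha> z w))\<^sup>2))"
    by (rule nn_integral_cmult) measurable
  finally show ?thesis .
qed

text \<open>The change of variables for the constant function 1. It gives the norm of the kernel
  with no appeal to the reproducing property.\<close>

lemma bergman_kernel_mass:
  assumes \<alpha>: "\<alpha> > -1" and z: "z \<in> unit_disk"
  shows "ennreal ((1 - (cmod z)\<^sup>2) powr (2 + \<alpha>)) *
    disk_integral \<alpha> (\<lambda>w. ennreal ((cmod (bergman_kernel \<alpha> z w))\<^sup>2)) = 1"
  using nn_integral_mob_kernel[OF z, of "\<lambda>_. 1" \<alpha>] by (simp add: nn_integral_disk_density[OF \<alpha>])

lemma bergman_kernel_in_space:
  assumes \<alpha>: "\<alpha> > -1" and z: "z \<in> unit_disk"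
  shows "zero_ext (bergman_kernel \<alpha> z) \<in> bergman_space \<alpha>"
proof (rule zero_ext_in_bergman[OF bergman_kernel_holomorphic[OF z]])
  let ?x = "disk_integral \<alpha> (\<lambda>w. ennreal ((cmod (bergman_kernel \<alpha> z w))\<^sup>2))"
  have "(1 - (cmod z)\<^sup>2) powr (2 + \<alpha>) > 0" using one_minus_norm_square_pos[OF z] by simp
  then have "?x \<noteq> \<infinity>" using bergman_kernel_mass[OF assms] by (auto simp: ennreal_mult_top)
  then show "?x < \<infinity>" by (simp add: less_top)
qed

lemma bergman_one: "\<alpha> > -1 \<Longrightarrow> zero_ext (\<lambda>_. 1) \<in> bergman_space \<alpha>"
  by (rule zero_ext_in_bergman) (simp_all add: nn_integral_disk_density)

lemma L2_norm_zero_ext [simp]: "L2_norm (weighted_area \<alpha>) (zero_ext f) = L2_norm (weighted_area \<alpha>) f"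
  unfolding L2_norm_def by (intro arg_cong[where f = sqrt] Bochner_Integration.integral_cong) (auto simp: zero_ext_def)

lemma bergman_kernel_norm:
  assumes \<alpha>: "\<alpha> > -1" and z: "z \<in> unit_disk"
  shows "(1 - (cmod z)\<^sup>2) powr (2 + \<alpha>) * (L2_norm (weighted_area \<alpha>) (bergman_kernel \<alpha> z))\<^sup>2 = 1"
proof -
  have K: "zero_ext (bergman_kernel \<alpha> z) \<in> bergman_space \<alpha>" by (rule bergman_kernel_in_space[OF assms])
  then have "zero_ext (bergman_kernel \<alpha> z) \<in> L2_fun (weighted_area \<alpha>)" by (simp add: bergman_space_def)
  from L2_norm_weighted_area[OF bergman_space_borel[OF K] this]
  have "ennreal ((L2_norm (weighted_area \<alpha>) (bergman_kernel \<alpha> z))\<^sup>2) =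
      disk_integral \<alpha> (\<lambda>w. ennreal ((cmod (bergman_kernel \<alpha> z w))\<^sup>2))"
    unfolding L2_norm_zero_ext by (simp only:) (intro nn_integral_cong, auto simp: zero_ext_def indicator_def)
  with bergman_kernel_mass[OF assms]
  have "ennreal ((1 - (cmod z)\<^sup>2) powr (2 + \<alpha>)) * ennreal ((L2_norm (weighted_area \<alpha>) (bergman_kernel \<alpha> z))\<^sup>2) = 1"
    by (simp only:)
  then have "ennreal ((1 - (cmod z)\<^sup>2) powr (2 + \<alpha>) * (L2_norm (weighted_area \<alpha>) (bergman_kernel \<alpha> z))\<^sup>2) = ennreal 1"
    by (simp add: ennreal_mult')
  then show ?thesis by (subst (asm) ennreal_inj) auto
qed

text \<open>The constant -1 is placed in the conjugated part, which then vanishes at 0 as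
  orthogonality requires.\<close>

lemma harmonic_bergman_kernel_eq:
  "zero_ext (harmonic_bergman_kernel \<alpha> z) =
    (\<lambda>w. zero_ext (bergman_kernel \<alpha> z) w + cnj (zero_ext (bergman_kernel \<alpha> z) w - zero_ext (\<lambda>_. 1) w))"
  by (auto simp: zero_ext_def harmonic_bergman_kernel_def)

lemma harmonic_bergman_kernel_in_space:
  assumes "\<alpha> > -1" "z \<in> unit_disk"
  shows "zero_ext (harmonic_bergman_kernel \<alpha> z) \<in> harmonic_bergman_space \<alpha>"
  unfolding harmonic_bergman_kernel_eq
  by (intro bergman_add_cnj bergman_diff bergman_kernel_in_space bergman_one assms)

text \<open>With this splitting the squared norm of the harmonic kernel is the sum of those of
  \<open>K\<close> and \<open>K - 1\<close>, and the second is dropped.\<close>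

lemma harmonic_bergman_kernel_norm_ge:
  assumes "\<alpha> > -1" "z \<in> unit_disk"
  shows "(L2_norm (weighted_area \<alpha>) (bergman_kernel \<alpha> z))\<^sup>2 \<le> (L2_norm (weighted_area \<alpha>) (harmonic_bergman_kernel \<alpha> z))\<^sup>2"
proof -
  have "(L2_norm (weighted_area \<alpha>) (zero_ext (harmonic_bergman_kernel \<alpha> z)))\<^sup>2 =
      (L2_norm (weighted_area \<alpha>) (zero_ext (bergman_kernel \<alpha> z)))\<^sup>2 +
      (L2_norm (weighted_area \<alpha>) (\<lambda>w. zero_ext (bergman_kernel \<alpha> z) w - zero_ext (\<lambda>_. 1) w))\<^sup>2"
    unfolding harmonic_bergman_kernel_eq
    by (intro L2_norm_bergman_add_cnj bergman_diff bergman_kernel_in_space bergman_one assms) (simp add: zero_ext_def)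
  then show ?thesis by simp
qed

text \<open>The triangle inequality gives 2 |K| + 1, and 1 is at most 2^(2+\<alpha>) |K|.\<close>

lemma norm_harmonic_bergman_kernel_le:
  assumes "\<alpha> > -1" "z \<in> unit_disk" "w \<in> unit_disk"
  shows "(cmod (harmonic_bergman_kernel \<alpha> z w))\<^sup>2 \<le> (2 + 2 powr (2 + \<alpha>))\<^sup>2 * (cmod (bergman_kernel \<alpha> z w))\<^sup>2"
proof -
  let ?K = "bergman_kernel \<alpha> z w"
  have "cmod (harmonic_bergman_kernel \<alpha> z w) \<le> cmod (?K + cnj ?K) + cmod 1"
    unfolding harmonic_bergman_kernel_def by (rule norm_triangle_ineq4)
  also have "cmod (?K + cnj ?K) \<le> cmod ?K + cmod ?K" using norm_triangle_ineq[of ?K "cnj ?K"] by simp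
  finally have "cmod (harmonic_bergman_kernel \<alpha> z w) \<le> (2 + 2 powr (2 + \<alpha>)) * cmod ?K"
    using norm_bergman_kernel_ge[OF assms] by (simp add: algebra_simps)
  then have "(cmod (harmonic_bergman_kernel \<alpha> z w))\<^sup>2 \<le> ((2 + 2 powr (2 + \<alpha>)) * cmod ?K)\<^sup>2"
    by (intro power_mono) auto
  then show ?thesis by (simp add: power_mult_distrib)
qed

section \<open>Total mass and invertibility of bounded functions\<close>

lemma finite_measure_weighted_area:
  assumes "\<alpha> > -1" shows "finite_measure (weighted_area \<alpha>)"
proof
  have "emeasure (weighted_area \<alpha>) (space (weighted_area \<alpha>)) = (\<integral>\<^sup>+z. 1 \<partial>weighted_area \<alpha>)" by simp
  also have "\<dots> = 1"
    by (subst nn_integral_weighted_area) (simp_all add: nn_integral_disk_density[OF assms])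
  finally show "emeasure (weighted_area \<alpha>) (space (weighted_area \<alpha>)) \<noteq> \<infinity>" by simp
qed

lemma invertible_Linfty_bounded_below:
  assumes "invertible_Linfty M g"
  shows "\<exists>c>0. AE z in M. c \<le> cmod (g z)"
proof -
  obtain h C where h: "AE z in M. cmod (h z) \<le> C" "AE z in M. g z * h z = 1"
    using assms by (auto simp: invertible_Linfty_def Linfty_fun_def)
  \<comment> \<open>The maximum with 1 gives a positive bound to divide by.\<close>
  define D where "D = max C 1"
  have D: "D > 0" by (simp add: D_def)
  have "AE z in M. 1 / D \<le> cmod (g z)"
    using h
  proof eventually_elim
    case (elim z)
    have "1 = cmod (g z) * cmod (h z)" using elim(2) by (metis norm_mult norm_one)
    also have "\<dots> \<le> cmod (g z) * D" using elim(1) by (intro mult_left_mono) (auto simp: D_def)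
    finally show ?case using D by (simp add: field_simps)
  qed
  then show ?thesis using D by (intro exI[of _ "1 / D"]) auto
qed

lemma invertible_LinftyI:
  assumes [measurable]: "g \<in> borel_measurable M"
    and b: "\<And>z. z \<in> space M \<Longrightarrow> cmod (g z) \<le> C" and c: "c > 0" "\<And>z. z \<in> space M \<Longrightarrow> c \<le> cmod (g z)"
  shows "invertible_Linfty M g"
  unfolding invertible_Linfty_def
proof (intro conjI bexI)
  show "g \<in> Linfty_fun M" using b by (auto simp: Linfty_fun_def intro!: AE_I2)
  have "cmod (1 / g z) \<le> 1 / c" if "z \<in> space M" for z
    using c(2)[OF that] c(1) by (simp add: norm_divide frac_le)
  then show "(\<lambda>z. 1 / g z) \<in> Linfty_fun M" by (auto simp: Linfty_fun_def intro!: AE_I2 exI[of _ "1 / c"])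
  show "AE z in M. g z * (1 / g z) = 1"
    using c by (intro AE_I2) force
qed

section \<open>The four conditions for a fixed symbol\<close>

locale toeplitz_symbol =
  fixes \<alpha> :: real and \<phi> :: "complex \<Rightarrow> real" and B :: real
  assumes alpha: "\<alpha> > -1" and phi_meas: "\<phi> \<in> borel_measurable (lebesgue_on unit_disk)"
    and phi_nonneg: "z \<in> unit_disk \<Longrightarrow> 0 \<le> \<phi> z" and phi_le: "z \<in> unit_disk \<Longrightarrow> \<phi> z \<le> B" and B_pos: "B > 0"
begin

abbreviation M :: "complex measure" where "M \<equiv> weighted_area \<alpha>"
abbreviation \<psi> :: "complex \<Rightarrow> complex" where "\<psi> \<equiv> \<lambda>z. complex_of_real (\<phi> z)"

lemma phi_measurable [measurable]: "\<phi> \<in> borel_measurable M"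
  using phi_meas by (subst measurable_cong_sets[OF sets_weighted_area refl])

text \<open>Coercivity of the quadratic form of the symbol on \<open>H\<close>, the condition
  through which all four are compared.\<close>

definition below :: "(complex \<Rightarrow> complex) set \<Rightarrow> bool" where
  "below H \<longleftrightarrow> (\<exists>c>0. \<forall>f\<in>H. c * (LINT z|M. (cmod (f z))\<^sup>2) \<le> (LINT z|M. \<phi> z * (cmod (f z))\<^sup>2))"

sublocale A: l2_toeplitz M "bergman_space \<alpha>" \<phi> B
proof -
  interpret l2_subspace M "bergman_space \<alpha>" by (rule bergman_l2_subspace[OF alpha])
  show "l2_toeplitz M (bergman_space \<alpha>) \<phi> B"
    by unfold_locales (auto simp: phi_nonneg phi_le B_pos simp del: mem_ball)
qed

sublocale Har: l2_toeplitz M "harmonic_bergman_space \<alpha>" \<phi> B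
proof -
  interpret l2_subspace M "harmonic_bergman_space \<alpha>" by (rule harmonic_bergman_l2_subspace[OF alpha])
  show "l2_toeplitz M (harmonic_bergman_space \<alpha>) \<phi> B"
    by unfold_locales (auto simp: phi_nonneg phi_le B_pos simp del: mem_ball)
qed

lemma toeplitz_invertible_iff:
  "invertible_operator_on M (bergman_space \<alpha>) (toeplitz \<alpha> \<psi>) \<longleftrightarrow> below (bergman_space \<alpha>)"
proof -
  have "toeplitz \<alpha> \<psi> = A.T" by (intro ext) (simp add: toeplitz_def A.T_def)
  then show ?thesis using A.invertible_iff_bounded_below by (simp add: below_def)
qed

lemma harmonic_toeplitz_invertible_iff:
  "invertible_operator_on M (harmonic_bergman_space \<alpha>) (harmonic_toeplitz \<alpha> \<psi>) \<longleftrightarrow> below (harmonic_bergman_space \<alpha>)"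
proof -
  have "harmonic_toeplitz \<alpha> \<psi> = Har.T" by (intro ext) (simp add: harmonic_toeplitz_def Har.T_def)
  then show ?thesis using Har.invertible_iff_bounded_below by (simp add: below_def)
qed

lemma below_harmonic_imp_below:
  assumes "below (harmonic_bergman_space \<alpha>)" shows "below (bergman_space \<alpha>)"
proof -
  have "bergman_space \<alpha> \<subseteq> harmonic_bergman_space \<alpha>"
    using bergman_add_cnj[OF _ A.zero] by auto
  then show ?thesis using assms unfolding below_def by blast
qed

text \<open>With \<open>k\<close> one of the two kernels this is the Berezin transform as a real
  number; both transforms share the lemmas on bounds and measurability.\<close>

definition quotient :: "(complex \<Rightarrow> complex \<Rightarrow> complex) \<Rightarrow> complex \<Rightarrow> real" where
  "quotient k z = (LINT w|M. \<phi> w * (cmod (k z w))\<^sup>2) / (L2_norm M (k z))\<^sup>2"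

lemma berezin_eq: "berezin \<alpha> \<psi> z = of_real (quotient (bergman_kernel \<alpha>) z)"
  by (simp only: berezin_def quotient_def of_real_mult[symmetric] integral_complex_of_real of_real_divide)

lemma harmonic_berezin_eq: "harmonic_berezin \<alpha> \<psi> z = of_real (quotient (harmonic_bergman_kernel \<alpha>) z)"
  by (simp only: harmonic_berezin_def quotient_def of_real_mult[symmetric] integral_complex_of_real of_real_divide)

lemma kernel_norm_pos:
  assumes "z \<in> unit_disk"
  shows "(L2_norm M (bergman_kernel \<alpha> z))\<^sup>2 > 0" "(L2_norm M (harmonic_bergman_kernel \<alpha> z))\<^sup>2 > 0"
proof -
  have "(L2_norm M (bergman_kernel \<alpha> z))\<^sup>2 \<noteq> 0"
    using bergman_kernel_norm[OF alpha assms] by (metis mult_zero_right zero_neq_one)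
  then show "(L2_norm M (bergman_kernel \<alpha> z))\<^sup>2 > 0" by simp
  then show "(L2_norm M (harmonic_bergman_kernel \<alpha> z))\<^sup>2 > 0"
    using harmonic_bergman_kernel_norm_ge[OF alpha assms] by (rule less_le_trans)
qed

lemma kernel_L2:
  assumes "z \<in> unit_disk"
  shows "zero_ext (bergman_kernel \<alpha> z) \<in> L2_fun M" "zero_ext (harmonic_bergman_kernel \<alpha> z) \<in> L2_fun M"
  using A.sub[OF bergman_kernel_in_space[OF alpha assms]] Har.sub[OF harmonic_bergman_kernel_in_space[OF alpha assms]] .

lemma integral_zero_ext: "(LINT w|M. \<phi> w * (cmod (zero_ext f w))\<^sup>2) = (LINT w|M. \<phi> w * (cmod (f w))\<^sup>2)"
  by (intro Bochner_Integration.integral_cong) (auto simp: zero_ext_def)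

lemma quotient_bounds:
  assumes "zero_ext (k z) \<in> L2_fun M"
  shows "0 \<le> quotient k z" "quotient k z \<le> B"
proof -
  have nn: "0 \<le> (LINT w|M. \<phi> w * (cmod (k z w))\<^sup>2)"
    by (intro integral_nonneg_AE AE_I2) (auto simp: phi_nonneg simp del: mem_ball)
  then show "0 \<le> quotient k z" by (simp add: quotient_def)
  have "(LINT w|M. \<phi> w * (cmod (zero_ext (k z) w))\<^sup>2) \<le> (LINT w|M. B * (cmod (zero_ext (k z) w))\<^sup>2)"
    using A.phi_integrable[OF assms] L2_funD(2)[OF assms]
    by (intro integral_mono) (auto intro!: mult_right_mono phi_le simp del: mem_ball)
  also have "\<dots> = B * (L2_norm M (k z))\<^sup>2" using L2_norm_zero_ext[of \<alpha> "k z"] by (simp flip: L2_norm_square)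
  finally show "quotient k z \<le> B"
    \<comment> \<open>If the norm is 0, division by zero makes the quotient 0, which is below
      \<open>B\<close>.\<close>
    using B_pos by (cases "(L2_norm M (k z))\<^sup>2 = 0") (auto simp: quotient_def integral_zero_ext divide_simps)
qed

text \<open>Invertibility as a bounded function includes measurability of the transform. It follows
  from joint measurability of the kernel, as integrating out one variable over a finite measure is
  measurable in the other.\<close>

lemma quotient_measurable:
  assumes k: "(\<lambda>p. k (fst p) (snd p)) \<in> borel_measurable (borel \<Otimes>\<^sub>M borel)"
  shows "quotient k \<in> borel_measurable M"
proof -
  interpret finite_measure M by (rule finite_measure_weighted_area[OF alpha])
  have id [measurable]: "(\<lambda>w. w) \<in> measurable M borel" by (intro weighted_area_measurableI) measurable
  have "(\<lambda>p. (fst p, snd p)) \<in> measurable (M \<Otimes>\<^sub>M M) (borel \<Otimes>\<^sub>M borel)"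
    by (intro measurable_Pair measurable_compose[OF measurable_fst id] measurable_compose[OF measurable_snd id])
  from measurable_compose[OF this k]
  have [measurable]: "(\<lambda>p. k (fst p) (snd p)) \<in> borel_measurable (M \<Otimes>\<^sub>M M)" by simp
  have "(\<lambda>z. LINT w|M. \<phi> w * (cmod (k z w))\<^sup>2) \<in> borel_measurable M"
    by (rule borel_measurable_lebesgue_integral) (simp add: case_prod_beta)
  moreover have "(\<lambda>z. LINT w|M. (cmod (k z w))\<^sup>2) \<in> borel_measurable M"
    by (rule borel_measurable_lebesgue_integral) (simp add: case_prod_beta)
  ultimately show ?thesis
    unfolding quotient_def[abs_def] L2_norm_square by measurable
qed

lemma below_imp_invertible:
  assumes b: "below H" and k: "\<And>z. z \<in> unit_disk \<Longrightarrow> zero_ext (k z) \<in> H" "\<And>z. z \<in> unit_disk \<Longrightarrow> zero_ext (k z) \<in> L2_fun M"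
    and pos: "\<And>z. z \<in> unit_disk \<Longrightarrow> (L2_norm M (k z))\<^sup>2 > 0"
    and km: "(\<lambda>p. k (fst p) (snd p)) \<in> borel_measurable (borel \<Otimes>\<^sub>M borel)"
  shows "invertible_Linfty M (\<lambda>z. complex_of_real (quotient k z))"
proof -
  obtain c where c: "c > 0" "\<And>f. f \<in> H \<Longrightarrow> c * (LINT z|M. (cmod (f z))\<^sup>2) \<le> (LINT z|M. \<phi> z * (cmod (f z))\<^sup>2)"
    using b by (auto simp: below_def)
  have ge: "c \<le> quotient k z" if "z \<in> unit_disk" for z
    using c(2)[OF k(1)[OF that]] pos[OF that] L2_norm_zero_ext[of \<alpha> "k z"]
    by (simp add: integral_zero_ext quotient_def field_simps flip: L2_norm_square)
  show ?thesis
  proof (rule invertible_LinftyI[where C = B and c = c])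
    show "(\<lambda>z. complex_of_real (quotient k z)) \<in> borel_measurable M"
      using quotient_measurable[OF km] by measurable
  qed (use c(1) ge quotient_bounds[OF k(2)] in \<open>auto simp del: mem_ball\<close>)
qed

lemma quotient_harmonic_le:
  assumes z: "z \<in> unit_disk"
  shows "quotient (harmonic_bergman_kernel \<alpha>) z \<le> (2 + 2 powr (2 + \<alpha>))\<^sup>2 * quotient (bergman_kernel \<alpha>) z"
proof -
  let ?C = "(2 + 2 powr (2 + \<alpha>))\<^sup>2" and ?K = "bergman_kernel \<alpha> z" and ?R = "harmonic_bergman_kernel \<alpha> z"
  have "(LINT w|M. \<phi> w * (cmod (zero_ext ?R w))\<^sup>2) \<le> (LINT w|M. ?C * (\<phi> w * (cmod (zero_ext ?K w))\<^sup>2))"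
  proof (rule integral_mono)
    fix w assume "w \<in> space M"
    then have w: "w \<in> unit_disk" by simp
    have "\<phi> w * (cmod (?R w))\<^sup>2 \<le> \<phi> w * (?C * (cmod (?K w))\<^sup>2)"
      by (intro mult_left_mono norm_harmonic_bergman_kernel_le[OF alpha z w] phi_nonneg w)
    then show "\<phi> w * (cmod (zero_ext ?R w))\<^sup>2 \<le> ?C * (\<phi> w * (cmod (zero_ext ?K w))\<^sup>2)"
      using w by (simp add: zero_ext_def mult.left_commute)
  qed (use kernel_L2[OF z] A.phi_integrable in auto)
  then have I: "(LINT w|M. \<phi> w * (cmod (?R w))\<^sup>2) \<le> ?C * (LINT w|M. \<phi> w * (cmod (?K w))\<^sup>2)"
    by (simp add: integral_zero_ext)
  have "0 \<le> (LINT w|M. \<phi> w * (cmod (?K w))\<^sup>2)"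
    by (intro integral_nonneg_AE AE_I2) (auto simp: phi_nonneg simp del: mem_ball)
  then have "(LINT w|M. \<phi> w * (cmod (?R w))\<^sup>2) / (L2_norm M ?R)\<^sup>2 \<le>
      (?C * (LINT w|M. \<phi> w * (cmod (?K w))\<^sup>2)) / (L2_norm M ?K)\<^sup>2"
    using I harmonic_bergman_kernel_norm_ge[OF alpha z] kernel_norm_pos[OF z] by (intro frac_le) auto
  then show ?thesis by (simp add: quotient_def)
qed

text \<open>The symbol is Lebesgue measurable, while compositions with \<open>mob z\<close> and
  Fubini are carried out for Borel functions. A Borel representative is scaled by \<open>B\<close>
  and clamped to [0, 1], so that its bounds hold everywhere.\<close>

lemma normalized_borel_symbol:
  obtains \<phi>' where "\<phi>' \<in> borel_measurable borel" "\<And>z. 0 \<le> \<phi>' z" "\<And>z. \<phi>' z \<le> 1"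
    "AE z in lborel. z \<in> unit_disk \<longrightarrow> \<phi> z = B * \<phi>' z"
proof -
  have "(\<lambda>z. indicator unit_disk z *\<^sub>R \<phi> z) \<in> borel_measurable lebesgue"
    using phi_meas by (subst (asm) borel_measurable_restrict_space_iff) auto
  then obtain g where g [measurable]: "g \<in> borel_measurable lborel" and eq: "AE z in lborel. indicator unit_disk z *\<^sub>R \<phi> z = g z"
    using completion_ex_borel_measurable_real by blast
  have "AE z in lborel. z \<in> unit_disk \<longrightarrow> \<phi> z = B * max 0 (min 1 (g z / B))"
    using eq
  proof eventually_elim
    case (elim z)
    show ?case
    proof
      assume z: "z \<in> unit_disk"
      then have "g z = \<phi> z" using elim by simp
      then show "\<phi> z = B * max 0 (min 1 (g z / B))"
        using phi_nonneg[OF z] phi_le[OF z] B_pos by (simp add: min_def max_def field_simps)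
    qed
  qed
  moreover have "(\<lambda>z. max 0 (min 1 (g z / B))) \<in> borel_measurable borel"
  proof -
    have [measurable]: "g \<in> borel_measurable borel" using g by simp
    show ?thesis by measurable
  qed
  ultimately show ?thesis by (intro that[of "\<lambda>z. max 0 (min 1 (g z / B))"]) auto
qed

lemma nn_integral_symbol:
  assumes \<phi>': "AE z in lborel. z \<in> unit_disk \<longrightarrow> \<phi> z = B * \<phi>' z" "\<phi>' \<in> borel_measurable borel" "\<And>z. 0 \<le> \<phi>' z"
    and f: "f \<in> borel_measurable borel" "f \<in> L2_fun M"
  shows "ennreal (LINT z|M. \<phi> z * (cmod (f z))\<^sup>2) =
    ennreal B * disk_integral \<alpha> (\<lambda>w. ennreal (\<phi>' w * (cmod (f w))\<^sup>2))"
proof -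
  note [measurable] = \<phi>'(2) f(1)
  have "f \<in> borel_measurable (lebesgue_on unit_disk)" by (rule borel_imp_lebesgue_on[OF f(1)])
  then have meas: "(\<lambda>z. ennreal (\<phi> z * (cmod (f z))\<^sup>2)) \<in> borel_measurable (lebesgue_on unit_disk)"
    using phi_meas by measurable
  have "ennreal (LINT z|M. \<phi> z * (cmod (f z))\<^sup>2) = (\<integral>\<^sup>+z. ennreal (\<phi> z * (cmod (f z))\<^sup>2) \<partial>M)"
    by (rule nn_integral_eq_integral[symmetric, OF A.phi_integrable[OF f(2)]])
      (intro AE_I2, auto simp: phi_nonneg simp del: mem_ball)
  also have "\<dots> = disk_integral \<alpha> (\<lambda>w. ennreal (\<phi> w * (cmod (f w))\<^sup>2))"
    by (rule nn_integral_weighted_area[OF meas])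
  also have "\<dots> = (\<integral>\<^sup>+w. ennreal B * (indicator unit_disk w * (ennreal (\<phi>' w * (cmod (f w))\<^sup>2) * ennreal (disk_density \<alpha> w))) \<partial>lborel)"
  proof (rule nn_integral_cong_AE, use \<phi>'(1) in eventually_elim)
    case (elim w)
    show ?case
    proof (cases "w \<in> unit_disk")
      case True
      then have "\<phi> w = B * \<phi>' w" using elim by simp
      then have "ennreal (\<phi> w * (cmod (f w))\<^sup>2) = ennreal B * ennreal (\<phi>' w * (cmod (f w))\<^sup>2)"
        using B_pos by (simp add: mult.assoc ennreal_mult')
      then show ?thesis by (simp add: mult_ac)
    qed simp
  qed
  also have "\<dots> = ennreal B * disk_integral \<alpha> (\<lambda>w. ennreal (\<phi>' w * (cmod (f w))\<^sup>2))"
    by (rule nn_integral_cmult) measurable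
  finally show ?thesis .
qed

text \<open>The reverse estimate is applied to the scaled Borel symbol and carried back by
  \<open>nn_integral_symbol\<close>, which restores the factor \<open>B\<close> in the final
  constant \<open>B * k\<close>.\<close>

lemma berezin_bounded_below_imp_below_harmonic:
  assumes c: "c > 0" and ge: "AE z in M. c \<le> quotient (bergman_kernel \<alpha>) z"
  shows "below (harmonic_bergman_space \<alpha>)"
proof -
  obtain \<phi>' where \<phi>'m [measurable]: "\<phi>' \<in> borel_measurable borel" and \<phi>'01: "\<And>z. 0 \<le> \<phi>' z" "\<And>z. \<phi>' z \<le> 1"
    and eq: "AE z in lborel. z \<in> unit_disk \<longrightarrow> \<phi> z = B * \<phi>' z"
    using normalized_borel_symbol by blast
  \<comment> \<open>The power of 1 - |z|^2 in the change of variables is the reciprocal of the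
    squared kernel norm, so the mean of \<open>\<phi>'\<close> composed with \<open>mob z\<close> is
    the transform divided by \<open>B\<close>.\<close>
  have key: "ennreal (c / B) \<le> disk_integral \<alpha> (\<lambda>u. ennreal (\<phi>' (mob z u)))"
    if z: "z \<in> unit_disk" and cz: "c \<le> quotient (bergman_kernel \<alpha>) z" for z
  proof -
    let ?K = "bergman_kernel \<alpha> z" and ?p = "(1 - (cmod z)\<^sup>2) powr (2 + \<alpha>)"
    let ?Y = "disk_integral \<alpha> (\<lambda>w. ennreal (\<phi>' w) * ennreal ((cmod (?K w))\<^sup>2))"
    have N: "?p * (L2_norm M ?K)\<^sup>2 = 1" by (rule bergman_kernel_norm[OF alpha z])
    have "quotient (bergman_kernel \<alpha>) z = ?p * (LINT w|M. \<phi> w * (cmod (?K w))\<^sup>2)"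
      using N kernel_norm_pos(1)[OF z] by (simp add: quotient_def field_simps)
    then have "ennreal c \<le> ennreal (?p * (LINT w|M. \<phi> w * (cmod (zero_ext ?K w))\<^sup>2))"
      using cz by (simp add: integral_zero_ext ennreal_leI)
    also have "\<dots> = ennreal ?p * ennreal (LINT w|M. \<phi> w * (cmod (zero_ext ?K w))\<^sup>2)" by (simp add: ennreal_mult')
    also have "ennreal (LINT w|M. \<phi> w * (cmod (zero_ext ?K w))\<^sup>2) = ennreal B *
        disk_integral \<alpha> (\<lambda>w. ennreal (\<phi>' w * (cmod (zero_ext ?K w))\<^sup>2))"
      by (rule nn_integral_symbol[OF eq \<phi>'m \<phi>'01(1) bergman_space_borel[OF bergman_kernel_in_space[OF alpha z]] kernel_L2(1)[OF z]])
    also have "disk_integral \<alpha> (\<lambda>w. ennreal (\<phi>' w * (cmod (zero_ext ?K w))\<^sup>2)) = ?Y"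
      by (intro nn_integral_cong) (auto simp: zero_ext_def indicator_def ennreal_mult' \<phi>'01)
    also have "ennreal ?p * (ennreal B * ?Y) = ennreal B * (ennreal ?p * ?Y)" by (rule mult.left_commute)
    also have "ennreal ?p * ?Y = disk_integral \<alpha> (\<lambda>u. ennreal (\<phi>' (mob z u)))"
      by (rule nn_integral_mob_kernel[OF z, symmetric]) measurable
    finally have "ennreal (1 / B) * ennreal c \<le> ennreal (1 / B) * (ennreal B *
        disk_integral \<alpha> (\<lambda>u. ennreal (\<phi>' (mob z u))))"
      by (rule mult_left_mono) simp
    moreover have "ennreal (1 / B) * ennreal B = 1" using B_pos by (simp flip: ennreal_mult')
    moreover have "ennreal (1 / B) * ennreal c = ennreal (c / B)" using B_pos by (simp flip: ennreal_mult')
    ultimately show ?thesis by (simp add: mult.assoc[symmetric])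
  qed
  have "AE z in lborel. z \<in> unit_disk \<longrightarrow> c \<le> quotient (bergman_kernel \<alpha>) z"
  proof -
    have "AE z in lebesgue_on unit_disk. c \<le> quotient (bergman_kernel \<alpha>) z"
      using ge AE_weighted_area[OF alpha] by blast
    then have "AE z in lebesgue. z \<in> unit_disk \<longrightarrow> c \<le> quotient (bergman_kernel \<alpha>) z"
      by (subst (asm) AE_restrict_space_iff) auto
    then show ?thesis by (simp only: AE_completion_iff)
  qed
  then have dense: "AE z in lborel. z \<in> unit_disk \<longrightarrow> ennreal (c / B) \<le>
      disk_integral \<alpha> (\<lambda>u. ennreal (\<phi>' (mob z u)))"
    by eventually_elim (use key in blast)
  have cB: "c / B > 0" using c B_pos by simp
  obtain k where k: "k > 0" and rev: "\<And>G H. G holomorphic_on unit_disk \<Longrightarrow> H holomorphic_on unit_disk \<Longrightarrow>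
    disk_integral \<alpha> (\<lambda>w. ennreal ((cmod (G w + cnj (H w)))\<^sup>2)) < \<infinity> \<Longrightarrow>
    ennreal k * disk_integral \<alpha> (\<lambda>w. ennreal ((cmod (G w + cnj (H w)))\<^sup>2)) \<le>
    disk_integral \<alpha> (\<lambda>w. ennreal (\<phi>' w * (cmod (G w + cnj (H w)))\<^sup>2))"
    using harmonic_reverse_estimate[OF alpha \<phi>'m \<phi>'01 cB dense] by blast
  have "B * k * (LINT z|M. (cmod (f z))\<^sup>2) \<le> (LINT z|M. \<phi> z * (cmod (f z))\<^sup>2)" if f: "f \<in> harmonic_bergman_space \<alpha>" for f
  proof -
    obtain g h where g: "g \<in> bergman_space \<alpha>" and h: "h \<in> bergman_space \<alpha>" and fgh: "f = (\<lambda>z. g z + cnj (h z))"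
      using harmonic_bergman_decomposition[OF f] by blast
    have fb: "f \<in> borel_measurable borel" and fL: "f \<in> L2_fun M"
      using harmonic_bergman_space_borel[OF f] Har.sub[OF f] .
    let ?X = "disk_integral \<alpha> (\<lambda>w. ennreal ((cmod (f w))\<^sup>2))"
    let ?Y = "disk_integral \<alpha> (\<lambda>w. ennreal (\<phi>' w * (cmod (f w))\<^sup>2))"
    have X: "ennreal (LINT z|M. (cmod (f z))\<^sup>2) = ?X"
      using L2_norm_weighted_area[OF fb fL] by (simp only: L2_norm_square)
    have "?X < \<infinity>" unfolding X[symmetric] by simp
    then have "ennreal k * ?X \<le> ?Y"
      using rev[of g h] g h unfolding fgh by (simp add: bergman_space_def)
    then have "ennreal B * (ennreal k * ?X) \<le> ennreal B * ?Y" by (rule mult_left_mono) simp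
    then have "ennreal B * (ennreal k * ennreal (LINT z|M. (cmod (f z))\<^sup>2)) \<le> ennreal (LINT z|M. \<phi> z * (cmod (f z))\<^sup>2)"
      unfolding X nn_integral_symbol[OF eq \<phi>'m \<phi>'01(1) fb fL] .
    moreover have "ennreal B * (ennreal k * ennreal (LINT z|M. (cmod (f z))\<^sup>2)) = ennreal (B * k * (LINT z|M. (cmod (f z))\<^sup>2))"
      using B_pos k by (simp add: ennreal_mult' mult.assoc)
    moreover have "0 \<le> (LINT z|M. \<phi> z * (cmod (f z))\<^sup>2)"
      by (intro integral_nonneg_AE AE_I2) (auto simp: phi_nonneg simp del: mem_ball)
    ultimately show ?thesis by (simp add: ennreal_le_iff)
  qed
  then show ?thesis
    unfolding below_def using B_pos k by (intro exI[of _ "B * k"]) auto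
qed

text \<open>Coercivity on harmonic functions is the strongest condition: by inclusion it implies
  coercivity on analytic ones, which bounds the analytic transform below, and that leads back. The
  harmonic transform is attached by a loop: harmonic coercivity bounds it below, and its lower bound
  passes to the analytic transform.\<close>

lemma equivalences:
  shows "below (bergman_space \<alpha>) \<longleftrightarrow> below (harmonic_bergman_space \<alpha>)"
    and "below (harmonic_bergman_space \<alpha>) \<longleftrightarrow> invertible_Linfty M (berezin \<alpha> \<psi>)"
    and "invertible_Linfty M (berezin \<alpha> \<psi>) \<longleftrightarrow> invertible_Linfty M (harmonic_berezin \<alpha> \<psi>)"
proof -
  have b: "berezin \<alpha> \<psi> = (\<lambda>z. of_real (quotient (bergman_kernel \<alpha>) z))"
    and hb: "harmonic_berezin \<alpha> \<psi> = (\<lambda>z. of_real (quotient (harmonic_bergman_kernel \<alpha>) z))"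
    by (intro ext berezin_eq harmonic_berezin_eq)+
  have A_B: "invertible_Linfty M (berezin \<alpha> \<psi>)" if "below (bergman_space \<alpha>)"
    unfolding b
  proof (rule below_imp_invertible[OF that])
    show "zero_ext (bergman_kernel \<alpha> z) \<in> bergman_space \<alpha>" if "z \<in> unit_disk" for z
      by (rule bergman_kernel_in_space[OF alpha that])
    show "(\<lambda>p. bergman_kernel \<alpha> (fst p) (snd p)) \<in> borel_measurable (borel \<Otimes>\<^sub>M borel)"
      by measurable
  qed (rule kernel_L2 kernel_norm_pos, assumption)+
  have H_HB: "invertible_Linfty M (harmonic_berezin \<alpha> \<psi>)" if "below (harmonic_bergman_space \<alpha>)"
    unfolding hb
  proof (rule below_imp_invertible[OF that])
    show "zero_ext (harmonic_bergman_kernel \<alpha> z) \<in> harmonic_bergman_space \<alpha>" if "z \<in> unit_disk" for z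
      by (rule harmonic_bergman_kernel_in_space[OF alpha that])
    show "(\<lambda>p. harmonic_bergman_kernel \<alpha> (fst p) (snd p)) \<in> borel_measurable (borel \<Otimes>\<^sub>M borel)"
      by measurable
  qed (rule kernel_L2 kernel_norm_pos, assumption)+
  have B_H: "below (harmonic_bergman_space \<alpha>)" if inv: "invertible_Linfty M (berezin \<alpha> \<psi>)"
  proof -
    obtain c where c: "c > 0" "AE z in M. c \<le> cmod (berezin \<alpha> \<psi> z)"
      using invertible_Linfty_bounded_below[OF inv] by blast
    have "AE z in M. c \<le> quotient (bergman_kernel \<alpha>) z"
      using c(2) AE_space
    proof eventually_elim
      case (elim z)
      then show ?case using quotient_bounds(1)[where k = "bergman_kernel \<alpha>", OF kernel_L2(1)] by (simp add: b del: mem_ball)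
    qed
    with c(1) show ?thesis by (rule berezin_bounded_below_imp_below_harmonic)
  qed
  have HB_H: "below (harmonic_bergman_space \<alpha>)" if inv: "invertible_Linfty M (harmonic_berezin \<alpha> \<psi>)"
  proof -
    let ?C = "(2 + 2 powr (2 + \<alpha>))\<^sup>2"
    have C: "?C > 0" by (intro zero_less_power add_pos_pos) auto
    obtain c where c: "c > 0" "AE z in M. c \<le> cmod (harmonic_berezin \<alpha> \<psi> z)"
      using invertible_Linfty_bounded_below[OF inv] by blast
    have "AE z in M. c / ?C \<le> quotient (bergman_kernel \<alpha>) z"
      using c(2) AE_space
    proof eventually_elim
      case (elim z)
      then have z: "z \<in> unit_disk" by simp
      have "c \<le> quotient (harmonic_bergman_kernel \<alpha>) z"
        using elim(1) quotient_bounds(1)[where k = "harmonic_bergman_kernel \<alpha>", OF kernel_L2(2)[OF z]] by (simp add: hb)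
      also have "\<dots> \<le> ?C * quotient (bergman_kernel \<alpha>) z" by (rule quotient_harmonic_le[OF z])
      finally show ?case using C by (simp add: pos_divide_le_eq mult.commute)
    qed
    moreover have "c / ?C > 0" using c(1) C by simp
    ultimately show ?thesis using berezin_bounded_below_imp_below_harmonic by blast
  qed
  show "below (bergman_space \<alpha>) \<longleftrightarrow> below (harmonic_bergman_space \<alpha>)"
    using A_B B_H below_harmonic_imp_below by blast
  show "below (harmonic_bergman_space \<alpha>) \<longleftrightarrow> invertible_Linfty M (berezin \<alpha> \<psi>)"
    using A_B B_H below_harmonic_imp_below by blast
  show "invertible_Linfty M (berezin \<alpha> \<psi>) \<longleftrightarrow> invertible_Linfty M (harmonic_berezin \<alpha> \<psi>)"
    using A_B B_H below_harmonic_imp_below H_HB HB_H by blast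
qed

end

theorem corollary4p5:
  fixes \<alpha> :: real and \<phi> :: "complex \<Rightarrow> real"
  assumes "\<alpha> > -1"
    and "\<phi> \<in> borel_measurable (lebesgue_on unit_disk)"
    and "\<forall>z\<in>unit_disk. 0 \<le> \<phi> z"
    and "bounded (\<phi> ` unit_disk)"
  defines "\<psi> \<equiv> (\<lambda>z. complex_of_real (\<phi> z))"
  shows "(invertible_operator_on (weighted_area \<alpha>) (bergman_space \<alpha>) (toeplitz \<alpha> \<psi>) \<longleftrightarrow>
           invertible_operator_on (weighted_area \<alpha>) (harmonic_bergman_space \<alpha>) (harmonic_toeplitz \<alpha> \<psi>))
       \<and> (invertible_operator_on (weighted_area \<alpha>) (harmonic_bergman_space \<alpha>) (harmonic_toeplitz \<alpha> \<psi>) \<longleftrightarrow>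
           invertible_Linfty (weighted_area \<alpha>) (berezin \<alpha> \<psi>))
       \<and> (invertible_Linfty (weighted_area \<alpha>) (berezin \<alpha> \<psi>) \<longleftrightarrow>
           invertible_Linfty (weighted_area \<alpha>) (harmonic_berezin \<alpha> \<psi>))"
proof -
  \<comment> \<open>The bound is taken positive even for a vanishing symbol, since the symbol will
    be divided by it.\<close>
  obtain B where B: "B > 0" "\<And>z. z \<in> unit_disk \<Longrightarrow> \<bar>\<phi> z\<bar> \<le> B"
    using assms(4) by (auto simp: bounded_pos)
  interpret toeplitz_symbol \<alpha> \<phi> B
  proof
    show "\<phi> z \<le> B" if "z \<in> unit_disk" for z using B(2)[OF that] by (rule abs_le_D1)
  qed (use assms B(1) in auto)
  show ?thesis
    unfolding \<psi>_def toeplitz_invertible_iff harmonic_toeplitz_invertible_iff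
    using equivalences by blast
qed

end
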